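(* The parameterized enumeration problem $\mathsf{EnumSimplePaths}_{\ge k}$ — given a directed graph $G$, nodes $s,t$, and parameter $k\in\mathbb N$, enumerate all simple paths from $s$ to $t$ of length at least $k$ — is in FPT delay.
   Context: A simple path has no repeated nodes; length is its number of edges. An enumeration algorithm outputs each answer exactly once; it runs with FPT delay if the time before the first output and between any two consecutive outputs is bounded by $f(k)\cdot|x|^{c}$ for a computable $f$, a constant $c$, and input size $|x|$. *)

theory Defs
  imports Main
begin

datatype instr =
    Const nat nat | Add nat nat nat | Sub nat nat nat
  | Load nat nat | Store nat nat | Jz nat nat | Jmp nat
  | Out nat | Emit | Halt

record conf =
  pc  :: nat
  mem :: "nat \<Rightarrow> nat"
  buf :: "nat list"

fun exec :: "instr \<Rightarrow> conf \<Rightarrow> conf \<times> nat list option" where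
  "exec (Const r c) C = (C\<lparr>pc := Suc (pc C), mem := (mem C)(r := c)\<rparr>, None)"
| "exec (Add r a b) C = (C\<lparr>pc := Suc (pc C), mem := (mem C)(r := mem C a + mem C b)\<rparr>, None)"
| "exec (Sub r a b) C = (C\<lparr>pc := Suc (pc C), mem := (mem C)(r := mem C a - mem C b)\<rparr>, None)"
| "exec (Load r a) C = (C\<lparr>pc := Suc (pc C), mem := (mem C)(r := mem C (mem C a))\<rparr>, None)"
| "exec (Store a r) C = (C\<lparr>pc := Suc (pc C), mem := (mem C)(mem C a := mem C r)\<rparr>, None)"
| "exec (Jz r l) C = (C\<lparr>pc := (if mem C r = 0 then l else Suc (pc C))\<rparr>, None)"
| "exec (Jmp l) C = (C\<lparr>pc := l\<rparr>, None)"
| "exec (Out r) C = (C\<lparr>pc := Suc (pc C), buf := buf C @ [mem C r]\<rparr>, None)"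
| "exec Emit C = (C\<lparr>pc := Suc (pc C), buf := []\<rparr>, Some (buf C))"
| "exec Halt C = (C, None)"

definition halted :: "instr list \<Rightarrow> conf \<Rightarrow> bool" where
  "halted P C \<longleftrightarrow> length P \<le> pc C \<or> P ! pc C = Halt"

definition step :: "instr list \<Rightarrow> conf \<Rightarrow> conf \<times> nat list option" where
  "step P C = (if halted P C then (C, None) else exec (P ! pc C) C)"

definition init_conf :: "nat list \<Rightarrow> conf" where
  "init_conf x = \<lparr>pc = 0,
     mem = (\<lambda>i. if i = 0 then length x else if i \<le> length x then x ! (i - 1) else 0),
     buf = []\<rparr>"

fun conf_at :: "instr list \<Rightarrow> nat list \<Rightarrow> nat \<Rightarrow> conf" where
  "conf_at P x 0 = init_conf x"
| "conf_at P x (Suc n) = fst (step P (conf_at P x n))"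

definition event :: "instr list \<Rightarrow> nat list \<Rightarrow> nat \<Rightarrow> nat list option" where
  "event P x n = snd (step P (conf_at P x n))"

definition outputs_until :: "instr list \<Rightarrow> nat list \<Rightarrow> nat \<Rightarrow> nat list list" where
  "outputs_until P x T = map the (filter (\<lambda>e. e \<noteq> None) (map (event P x) [0..<T]))"

text \<open>P enumerates the set S on input x with delay at most B: it halts, outputs every element
  of S exactly once and nothing else, and every stretch of computation steps without an output
  (before the first output, between two consecutive outputs, and after the last output until
  termination) has length at most B.\<close>
definition enumerates_with_delay ::
  "instr list \<Rightarrow> nat list \<Rightarrow> nat list set \<Rightarrow> nat \<Rightarrow> bool" where
  "enumerates_with_delay P x S B \<longleftrightarrow>
     (\<exists>T. halted P (conf_at P x T) \<and>
          distinct (outputs_until P x T) \<and> set (outputs_until P x T) = S \<and>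
          (\<forall>i j. i \<le> j \<and> j \<le> T \<and> (\<forall>l\<in>{i..<j}. event P x l = None) \<longrightarrow> j - i \<le> B))"

definition computable :: "(nat \<Rightarrow> nat) \<Rightarrow> bool" where
  "computable f \<longleftrightarrow> (\<exists>P. \<forall>k. \<exists>T. halted P (conf_at P [k] T) \<and> outputs_until P [k] T = [[f k]])"

text \<open>A directed graph on node set {0..<n} with edge list es (pairs (u,v) = edge u -> v).\<close>
definition wf_graph :: "nat \<Rightarrow> (nat \<times> nat) list \<Rightarrow> bool" where
  "wf_graph n es \<longleftrightarrow> (\<forall>(u, v) \<in> set es. u < n \<and> v < n)"

definition simple_path :: "nat \<Rightarrow> (nat \<times> nat) list \<Rightarrow> nat \<Rightarrow> nat \<Rightarrow> nat list \<Rightarrow> bool" where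
  "simple_path n es s t p \<longleftrightarrow>
     p \<noteq> [] \<and> hd p = s \<and> last p = t \<and> distinct p \<and> set p \<subseteq> {0..<n} \<and>
     (\<forall>i. Suc i < length p \<longrightarrow> (p ! i, p ! Suc i) \<in> set es)"

definition path_length :: "nat list \<Rightarrow> nat" where
  "path_length p = length p - 1"

definition encode :: "nat \<Rightarrow> (nat \<times> nat) list \<Rightarrow> nat \<Rightarrow> nat \<Rightarrow> nat \<Rightarrow> nat list" where
  "encode n es s t k = [n, s, t, k] @ concat (map (\<lambda>(u, v). [u, v]) es)"

definition inst_size :: "nat \<Rightarrow> (nat \<times> nat) list \<Rightarrow> nat \<Rightarrow> nat \<Rightarrow> nat \<Rightarrow> nat" where
  "inst_size n es s t k = length (encode n es s t k) + n"

definition answers :: "nat \<Rightarrow> (nat \<times> nat) list \<Rightarrow> nat \<Rightarrow> nat \<Rightarrow> nat \<Rightarrow> nat list set" where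
  "answers n es s t k = {p. simple_path n es s t p \<and> k \<le> path_length p}"

end

theory Submission
  imports Defs
begin

text \<open>The answers are enumerated by depth-first search over path prefixes, entering only those
  prefixes that extend to an answer; since every dead end is detected in advance, only polynomially
  many tests lie between two outputs. The test asks, for the graph without the prefix, whether
  there is a simple path of length at least k from the current vertex c to t. For each vertex v,
  a family of k-edge paths from c to v is kept that represents all such paths with respect to
  avoiding any k further vertices (Monien's representative families, grown edge by edge), and it is
  checked whether t can be reached from v without touching some member of the family. For a
  shortest solution, a representative avoiding its last k vertices avoids the whole rest of it.

  The machine program is obtained by compiling a small functional language over numbers and cons
  cells whose only loops run over a list or a counter, with an exact cost semantics.\<close>

section \<open>Runs of the machine and a functional language\<close>

text \<open>Reachability alone cannot tell whether a prefix extends, because the rest has to be both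
  simple and long. Only its first k + 1 vertices need care: if they do not block the remainder,
  reachability around them completes the path. They have to avoid the last k vertices of a shortest
  solution, and while the families grow edge by edge every vertex split off at the end has to be
  avoided as well. So all families are built for 2k forbidden vertices; for paths of at most k + 1
  vertices this gives search trees of size at most (k + 2)^(2k + 1), from which the dependence on
  the parameter comes. With M = |x| (k + 2)^(2k + 1), one test costs O(M^7) and O(M^2) tests lie
  between two outputs, hence the exponent 9. Since delay is counted in single instructions and also
  up to halting, costs are exact and the search carries a potential bounding the rounds until the
  next output or the end. The factor f is doubly exponential because two nested doubling loops
  compute such a number.\<close>

fun run :: "instr list \<Rightarrow> conf \<Rightarrow> nat list option list \<Rightarrow> conf \<Rightarrow> bool" where
  "run Pr C [] C' \<longleftrightarrow> C' = C"
| "run Pr C (e # es) C' \<longleftrightarrow> snd (step Pr C) = e \<and> run Pr (fst (step Pr C)) es C'"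

lemma run_append:
  "run Pr C (xs @ ys) C' \<longleftrightarrow> (\<exists>C1. run Pr C xs C1 \<and> run Pr C1 ys C')"
  by (induction xs arbitrary: C) auto

text \<open>Holding for every buffer, a fact about expression code never has to mention the buffer.
  The number \<open>n\<close> is an exact running time, not a bound.\<close>

definition silent :: "instr list \<Rightarrow> nat \<Rightarrow> nat \<Rightarrow> (nat \<Rightarrow> nat) \<Rightarrow> nat \<Rightarrow> (nat \<Rightarrow> nat) \<Rightarrow> bool" where
  "silent Pr n a m a' m' \<longleftrightarrow>
     (\<forall>b. run Pr \<lparr>pc = a, mem = m, buf = b\<rparr> (replicate n None) \<lparr>pc = a', mem = m', buf = b\<rparr>)"

lemma silent_refl [simp]: "silent Pr 0 a m a m"
  by (simp add: silent_def)

lemma silent_trans: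
  "silent Pr i a m b m1 \<Longrightarrow> silent Pr j b m1 c m2 \<Longrightarrow> silent Pr (i + j) a m c m2"
  by (force simp: silent_def replicate_add run_append)

definition ins_at :: "instr list \<Rightarrow> nat \<Rightarrow> instr \<Rightarrow> bool" where
  "ins_at Pr a i \<longleftrightarrow> a < length Pr \<and> Pr ! a = i"

fun code_at :: "instr list \<Rightarrow> nat \<Rightarrow> instr list \<Rightarrow> bool" where
  "code_at Pr a [] \<longleftrightarrow> True"
| "code_at Pr a (i # is) \<longleftrightarrow> ins_at Pr a i \<and> code_at Pr (Suc a) is"

lemma code_at_append [simp]:
  "code_at Pr a (xs @ ys) \<longleftrightarrow> code_at Pr a xs \<and> code_at Pr (a + length xs) ys"
  by (induction xs arbitrary: a) auto

lemma code_at_self: "code_at (us @ xs @ vs) (length us) xs"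
proof (induction xs arbitrary: us)
  case (Cons x xs)
  from Cons[of "us @ [x]"] show ?case by (simp add: ins_at_def)
qed simp

text \<open>Each of these rules peels off the first instruction and leaves the rest of the run as
  its last premise; applied in program order they execute straight-line code symbolically.\<close>

lemma silent_Const:
  "ins_at Pr a (Const r c) \<Longrightarrow> silent Pr n (Suc a) (m(r := c)) b m' \<Longrightarrow> silent Pr (Suc n) a m b m'"
  by (auto simp: silent_def ins_at_def step_def halted_def)

lemma silent_Add:
  "ins_at Pr a (Add r x y) \<Longrightarrow> silent Pr n (Suc a) (m(r := m x + m y)) b m' \<Longrightarrow> silent Pr (Suc n) a m b m'"
  by (auto simp: silent_def ins_at_def step_def halted_def)

lemma silent_Sub:
  "ins_at Pr a (Sub r x y) \<Longrightarrow> silent Pr n (Suc a) (m(r := m x - m y)) b m' \<Longrightarrow> silent Pr (Suc n) a m b m'"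
  by (auto simp: silent_def ins_at_def step_def halted_def)

lemma silent_Load:
  "ins_at Pr a (Load r x) \<Longrightarrow> silent Pr n (Suc a) (m(r := m (m x))) b m' \<Longrightarrow> silent Pr (Suc n) a m b m'"
  by (auto simp: silent_def ins_at_def step_def halted_def)

lemma silent_Store:
  "ins_at Pr a (Store x r) \<Longrightarrow> silent Pr n (Suc a) (m(m x := m r)) b m' \<Longrightarrow> silent Pr (Suc n) a m b m'"
  by (auto simp: silent_def ins_at_def step_def halted_def)

lemma silent_Jmp:
  "ins_at Pr a (Jmp l) \<Longrightarrow> silent Pr n l m b m' \<Longrightarrow> silent Pr (Suc n) a m b m'"
  by (auto simp: silent_def ins_at_def step_def halted_def)

lemma silent_Jz:
  "ins_at Pr a (Jz r l) \<Longrightarrow> silent Pr n (if m r = 0 then l else Suc a) m b m' \<Longrightarrow> silent Pr (Suc n) a m b m'"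
  by (auto simp: silent_def ins_at_def step_def halted_def)

section \<open>A typed functional language and its cost semantics\<close>

datatype val = N nat | P val val

text \<open>Machine words carry no tags, so a number and a pointer look alike. Typing excludes the
  situations in which the default values of \<open>num\<close>, \<open>vhd\<close> and
  \<open>vtl\<close> would differ from what the machine computes. The value \<open>N 0\<close> is
  the null pointer and belongs to every type.\<close>

datatype ty = TNat | TPair ty ty | TList ty

text \<open>Variables are de Bruijn levels. The second operand of a binary operation is evaluated with
  the value of the first one pushed, so that the environment always fills the registers below the
  one that receives the result; this leaves the levels of free variables unchanged.
  ELocal runs an expression that sees the topmost variables only.\<close>
datatype exp =
    EVar nat | ENum nat | ENil ty | EAdd exp exp | ESub exp exp
  | ECons exp exp | EHd exp | ETl exp | EIf exp exp exp | ELet exp exp | ELocal nat exp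
  | EFold exp exp exp | EIter exp exp exp

fun num :: "val \<Rightarrow> nat" where
  "num (N n) = n" | "num (P x y) = 0"

fun vhd :: "val \<Rightarrow> val" where
  "vhd (N n) = N 0" | "vhd (P x y) = x"

fun vtl :: "val \<Rightarrow> val" where
  "vtl (N n) = N 0" | "vtl (P x y) = y"

text \<open>The body also sees the cells not yet processed, since the loop pointer sits in a
  register below the accumulator and so belongs to the environment. The same holds for the counter
  of \<open>viter\<close>, which runs down to 1.\<close>

fun vfold :: "(val \<Rightarrow> val \<Rightarrow> val \<Rightarrow> val) \<Rightarrow> val \<Rightarrow> val \<Rightarrow> val" where
  "vfold g (N n) a = a"
| "vfold g (P x y) a = vfold g y (g (P x y) a x)"

fun viter :: "(val \<Rightarrow> val \<Rightarrow> val) \<Rightarrow> nat \<Rightarrow> val \<Rightarrow> val" where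
  "viter g 0 a = a"
| "viter g (Suc n) a = viter g n (g (N (Suc n)) a)"

primrec eval :: "exp \<Rightarrow> val list \<Rightarrow> val" where
  "eval (EVar i) = (\<lambda>env. env ! i)"
| "eval (ENum c) = (\<lambda>env. N c)"
| "eval (ENil t) = (\<lambda>env. N 0)"
| "eval (EAdd e f) = (\<lambda>env. N (num (eval e env) + num (eval f (env @ [eval e env]))))"
| "eval (ESub e f) = (\<lambda>env. N (num (eval e env) - num (eval f (env @ [eval e env]))))"
| "eval (ECons e f) = (\<lambda>env. P (eval e env) (eval f (env @ [eval e env])))"
| "eval (EHd e) = (\<lambda>env. vhd (eval e env))"
| "eval (ETl e) = (\<lambda>env. vtl (eval e env))"
| "eval (EIf c e f) = (\<lambda>env. if eval c env = N 0 then eval f env else eval e env)"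
| "eval (ELet e f) = (\<lambda>env. eval f (env @ [eval e env]))"
| "eval (ELocal k e) = (\<lambda>env. eval e (drop (length env - k) env))"
| "eval (EFold l i b) = (\<lambda>env. vfold (\<lambda>r a x. eval b (env @ [r, a, x]))
     (eval l env) (eval i (env @ [eval l env])))"
| "eval (EIter n i b) = (\<lambda>env. viter (\<lambda>c a. eval b (env @ [c, a]))
     (num (eval n env)) (eval i (env @ [eval n env])))"

text \<open>The constants count the loop instructions of the compiled code. A round of a fold has
  two before the body (\<open>Jz\<close>, \<open>Load\<close>) and four after it, leaving costs a
  \<open>Jz\<close> and a move; a round of an iteration has one before the body and three after
  it.\<close>

fun vfold_time :: "(val \<Rightarrow> val \<Rightarrow> val \<Rightarrow> val) \<Rightarrow> (val \<Rightarrow> val \<Rightarrow> val \<Rightarrow> nat) \<Rightarrow> val \<Rightarrow> val \<Rightarrow> nat" where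
  "vfold_time g t (N n) a = 2"
| "vfold_time g t (P x y) a = t (P x y) a x + 6 + vfold_time g t y (g (P x y) a x)"

fun viter_time :: "(val \<Rightarrow> val \<Rightarrow> val) \<Rightarrow> (val \<Rightarrow> val \<Rightarrow> nat) \<Rightarrow> nat \<Rightarrow> val \<Rightarrow> nat" where
  "viter_time g t 0 a = 2"
| "viter_time g t (Suc n) a = t (N (Suc n)) a + 4 + viter_time g t n (g (N (Suc n)) a)"

primrec tm :: "exp \<Rightarrow> val list \<Rightarrow> nat" where
  "tm (EVar i) = (\<lambda>env. 1)"
| "tm (ENum c) = (\<lambda>env. 1)"
| "tm (ENil t) = (\<lambda>env. 1)"
| "tm (EAdd e f) = (\<lambda>env. tm e env + tm f (env @ [eval e env]) + 1)"
| "tm (ESub e f) = (\<lambda>env. tm e env + tm f (env @ [eval e env]) + 1)"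
| "tm (ECons e f) = (\<lambda>env. tm e env + tm f (env @ [eval e env]) + 5)"
| "tm (EHd e) = (\<lambda>env. tm e env + 1)"
| "tm (ETl e) = (\<lambda>env. tm e env + 2)"
| "tm (EIf c e f) = (\<lambda>env. tm c env + 1 + (if eval c env = N 0 then tm f env else tm e env + 1))"
| "tm (ELet e f) = (\<lambda>env. tm e env + tm f (env @ [eval e env]) + 1)"
| "tm (ELocal k e) = (\<lambda>env. tm e (drop (length env - k) env))"
| "tm (EFold l i b) = (\<lambda>env. tm l env + tm i (env @ [eval l env]) +
     vfold_time (\<lambda>r a x. eval b (env @ [r, a, x])) (\<lambda>r a x. tm b (env @ [r, a, x]))
     (eval l env) (eval i (env @ [eval l env])))"
| "tm (EIter n i b) = (\<lambda>env. tm n env + tm i (env @ [eval n env]) +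
     viter_time (\<lambda>c a. eval b (env @ [c, a])) (\<lambda>c a. tm b (env @ [c, a]))
     (num (eval n env)) (eval i (env @ [eval n env])))"

fun vty :: "val \<Rightarrow> ty \<Rightarrow> bool" where
  "vty (N n) TNat \<longleftrightarrow> True"
| "vty (N n) (TPair a b) \<longleftrightarrow> n = 0"
| "vty (N n) (TList a) \<longleftrightarrow> n = 0"
| "vty (P x y) TNat \<longleftrightarrow> False"
| "vty (P x y) (TPair a b) \<longleftrightarrow> vty x a \<and> vty y b"
| "vty (P x y) (TList a) \<longleftrightarrow> vty x a \<and> vty y (TList a)"

text \<open>Lists and pairs share the constructor \<open>ECons\<close>. A cell whose tail is a list
  over the type of its head is taken for a list; head and tail receive the same types under either
  reading.\<close>

primrec infer :: "exp \<Rightarrow> ty list \<Rightarrow> ty option" where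
  "infer (EVar i) = (\<lambda>G. if i < length G then Some (G ! i) else None)"
| "infer (ENum c) = (\<lambda>G. Some TNat)"
| "infer (ENil t) = (\<lambda>G. Some t)"
| "infer (EAdd e f) = (\<lambda>G. if infer e G = Some TNat \<and> infer f (G @ [TNat]) = Some TNat then Some TNat else None)"
| "infer (ESub e f) = (\<lambda>G. if infer e G = Some TNat \<and> infer f (G @ [TNat]) = Some TNat then Some TNat else None)"
| "infer (ECons e f) = (\<lambda>G. case infer e G of None \<Rightarrow> None | Some a \<Rightarrow>
     (case infer f (G @ [a]) of None \<Rightarrow> None | Some b \<Rightarrow> Some (if b = TList a then TList a else TPair a b)))"
| "infer (EHd e) = (\<lambda>G. case infer e G of Some (TList a) \<Rightarrow> Some a | Some (TPair a b) \<Rightarrow> Some a | _ \<Rightarrow> None)"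
| "infer (ETl e) = (\<lambda>G. case infer e G of Some (TList a) \<Rightarrow> Some (TList a) | Some (TPair a b) \<Rightarrow> Some b | _ \<Rightarrow> None)"
| "infer (EIf c e f) = (\<lambda>G. if infer c G \<noteq> None \<and> infer e G = infer f G then infer e G else None)"
| "infer (ELet e f) = (\<lambda>G. case infer e G of None \<Rightarrow> None | Some a \<Rightarrow> infer f (G @ [a]))"
| "infer (ELocal k e) = (\<lambda>G. if k \<le> length G then infer e (drop (length G - k) G) else None)"
| "infer (EFold l i b) = (\<lambda>G. case infer l G of Some (TList t) \<Rightarrow>
     (case infer i (G @ [TList t]) of None \<Rightarrow> None | Some a \<Rightarrow>
       if infer b (G @ [TList t, a, t]) = Some a then Some a else None) | _ \<Rightarrow> None)"
| "infer (EIter n i b) = (\<lambda>G. if infer n G = Some TNat then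
     (case infer i (G @ [TNat]) of None \<Rightarrow> None | Some a \<Rightarrow>
       if infer b (G @ [TNat, a]) = Some a then Some a else None) else None)"

lemma vty_N0 [simp]: "vty (N 0) t"
  by (cases t) auto

lemma vty_NatD: "vty v TNat \<Longrightarrow> \<exists>n. v = N n"
  by (cases v) auto

lemma vty_vhd: "vty v (TList a) \<Longrightarrow> vty (vhd v) a" "vty v (TPair a b) \<Longrightarrow> vty (vhd v) a"
  by (cases v; simp)+

lemma vty_vtl: "vty v (TList a) \<Longrightarrow> vty (vtl v) (TList a)" "vty v (TPair a b) \<Longrightarrow> vty (vtl v) b"
  by (cases v; simp)+

lemma vty_vfold:
  assumes "vty l (TList t)" "vty i a"
    "\<And>r u x. vty r (TList t) \<Longrightarrow> vty u a \<Longrightarrow> vty x t \<Longrightarrow> vty (g r u x) a"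
  shows "vty (vfold g l i) a"
  using assms(1,2)
proof (induction l arbitrary: i)
  case (P x y)
  then have "vty (g (P x y) i x) a" by (intro assms(3)) auto
  with P show ?case by simp
qed simp

lemma vty_viter:
  assumes "vty i a" "\<And>c u. vty u a \<Longrightarrow> vty (g (N c) u) a"
  shows "vty (viter g n i) a"
  using assms(1) by (induction n arbitrary: i) (auto intro: assms(2))

lemma infer_sound:
  "infer e G = Some t \<Longrightarrow> list_all2 vty env G \<Longrightarrow> vty (eval e env) t"
proof (induction e arbitrary: G t env)
  case (EVar i)
  then show ?case by (auto simp: list_all2_conv_all_nth split: if_splits)
next
  case (ECons e f)
  then obtain a b where ab: "infer e G = Some a" "infer f (G @ [a]) = Some b"
    "t = (if b = TList a then TList a else TPair a b)"
    by (auto split: option.splits)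
  have e: "vty (eval e env) a" using ECons ab by blast
  have "vty (eval f (env @ [eval e env])) b"
    using ECons.IH(2)[OF ab(2)] e ECons.prems(2) by (simp add: list_all2_appendI)
  with e ab(3) show ?case by (cases "b = TList a") simp_all
next
  case (EHd e)
  then show ?case by (fastforce split: option.splits ty.splits intro: vty_vhd)
next
  case (ETl e)
  then show ?case by (fastforce split: option.splits ty.splits intro: vty_vtl)
next
  case (EIf c e f)
  then show ?case by (auto split: if_splits)
next
  case (ELet e f)
  then obtain a where a: "infer e G = Some a" "infer f (G @ [a]) = Some t"
    by (auto split: option.splits)
  have e: "vty (eval e env) a" using ELet a by blast
  show ?case using ELet.IH(2)[OF a(2)] e ELet.prems(2) by (simp add: list_all2_appendI)
next
  case (ELocal k e)
  from ELocal.prems(2) have "length env = length G" by (rule list_all2_lengthD)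
  with ELocal show ?case by (auto split: if_splits intro!: list_all2_dropI)
next
  case (EFold l i b)
  then obtain s where s: "infer l G = Some (TList s)" "infer i (G @ [TList s]) = Some t"
    "infer b (G @ [TList s, t, s]) = Some t"
    by (auto split: option.splits ty.splits if_splits)
  have l: "vty (eval l env) (TList s)" using EFold s by blast
  have i: "vty (eval i (env @ [eval l env])) t"
    using EFold.IH(2)[OF s(2)] l EFold.prems(2) by (simp add: list_all2_appendI)
  show ?case
    using EFold.IH(3)[OF s(3)] EFold.prems(2)
    by (auto intro!: vty_vfold[OF l i] simp: list_all2_appendI)
next
  case (EIter n i b)
  then have s: "infer n G = Some TNat" "infer i (G @ [TNat]) = Some t"
    "infer b (G @ [TNat, t]) = Some t"
    by (auto split: option.splits ty.splits if_splits)
  have l: "vty (eval n env) TNat" using EIter s by blast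
  have i: "vty (eval i (env @ [eval n env])) t"
    using EIter.IH(2)[OF s(2)] l EIter.prems(2) by (simp add: list_all2_appendI)
  show ?case
    using EIter.IH(3)[OF s(3)] EIter.prems(2)
    by (auto intro!: vty_viter[OF i] simp: list_all2_appendI)
qed (auto split: if_splits option.splits)

section \<open>Code generation and register use\<close>

primrec clen :: "exp \<Rightarrow> nat" where
  "clen (EVar i) = 1"
| "clen (ENum c) = 1"
| "clen (ENil t) = 1"
| "clen (EAdd e f) = clen e + clen f + 1"
| "clen (ESub e f) = clen e + clen f + 1"
| "clen (ECons e f) = clen e + clen f + 5"
| "clen (EHd e) = clen e + 1"
| "clen (ETl e) = clen e + 2"
| "clen (EIf c e f) = clen c + clen e + clen f + 2"
| "clen (ELet e f) = clen e + clen f + 1"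
| "clen (ELocal k e) = clen e"
| "clen (EFold l i b) = clen l + clen i + clen b + 7"
| "clen (EIter n i b) = clen n + clen i + clen b + 5"

text \<open>Registers 0 and 1 hold zero, so that the null pointer has null components; register 2 holds
  one, register 3 the first free heap address, and register 4 is scratch. The code for an
  expression finds its environment in registers b to d - 1, starts at address a, and leaves its
  result in register d.\<close>
primrec compile :: "exp \<Rightarrow> nat \<Rightarrow> nat \<Rightarrow> nat \<Rightarrow> instr list" where
  "compile (EVar i) = (\<lambda>b d a. [Add d (b + i) 0])"
| "compile (ENum c) = (\<lambda>b d a. [Const d c])"
| "compile (ENil t) = (\<lambda>b d a. [Const d 0])"
| "compile (EAdd e f) = (\<lambda>b d a. compile e b d a @ compile f b (d + 1) (a + clen e) @ [Add d d (d + 1)])"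
| "compile (ESub e f) = (\<lambda>b d a. compile e b d a @ compile f b (d + 1) (a + clen e) @ [Sub d d (d + 1)])"
| "compile (ECons e f) = (\<lambda>b d a. compile e b d a @ compile f b (d + 1) (a + clen e) @
     [Store 3 d, Add 4 3 2, Store 4 (d + 1), Add d 3 0, Add 3 4 2])"
| "compile (EHd e) = (\<lambda>b d a. compile e b d a @ [Load d d])"
| "compile (ETl e) = (\<lambda>b d a. compile e b d a @ [Add d d 2, Load d d])"
| "compile (EIf c e f) = (\<lambda>b d a. compile c b d a @ [Jz d (a + clen c + clen e + 2)] @
     compile e b d (a + clen c + 1) @ [Jmp (a + clen c + clen e + clen f + 2)] @
     compile f b d (a + clen c + clen e + 2))"
| "compile (ELet e f) = (\<lambda>b d a. compile e b d a @ compile f b (d + 1) (a + clen e) @ [Add d (d + 1) 0])"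
| "compile (ELocal k e) = (\<lambda>b d a. compile e (d - k) d a)"
| "compile (EFold l i e) = (\<lambda>b d a. compile l b d a @ compile i b (d + 1) (a + clen l) @
     [Jz d (a + clen l + clen i + clen e + 6), Load (d + 2) d] @
     compile e b (d + 3) (a + clen l + clen i + 2) @
     [Add (d + 1) (d + 3) 0, Add d d 2, Load d d, Jmp (a + clen l + clen i), Add d (d + 1) 0])"
| "compile (EIter n i e) = (\<lambda>b d a. compile n b d a @ compile i b (d + 1) (a + clen n) @
     [Jz d (a + clen n + clen i + clen e + 4)] @
     compile e b (d + 2) (a + clen n + clen i + 1) @
     [Add (d + 1) (d + 2) 0, Sub d d 2, Jmp (a + clen n + clen i), Add d (d + 1) 0])"

lemma length_comp [simp]: "length (compile e b d a) = clen e"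
  by (induction e arbitrary: b d a) auto

text \<open>The heap base \<open>R\<close> is later chosen above this number, so that registers and
  heap cells never overlap.\<close>

primrec maxreg :: "exp \<Rightarrow> nat \<Rightarrow> nat" where
  "maxreg (EVar i) = (\<lambda>d. d)"
| "maxreg (ENum c) = (\<lambda>d. d)"
| "maxreg (ENil t) = (\<lambda>d. d)"
| "maxreg (EAdd e f) = (\<lambda>d. max (maxreg e d) (maxreg f (d + 1)))"
| "maxreg (ESub e f) = (\<lambda>d. max (maxreg e d) (maxreg f (d + 1)))"
| "maxreg (ECons e f) = (\<lambda>d. max (maxreg e d) (maxreg f (d + 1)))"
| "maxreg (EHd e) = maxreg e"
| "maxreg (ETl e) = maxreg e"
| "maxreg (EIf c e f) = (\<lambda>d. max (maxreg c d) (max (maxreg e d) (maxreg f d)))"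
| "maxreg (ELet e f) = (\<lambda>d. max (maxreg e d) (maxreg f (d + 1)))"
| "maxreg (ELocal k e) = maxreg e"
| "maxreg (EFold l i e) = (\<lambda>d. max (maxreg l d) (max (maxreg i (d + 1)) (maxreg e (d + 3))))"
| "maxreg (EIter n i e) = (\<lambda>d. max (maxreg n d) (max (maxreg i (d + 1)) (maxreg e (d + 2))))"

lemma maxreg_ge: "d \<le> maxreg e d"
proof (induction e arbitrary: d)
  case (EAdd e f) then show ?case by (simp add: le_max_iff_disj)
next
  case (ESub e f) then show ?case by (simp add: le_max_iff_disj)
next
  case (ECons e f) then show ?case by (simp add: le_max_iff_disj)
next
  case (EIf c e f) then show ?case by (simp add: le_max_iff_disj)
next
  case (ELet e f) then show ?case by (simp add: le_max_iff_disj)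
next
  case (EFold l i e) then show ?case by (simp add: le_max_iff_disj)
next
  case (EIter n i e) then show ?case by (simp add: le_max_iff_disj)
qed auto

section \<open>Representation of values in memory\<close>

fun repr :: "nat \<Rightarrow> (nat \<Rightarrow> nat) \<Rightarrow> nat \<Rightarrow> val \<Rightarrow> bool" where
  "repr R m w (N n) \<longleftrightarrow> w = n"
| "repr R m w (P x y) \<longleftrightarrow> R \<le> w \<and> Suc w < m 3 \<and> repr R m (m w) x \<and> repr R m (m (Suc w)) y"

definition good :: "nat \<Rightarrow> (nat \<Rightarrow> nat) \<Rightarrow> bool" where
  "good R m \<longleftrightarrow> 5 \<le> R \<and> R \<le> m 3 \<and> m 0 = 0 \<and> m 1 = 0 \<and> m 2 = 1"

definition extends :: "nat \<Rightarrow> (nat \<Rightarrow> nat) \<Rightarrow> (nat \<Rightarrow> nat) \<Rightarrow> bool" where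
  "extends R m m' \<longleftrightarrow> m 3 \<le> m' 3 \<and> (\<forall>i. R \<le> i \<and> i < m 3 \<longrightarrow> m' i = m i)"

text \<open>The range starts at 5 because cells 0 to 2 are constants governed by
  \<open>good\<close>, while cells 3 and 4 change with every allocation.\<close>

definition keeps :: "nat \<Rightarrow> (nat \<Rightarrow> nat) \<Rightarrow> (nat \<Rightarrow> nat) \<Rightarrow> bool" where
  "keeps d m m' \<longleftrightarrow> (\<forall>i. 5 \<le> i \<and> i < d \<longrightarrow> m' i = m i)"

definition env_repr :: "nat \<Rightarrow> (nat \<Rightarrow> nat) \<Rightarrow> nat \<Rightarrow> val list \<Rightarrow> bool" where
  "env_repr R m b env \<longleftrightarrow> (\<forall>i<length env. repr R m (m (b + i)) (env ! i))"

lemma extends_refl [simp]: "extends R m m"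
  by (simp add: extends_def)

lemma extends_trans: "extends R m m1 \<Longrightarrow> extends R m1 m2 \<Longrightarrow> extends R m m2"
  by (simp add: extends_def)

lemma keeps_refl [simp]: "keeps d m m"
  by (simp add: keeps_def)

lemma keeps_trans: "keeps d m m1 \<Longrightarrow> keeps d' m1 m2 \<Longrightarrow> d \<le> d' \<Longrightarrow> keeps d m m2"
  by (simp add: keeps_def)

lemma keeps_mono: "keeps d' m m2 \<Longrightarrow> d \<le> d' \<Longrightarrow> keeps d m m2"
  by (simp add: keeps_def)

text \<open>Heap cells are immutable: a represented value lies entirely between \<open>R\<close> and
  the free pointer, which is exactly the range that \<open>extends\<close> protects.\<close>

lemma repr_extends: "repr R m w v \<Longrightarrow> extends R m m' \<Longrightarrow> repr R m' w v"
  by (induction v arbitrary: w) (auto simp: extends_def)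

lemma env_repr_extends:
  "env_repr R m b env \<Longrightarrow> extends R m m' \<Longrightarrow> keeps d m m' \<Longrightarrow> b + length env \<le> d \<Longrightarrow> 5 \<le> b \<Longrightarrow>
    env_repr R m' b env"
  unfolding env_repr_def keeps_def by (auto intro: repr_extends)

lemma env_repr_snoc:
  "env_repr R m b (env @ [v]) \<longleftrightarrow> env_repr R m b env \<and> repr R m (m (b + length env)) v"
  by (auto simp: env_repr_def nth_append less_Suc_eq)

lemma good_reg: "good R m \<Longrightarrow> 5 \<le> d \<Longrightarrow> good R (m(d := w))"
  by (simp add: good_def)

lemma extends_reg: "5 \<le> d \<Longrightarrow> d < R \<Longrightarrow> extends R m (m(d := w))"
  by (simp add: extends_def)

lemma keeps_reg: "d \<le> d' \<Longrightarrow> keeps d m (m(d' := w))"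
  by (simp add: keeps_def)

definition computes :: "instr list \<Rightarrow> nat \<Rightarrow> nat \<Rightarrow> nat \<Rightarrow> (nat \<Rightarrow> nat) \<Rightarrow> nat \<Rightarrow> nat \<Rightarrow> val \<Rightarrow> bool" where
  "computes Pr R t a m a' d v \<longleftrightarrow>
     (\<exists>m'. silent Pr t a m a' m' \<and> good R m' \<and> extends R m m' \<and> keeps d m m' \<and> repr R m' (m' d) v)"

section \<open>Compilation\<close>

lemma computes_combine:
  assumes "silent Pr t1 a m a1 m1" "good R m1" "extends R m m1" "keeps d m m1"
    and "computes Pr R t2 a1 m1 a' d v"
  shows "computes Pr R (t1 + t2) a m a' d v"
  using assms unfolding computes_def
  by (meson silent_trans extends_trans keeps_trans order_refl)

lemma computes_finish:
  assumes "silent Pr t a m a' m'" "good R m'" "extends R m m'" "keeps d m m'" "repr R m' (m' d) v"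
  shows "computes Pr R t a m a' d v"
  using assms unfolding computes_def by blast

text \<open>The predicate \<open>I\<close> stands for the representation of the surrounding
  environment. It only has to survive heap growth and changes of registers from \<open>d\<close> on,
  which keeps the loop argument independent of environments. The typing premises guarantee that the
  body is only ever run on well-typed values.\<close>

lemma fold_loop:
  assumes g: "5 \<le> d" "Suc (Suc d) < R"
    and code: "ins_at Pr a (Jz d z)" "ins_at Pr (Suc a) (Load (d + 2) d)"
      "ins_at Pr a' (Add (d + 1) (d + 3) 0)" "ins_at Pr (Suc a') (Add d d 2)"
      "ins_at Pr (Suc (Suc a')) (Load d d)" "ins_at Pr (Suc (Suc (Suc a'))) (Jmp a)"
      "ins_at Pr z (Add d (d + 1) 0)"
    and body: "\<And>m x y u. good R m \<Longrightarrow> I m \<Longrightarrow> repr R m (m d) (P x y) \<Longrightarrow> repr R m (m (d + 1)) u \<Longrightarrow>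
      repr R m (m (d + 2)) x \<Longrightarrow> vty (P x y) (TList s) \<Longrightarrow> vty u t \<Longrightarrow>
      computes Pr R (c (P x y) u x) (a + 2) m a' (d + 3) (f (P x y) u x)"
    and ty: "\<And>x y u. vty (P x y) (TList s) \<Longrightarrow> vty u t \<Longrightarrow> vty (f (P x y) u x) t"
    and I: "\<And>m m'. I m \<Longrightarrow> extends R m m' \<Longrightarrow> keeps d m m' \<Longrightarrow> I m'"
    and "good R m" "I m" "repr R m (m d) l" "repr R m (m (d + 1)) u" "vty l (TList s)" "vty u t"
  shows "computes Pr R (vfold_time f c l u) a m (Suc z) d (vfold f l u)"
  using assms(13-)
proof (induction l arbitrary: m u)
  case (N n)
  then have n: "m d = 0" by simp
  have "silent Pr 2 a m (Suc z) (m(d := m (d + 1) + m 0))"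
    unfolding numeral_2_eq_2
    by (rule silent_Jz[OF code(1)], subst if_P, rule n, rule silent_Add[OF code(7)], rule silent_refl)
  then show ?case using N g
    by (auto intro!: computes_finish good_reg extends_reg keeps_reg
        repr_extends[where m = m and R = R and m' = "m(d := m (Suc d))"] simp: good_def)
next
  case (P x y)
  from P.prems have x: "R \<le> m d" "Suc (m d) < m 3" "repr R m (m (m d)) x" "repr R m (m (Suc (m d))) y"
    by auto
  let ?m1 = "m(d + 2 := m (m d))"
  have e1: "extends R m ?m1" "keeps d m ?m1" using g by (auto intro: extends_reg keeps_reg)
  have "computes Pr R (c (P x y) u x) (a + 2) ?m1 a' (d + 3) (f (P x y) u x)"
  proof (rule body)
    show "repr R ?m1 (?m1 d) (P x y)" using repr_extends[OF P.prems(3) e1(1)] by simp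
    show "repr R ?m1 (?m1 (d + 1)) u" using repr_extends[OF P.prems(4) e1(1)] by simp
    show "repr R ?m1 (?m1 (d + 2)) x" using repr_extends[OF x(3) e1(1)] by simp
  qed (use P.prems e1 g in \<open>auto intro: good_reg I\<close>)
  then obtain m2 where m2: "silent Pr (c (P x y) u x) (a + 2) ?m1 a' m2" "good R m2"
    "extends R ?m1 m2" "keeps (d + 3) ?m1 m2" "repr R m2 (m2 (d + 3)) (f (P x y) u x)"
    unfolding computes_def by blast
  have e2: "extends R m m2" "keeps d m m2"
    using extends_trans[OF e1(1) m2(3)] keeps_trans[OF e1(2) m2(4)] by simp_all
  have d2: "m2 d = m d" using m2(4) g by (simp add: keeps_def)
  \<comment> \<open>The tail is loaded only after the body has run; it is still the old one because
    its cell lies in the protected part of the heap.\<close>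
  have h2: "m2 (Suc (m d)) = m (Suc (m d))" using e2(1) x by (simp add: extends_def)
  let ?m3 = "m2(d + 1 := m2 (d + 3), d := m (Suc (m d)))"
  have good2: "m2 0 = 0" "m2 2 = 1" "R \<le> m2 3" using m2(2) by (auto simp: good_def)
  have d1: "Suc (m d) \<noteq> d" "Suc (m d) \<noteq> Suc d" using x(1) g by auto
  have n4: "4 = Suc (Suc (Suc (Suc 0)))" by simp
  have s3: "silent Pr 4 a' m2 a ?m3"
    apply (subst n4)
    apply (rule silent_Add[OF code(3)])
    apply (rule silent_Add[OF code(4)])
    apply (rule silent_Load[OF code(5)])
    apply (rule silent_Jmp[OF code(6)])
    using g good2 d2 h2 d1 by (simp add: fun_upd_twist)
  have e3: "extends R m2 ?m3" "keeps d m2 ?m3"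
    using g by (auto simp: extends_def keeps_def)
  have s1: "silent Pr 2 a m (a + 2) ?m1"
    unfolding numeral_2_eq_2
    apply (rule silent_Jz[OF code(1)])
    using x g P.prems(1) apply (simp add: good_def)
    apply (rule silent_Load[OF code(2), unfolded numeral_2_eq_2])
    by simp
  have rec: "computes Pr R (vfold_time f c y (f (P x y) u x)) a ?m3 (Suc z) d (vfold f y (f (P x y) u x))"
  proof (rule P.IH(2))
    show "good R ?m3" using m2(2) g by (simp add: good_def)
    show "I ?m3" using P.prems(2) e2 e3 I by blast
    show "repr R ?m3 (?m3 d) y"
      using repr_extends[OF x(4) extends_trans[OF e2(1) e3(1)]] by simp
    show "repr R ?m3 (?m3 (d + 1)) (f (P x y) u x)"
      using repr_extends[OF m2(5) e3(1)] by simp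
    show "vty (f (P x y) u x) t" using ty P.prems by blast
  qed (use P.prems in auto)
  have "silent Pr (2 + (c (P x y) u x + 4)) a m a ?m3"
    by (rule silent_trans[OF s1 silent_trans[OF m2(1) s3]])
  from computes_combine[OF this _ extends_trans[OF e2(1) e3(1)] keeps_trans[OF e2(2) e3(2)] rec]
  show ?case using m2(2) g by (simp add: good_def add.commute add.left_commute)
qed

lemma iter_loop:
  assumes g: "5 \<le> d" "Suc d < R"
    and code: "ins_at Pr a (Jz d z)"
      "ins_at Pr a' (Add (d + 1) (d + 2) 0)" "ins_at Pr (Suc a') (Sub d d 2)"
      "ins_at Pr (Suc (Suc a')) (Jmp a)" "ins_at Pr z (Add d (d + 1) 0)"
    and body: "\<And>m n u. good R m \<Longrightarrow> I m \<Longrightarrow> m d = n \<Longrightarrow> repr R m (m (d + 1)) u \<Longrightarrow> vty u t \<Longrightarrow>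
      computes Pr R (c (N n) u) (a + 1) m a' (d + 2) (f (N n) u)"
    and ty: "\<And>n u. vty u t \<Longrightarrow> vty (f (N n) u) t"
    and I: "\<And>m m'. I m \<Longrightarrow> extends R m m' \<Longrightarrow> keeps d m m' \<Longrightarrow> I m'"
    and "good R m" "I m" "m d = n" "repr R m (m (d + 1)) u" "vty u t"
  shows "computes Pr R (viter_time f c n u) a m (Suc z) d (viter f n u)"
  using assms(11-)
proof (induction n arbitrary: m u)
  case 0
  have "silent Pr 2 a m (Suc z) (m(d := m (d + 1) + m 0))"
    unfolding numeral_2_eq_2
    by (rule silent_Jz[OF code(1)], subst if_P, rule 0, rule silent_Add[OF code(5)], rule silent_refl)
  then show ?case using 0 g
    by (auto intro!: computes_finish good_reg extends_reg keeps_reg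
        repr_extends[where m = m and R = R and m' = "m(d := m (Suc d))"] simp: good_def)
next
  case (Suc n)
  have "computes Pr R (c (N (Suc n)) u) (a + 1) m a' (d + 2) (f (N (Suc n)) u)"
    by (rule body) (use Suc.prems in auto)
  then obtain m2 where m2: "silent Pr (c (N (Suc n)) u) (a + 1) m a' m2" "good R m2"
    "extends R m m2" "keeps (d + 2) m m2" "repr R m2 (m2 (d + 2)) (f (N (Suc n)) u)"
    unfolding computes_def by blast
  have d2: "m2 d = Suc n" using m2(4) g Suc.prems by (simp add: keeps_def)
  let ?m3 = "m2(d + 1 := m2 (d + 2), d := n)"
  have good2: "m2 0 = 0" "m2 2 = 1" using m2(2) by (auto simp: good_def)
  have n3: "3 = Suc (Suc (Suc 0))" by simp
  have s3: "silent Pr 3 a' m2 a ?m3"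
    apply (subst n3)
    apply (rule silent_Add[OF code(2)])
    apply (rule silent_Sub[OF code(3)])
    apply (rule silent_Jmp[OF code(4)])
    using g good2 d2 by (simp add: fun_upd_twist)
  have e3: "extends R m2 ?m3" "keeps d m2 ?m3"
    using g by (auto simp: extends_def keeps_def)
  have s1: "silent Pr 1 a m (a + 1) m"
    unfolding One_nat_def
    by (rule silent_Jz[OF code(1)]) (use Suc.prems in simp)
  have e2: "keeps d m m2" using m2(4) by (rule keeps_mono) simp
  have rec: "computes Pr R (viter_time f c n (f (N (Suc n)) u)) a ?m3 (Suc z) d (viter f n (f (N (Suc n)) u))"
  proof (rule Suc.IH)
    show "good R ?m3" using m2(2) g by (simp add: good_def)
    show "I ?m3" using Suc.prems(2) e2 e3 m2(3) I by blast
    show "repr R ?m3 (?m3 (d + 1)) (f (N (Suc n)) u)"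
      using repr_extends[OF m2(5) e3(1)] by simp
    show "vty (f (N (Suc n)) u) t" using ty Suc.prems by blast
  qed simp
  have "silent Pr (1 + (c (N (Suc n)) u + 3)) a m a ?m3"
    by (rule silent_trans[OF s1 silent_trans[OF m2(1) s3]])
  from computes_combine[OF this _ extends_trans[OF m2(3) e3(1)] keeps_trans[OF e2 e3(2)] rec]
  show ?case using m2(2) g by (simp add: good_def add.commute add.left_commute)
qed

lemma computes_then:
  assumes "computes Pr R t1 a m a1 d v1"
    and "\<And>m1. good R m1 \<Longrightarrow> extends R m m1 \<Longrightarrow> keeps d m m1 \<Longrightarrow> repr R m1 (m1 d) v1 \<Longrightarrow>
      computes Pr R t2 a1 m1 a' d v"
  shows "computes Pr R (t1 + t2) a m a' d v"
proof -
  from assms(1) obtain m1 where "silent Pr t1 a m a1 m1" "good R m1" "extends R m m1" "keeps d m m1"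
    "repr R m1 (m1 d) v1"
    unfolding computes_def by blast
  with assms(2) show ?thesis by (blast intro: computes_combine)
qed

lemma computes_reg:
  assumes "silent Pr t a m a' (m(d := w))" "good R m" "5 \<le> d" "d < R" "repr R m w v"
  shows "computes Pr R t a m a' d v"
proof (rule computes_finish[OF assms(1)])
  show "extends R m (m(d := w))" using assms by (auto intro: extends_reg)
  then show "repr R (m(d := w)) ((m(d := w)) d) v"
    using repr_extends[OF assms(5)] by simp
qed (use assms in \<open>auto intro: good_reg keeps_reg\<close>)

lemma computes_move:
  assumes "ins_at Pr a (Add d x 0)" "good R m" "5 \<le> d" "d < R" "repr R m (m x) v"
  shows "computes Pr R (Suc 0) a m (Suc a) d v"
proof (rule computes_reg[where w = "m x"])
  show "silent Pr (Suc 0) a m (Suc a) (m(d := m x))"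
    by (rule silent_Add[OF assms(1)]) (use assms(2) in \<open>simp add: good_def\<close>)
qed (use assms in auto)

text \<open>For the null pointer the load hits cell 0, and for the tail cell 1; \<open>good\<close>
  keeps both at zero, in accordance with \<open>vhd (N 0) = N 0\<close>. Typing rules out any other
  number as an address.\<close>

lemma repr_vhd: "good R m \<Longrightarrow> repr R m w v \<Longrightarrow> vty v (TList t) \<or> vty v (TPair t t') \<Longrightarrow> repr R m (m w) (vhd v)"
  by (cases v) (auto simp: good_def)

lemma repr_vtl:
  "good R m \<Longrightarrow> repr R m w v \<Longrightarrow> vty v (TList t) \<or> vty v (TPair t t') \<Longrightarrow> repr R m (m (w + 1)) (vtl v)"
  by (cases v) (auto simp: good_def)

lemma repr_zero_iff: "good R m \<Longrightarrow> repr R m w v \<Longrightarrow> w = 0 \<longleftrightarrow> v = N 0"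
  by (cases v) (auto simp: good_def)

lemma computes_cons:
  assumes code: "code_at Pr a [Store 3 d, Add 4 3 2, Store 4 (d + 1), Add d 3 0, Add 3 4 2]"
    and g: "good R m" "5 \<le> d" "d + 1 < R"
    and v: "repr R m (m d) v" "repr R m (m (d + 1)) w"
  shows "computes Pr R 5 a m (a + 5) d (P v w)"
proof -
  have g': "m 0 = 0" "m 2 = 1" "R \<le> m 3" "5 \<le> R" using g by (auto simp: good_def)
  let ?h = "m 3"
  let ?m1 = "m(?h := m d, 4 := Suc ?h, Suc ?h := m (d + 1), d := ?h, 3 := Suc (Suc ?h))"
  have n5: "5 = Suc (Suc (Suc (Suc (Suc 0))))" by simp
  have ne: "?h \<noteq> 0" "?h \<noteq> 2" "?h \<noteq> 3" "?h \<noteq> 4" "?h \<noteq> d" "?h \<noteq> Suc d" "Suc ?h \<noteq> 2" "Suc ?h \<noteq> 3"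
    "Suc ?h \<noteq> 4" "Suc ?h \<noteq> d" "Suc ?h \<noteq> Suc d" "d \<noteq> 4" "d \<noteq> 3" "d \<noteq> 2" "d \<noteq> 0"
    "Suc d \<noteq> 4" "Suc d \<noteq> 3" "Suc d \<noteq> 2"
    using g' g by auto
  have code': "ins_at Pr a (Store 3 d)" "ins_at Pr (Suc a) (Add 4 3 2)"
    "ins_at Pr (Suc (Suc a)) (Store 4 (d + 1))" "ins_at Pr (Suc (Suc (Suc a))) (Add d 3 0)"
    "ins_at Pr (Suc (Suc (Suc (Suc a)))) (Add 3 4 2)"
    using code by auto
  have s: "silent Pr 5 a m (a + 5) ?m1"
    apply (subst n5)
    apply (rule silent_Store[OF code'(1)])
    apply (rule silent_Add[OF code'(2)])
    apply (rule silent_Store[OF code'(3)])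
    apply (rule silent_Add[OF code'(4)])
    apply (rule silent_Add[OF code'(5)])
    using ne g' by (simp add: silent_def fun_upd_def)
  have e: "extends R m ?m1" using ne g' g by (auto simp: extends_def)
  show ?thesis
  proof (rule computes_finish[OF s _ e])
    show "good R ?m1" using ne g' g by (auto simp: good_def)
    show "keeps d m ?m1" using ne g' g by (auto simp: keeps_def)
    have "repr R ?m1 (m d) v" "repr R ?m1 (m (d + 1)) w"
      using v e by (auto intro: repr_extends)
    then show "repr R ?m1 (?m1 d) (P v w)" using ne g' by simp
  qed
qed

definition compiled :: "instr list \<Rightarrow> nat \<Rightarrow> exp \<Rightarrow> bool" where
  "compiled Pr R e \<longleftrightarrow> (\<forall>G t env a b m. infer e G = Some t \<longrightarrow> list_all2 vty env G \<longrightarrow>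
     code_at Pr a (compile e b (b + length env) a) \<longrightarrow> 5 \<le> b \<longrightarrow> maxreg e (b + length env) < R \<longrightarrow>
     good R m \<longrightarrow> env_repr R m b env \<longrightarrow>
     computes Pr R (tm e env) a m (a + clen e) (b + length env) (eval e env))"

lemma compiledD:
  assumes "compiled Pr R e" "infer e G = Some t" "list_all2 vty env G" "d = b + length env"
    "code_at Pr a (compile e b d a)" "5 \<le> b" "maxreg e d < R" "good R m" "env_repr R m b env" "a' = a + clen e"
  shows "computes Pr R (tm e env) a m a' d (eval e env)"
  using assms unfolding compiled_def by blast

text \<open>The common part of all constructs with two subexpressions, loops included: both results
  are available in adjacent registers, and \<open>fin\<close> covers whatever instructions
  follow.\<close>

lemma compiled_operands:
  assumes e: "compiled Pr R e" "infer e G = Some te" and f: "compiled Pr R f" "infer f (G @ [te]) = Some tf"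
    and env: "list_all2 vty env G" and d: "d = b + length env"
    and code: "code_at Pr a (compile e b d a)" "code_at Pr (a + clen e) (compile f b (d + 1) (a + clen e))"
    and b: "5 \<le> b" "maxreg e d < R" "maxreg f (d + 1) < R" and m: "good R m" "env_repr R m b env"
    and fin: "\<And>m2. good R m2 \<Longrightarrow> env_repr R m2 b env \<Longrightarrow> repr R m2 (m2 d) (eval e env) \<Longrightarrow>
      repr R m2 (m2 (d + 1)) (eval f (env @ [eval e env])) \<Longrightarrow> vty (eval e env) te \<Longrightarrow>
      vty (eval f (env @ [eval e env])) tf \<Longrightarrow> 5 \<le> d \<Longrightarrow> d + 1 < R \<Longrightarrow>
      computes Pr R t3 (a + clen e + clen f) m2 a' d v"
  shows "computes Pr R (tm e env + tm f (env @ [eval e env]) + t3) a m a' d v"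
proof -
  have ve: "vty (eval e env) te" using infer_sound e(2) env by blast
  have env': "list_all2 vty (env @ [eval e env]) (G @ [te])" using ve env by (simp add: list_all2_appendI)
  have vf: "vty (eval f (env @ [eval e env])) tf" using infer_sound f(2) env' by blast
  have d5: "5 \<le> d" "d + 1 < R" using d b maxreg_ge[of "d + 1" f] by auto
  from compiledD[OF e env d code(1) b(1,2) m refl] obtain m1 where
    m1: "silent Pr (tm e env) a m (a + clen e) m1" "good R m1" "extends R m m1" "keeps d m m1"
      "repr R m1 (m1 d) (eval e env)"
    unfolding computes_def by blast
  have "env_repr R m1 b (env @ [eval e env])"
    using m1 m b d by (auto simp: env_repr_snoc intro: env_repr_extends)
  from compiledD[OF f env' _ code(2) b(1,3) m1(2) this refl] obtain m2 where
    m2: "silent Pr (tm f (env @ [eval e env])) (a + clen e) m1 (a + clen e + clen f) m2" "good R m2"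
      "extends R m1 m2" "keeps (d + 1) m1 m2" "repr R m2 (m2 (d + 1)) (eval f (env @ [eval e env]))"
    unfolding computes_def using d by auto
  have e2: "extends R m m2" "keeps d m m2"
    using extends_trans[OF m1(3) m2(3)] keeps_trans[OF m1(4) m2(4)] by simp_all
  have v1: "repr R m2 (m2 d) (eval e env)"
    using repr_extends[OF m1(5) m2(3)] m2(4) d5 by (simp add: keeps_def)
  have "env_repr R m2 b env" using env_repr_extends[OF m(2) e2] d b by simp
  from computes_combine[OF silent_trans[OF m1(1) m2(1)] m2(2) e2 fin[OF m2(2) this v1 m2(5) ve vf d5]]
  show ?thesis .
qed

lemma compiled: "compiled Pr R e"
proof (induction e)
  case (EVar i)
  show ?case unfolding compiled_def
  proof (intro allI impI, goal_cases)
    case (1 G t env a b m)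
    then have "i < length env" by (auto dest: list_all2_lengthD split: if_splits)
    then show ?case using 1 by (auto intro!: computes_move simp: env_repr_def)
  qed
next
  case (ENum c)
  show ?case unfolding compiled_def
  proof (intro allI impI, goal_cases)
    case (1 G t env a b m)
    then have "silent Pr 1 a m (Suc a) (m(b + length env := c))" by (auto intro!: silent_Const)
    with 1 show ?case by (auto intro!: computes_reg[where w = c])
  qed
next
  case (ENil s)
  show ?case unfolding compiled_def
  proof (intro allI impI, goal_cases)
    case (1 G t env a b m)
    then have "silent Pr 1 a m (Suc a) (m(b + length env := 0))" by (auto intro!: silent_Const)
    with 1 show ?case by (auto intro!: computes_reg[where w = 0])
  qed
next
  case (EAdd e f)
  show ?case unfolding compiled_def tm.simps
  proof (intro allI impI, goal_cases)
    case (1 G t env a b m)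
    then have T: "infer e G = Some TNat" "infer f (G @ [TNat]) = Some TNat" by (auto split: if_splits)
    let ?d = "b + length env"
    show ?case
    proof (rule compiled_operands[OF EAdd(1) T(1) EAdd(2) T(2) 1(2) refl])
      fix m2 assume m2: "good R m2" "repr R m2 (m2 ?d) (eval e env)"
        "repr R m2 (m2 (?d + 1)) (eval f (env @ [eval e env]))" "vty (eval e env) TNat"
        "vty (eval f (env @ [eval e env])) TNat" "5 \<le> ?d" "?d + 1 < R"
      have "silent Pr 1 (a + clen e + clen f) m2 (Suc (a + clen e + clen f)) (m2(?d := m2 ?d + m2 (?d + 1)))"
        using 1(3) unfolding One_nat_def by (intro silent_Add) auto
      then show "computes Pr R 1 (a + clen e + clen f) m2 (a + clen (EAdd e f)) ?d (eval (EAdd e f) env)"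
        using m2 vty_NatD[OF m2(4)] vty_NatD[OF m2(5)]
        by (auto intro!: computes_reg[where w = "m2 ?d + m2 (?d + 1)"] simp: add.assoc)
    qed (use 1 in simp_all)
  qed
next
  case (ESub e f)
  show ?case unfolding compiled_def tm.simps
  proof (intro allI impI, goal_cases)
    case (1 G t env a b m)
    then have T: "infer e G = Some TNat" "infer f (G @ [TNat]) = Some TNat" by (auto split: if_splits)
    let ?d = "b + length env"
    show ?case
    proof (rule compiled_operands[OF ESub(1) T(1) ESub(2) T(2) 1(2) refl])
      fix m2 assume m2: "good R m2" "repr R m2 (m2 ?d) (eval e env)"
        "repr R m2 (m2 (?d + 1)) (eval f (env @ [eval e env]))" "vty (eval e env) TNat"
        "vty (eval f (env @ [eval e env])) TNat" "5 \<le> ?d" "?d + 1 < R"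
      have "silent Pr 1 (a + clen e + clen f) m2 (Suc (a + clen e + clen f)) (m2(?d := m2 ?d - m2 (?d + 1)))"
        using 1(3) unfolding One_nat_def by (intro silent_Sub) auto
      then show "computes Pr R 1 (a + clen e + clen f) m2 (a + clen (ESub e f)) ?d (eval (ESub e f) env)"
        using m2 vty_NatD[OF m2(4)] vty_NatD[OF m2(5)]
        by (auto intro!: computes_reg[where w = "m2 ?d - m2 (?d + 1)"] simp: add.assoc)
    qed (use 1 in simp_all)
  qed
next
  case (ECons e f)
  show ?case unfolding compiled_def tm.simps
  proof (intro allI impI, goal_cases)
    case (1 G t env a b m)
    then obtain s s' where T: "infer e G = Some s" "infer f (G @ [s]) = Some s'"
      by (auto split: option.splits)
    show ?case
      by (rule compiled_operands[OF ECons(1) T(1) ECons(2) T(2) 1(2) refl])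
        (use 1 computes_cons in \<open>simp_all add: add.assoc[symmetric]\<close>)
  qed
next
  case (EHd e)
  show ?case unfolding compiled_def tm.simps
  proof (intro allI impI, goal_cases)
    case (1 G t env a b m)
    let ?d = "b + length env"
    from 1(1) obtain s s' where T: "infer e G = Some s'" "s' = TList t \<or> s' = TPair t s"
      by (auto split: option.splits ty.splits)
    have ve: "vty (eval e env) s'" using infer_sound T 1(2) by blast
    show ?case
    proof (rule computes_then[OF compiledD[OF EHd T(1) 1(2) refl]])
      fix m1 assume m1: "good R m1" "repr R m1 (m1 ?d) (eval e env)"
      have "silent Pr 1 (a + clen e) m1 (Suc (a + clen e)) (m1(?d := m1 (m1 ?d)))"
        using 1(3) unfolding One_nat_def by (intro silent_Load) auto
      then show "computes Pr R 1 (a + clen e) m1 (a + clen (EHd e)) ?d (eval (EHd e) env)"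
        using m1 1 maxreg_ge[of ?d e] T(2) ve
        by (auto intro!: computes_reg[where w = "m1 (m1 ?d)"] intro: repr_vhd)
    qed (use 1 in simp_all)
  qed
next
  case (ETl e)
  show ?case unfolding compiled_def tm.simps
  proof (intro allI impI, goal_cases)
    case (1 G t env a b m)
    let ?d = "b + length env"
    from 1(1) obtain s s' where T: "infer e G = Some s'" "s' = TList s \<or> s' = TPair s t"
      by (auto split: option.splits ty.splits)
    have ve: "vty (eval e env) s'" using infer_sound T 1(2) by blast
    show ?case
    proof (rule computes_then[OF compiledD[OF ETl T(1) 1(2) refl]])
      fix m1 assume m1: "good R m1" "repr R m1 (m1 ?d) (eval e env)"
      have c: "ins_at Pr (a + clen e) (Add ?d ?d 2)" "ins_at Pr (Suc (a + clen e)) (Load ?d ?d)"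
        using 1(3) by auto
      have dR: "5 \<le> ?d" "?d < R" using 1 maxreg_ge[of ?d e] by auto
      have "silent Pr 2 (a + clen e) m1 (a + clen e + 2) (m1(?d := if m1 ?d + 1 = ?d then ?d else m1 (m1 ?d + 1)))"
        unfolding numeral_2_eq_2
        apply (rule silent_Add[OF c(1)])
        apply (rule silent_Load[OF c(2)])
        using m1(1) by (simp add: good_def)
      \<comment> \<open>Register \<open>?d\<close> has just been overwritten by the address of the
        tail, so the load must not read that register. The pointer was null or at least
        \<open>R\<close>, hence its successor is not \<open>?d\<close>.\<close>
      moreover have "m1 ?d + 1 \<noteq> ?d"
        using ve T(2) m1 dR by (cases "eval e env") (auto simp: good_def)
      moreover have "repr R m1 (m1 (m1 ?d + 1)) (vtl (eval e env))"
        using repr_vtl[OF m1] ve T(2) by blast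
      ultimately show "computes Pr R 2 (a + clen e) m1 (a + clen (ETl e)) ?d (eval (ETl e) env)"
        using m1 dR by (auto intro!: computes_reg[where w = "m1 (m1 ?d + 1)"] simp: add.assoc)
    qed (use 1 in simp_all)
  qed
next
  case (EIf c e f)
  show ?case unfolding compiled_def tm.simps add.assoc
  proof (intro allI impI, goal_cases)
    case (1 G t env a b m)
    let ?d = "b + length env" and ?z = "a + clen c + clen e + 2"
    from 1(1) obtain s where T: "infer c G = Some s" "infer e G = Some t" "infer f G = Some t"
      by (auto split: if_splits)
    have dR: "5 \<le> ?d" "?d < R" using 1 maxreg_ge[of ?d e] by auto
    have c: "ins_at Pr (a + clen c) (Jz ?d ?z)" "ins_at Pr (a + clen c + 1 + clen e) (Jmp (?z + clen f))"
      "code_at Pr (a + clen c + 1) (compile e b ?d (a + clen c + 1))" "code_at Pr ?z (compile f b ?d ?z)"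
      using 1(3) by (auto simp: add.commute add.left_commute)
    show ?case
    proof (rule computes_then[OF compiledD[OF EIf(1) T(1) 1(2) refl]])
      fix m1 assume m1: "good R m1" "extends R m m1" "keeps ?d m m1" "repr R m1 (m1 ?d) (eval c env)"
      have er: "env_repr R m1 b env" using 1 m1 by (auto intro: env_repr_extends)
      have z: "m1 ?d = 0 \<longleftrightarrow> eval c env = N 0" using repr_zero_iff m1 by blast
      show "computes Pr R (1 + (if eval c env = N 0 then tm f env else tm e env + 1)) (a + clen c) m1
          (a + clen (EIf c e f)) ?d (eval (EIf c e f) env)"
      proof (cases "eval c env = N 0")
        case True
        have s: "silent Pr 1 (a + clen c) m1 ?z m1"
          unfolding One_nat_def by (rule silent_Jz[OF c(1)]) (use z True in simp)
        have "computes Pr R (tm f env) ?z m1 (?z + clen f) ?d (eval f env)"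
          by (rule compiledD[OF EIf(3) T(3) 1(2) refl c(4)]) (use 1 er m1 in simp_all)
        from computes_combine[OF s m1(1) extends_refl keeps_refl this] True show ?thesis
          by (simp add: algebra_simps)
      next
        case False
        have s: "silent Pr 1 (a + clen c) m1 (a + clen c + 1) m1"
          unfolding One_nat_def by (rule silent_Jz[OF c(1)]) (use z False in simp)
        have "computes Pr R (tm e env) (a + clen c + 1) m1 (a + clen c + 1 + clen e) ?d (eval e env)"
          by (rule compiledD[OF EIf(2) T(2) 1(2) refl c(3)]) (use 1 er m1 in simp_all)
        then have "computes Pr R (tm e env + 1) (a + clen c + 1) m1 (?z + clen f) ?d (eval e env)"
        proof (rule computes_then)
          fix m2 assume m2: "good R m2" "repr R m2 (m2 ?d) (eval e env)"
          have "silent Pr 1 (a + clen c + 1 + clen e) m2 (?z + clen f) m2"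
            unfolding One_nat_def by (rule silent_Jmp[OF c(2)[unfolded One_nat_def]]) simp
          with m2 show "computes Pr R 1 (a + clen c + 1 + clen e) m2 (?z + clen f) ?d (eval e env)"
            by (auto intro: computes_finish)
        qed
        from computes_combine[OF s m1(1) extends_refl keeps_refl this] False show ?thesis
          by (simp add: algebra_simps)
      qed
    qed (use 1 in simp_all)
  qed
next
  case (ELet e f)
  show ?case unfolding compiled_def tm.simps
  proof (intro allI impI, goal_cases)
    case (1 G t env a b m)
    then obtain s where T: "infer e G = Some s" "infer f (G @ [s]) = Some t"
      by (auto split: option.splits)
    show ?case
      by (rule compiled_operands[OF ELet(1) T(1) ELet(2) T(2) 1(2) refl])
        (use 1 computes_move[where x = "Suc (b + length env)"] in \<open>simp_all add: add.assoc[symmetric]\<close>)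
  qed
next
  case (ELocal k e)
  show ?case unfolding compiled_def
  proof (intro allI impI, goal_cases)
    case (1 G t env a b m)
    \<comment> \<open>The top \<open>k\<close> variables already fill the registers directly below
      the result register, so restricting the environment merely raises its base and costs no
      instruction.\<close>
    let ?env = "drop (length env - k) env" and ?b = "b + length env - k"
    have "length env = length G" using 1(2) by (rule list_all2_lengthD)
    with 1(1) have T: "k \<le> length env" "infer e (drop (length env - k) G) = Some t"
      by (auto split: if_splits)
    have er: "env_repr R m ?b ?env" unfolding env_repr_def
    proof (intro allI impI)
      fix i assume "i < length ?env"
      then have "repr R m (m (b + (length env - k + i))) (env ! (length env - k + i))"
        using 1(7) by (simp add: env_repr_def)
      then show "repr R m (m (?b + i)) (?env ! i)" using T(1) by (simp add: add.assoc)
    qed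
    have "computes Pr R (tm e ?env) a m (a + clen e) (b + length env) (eval e ?env)"
      by (rule compiledD[OF ELocal T(2) list_all2_dropI[OF 1(2)] _ _ _ _ 1(6) er refl]) (use 1 T in auto)
    then show ?case by simp
  qed
next
  case (EFold l i e)
  show ?case unfolding compiled_def tm.simps
  proof (intro allI impI, goal_cases)
    case (1 G t env a b m)
    let ?d = "b + length env" and ?a = "a + clen l + clen i" and ?l = "eval l env"
    let ?i = "eval i (env @ [?l])" and ?f = "\<lambda>r a x. eval e (env @ [r, a, x])"
    from 1(1) obtain s where T: "infer l G = Some (TList s)" "infer i (G @ [TList s]) = Some t"
      "infer e (G @ [TList s, t, s]) = Some t"
      by (auto split: option.splits ty.splits if_splits)
    have dR: "Suc (Suc ?d) < R" using 1 maxreg_ge[of "?d + 3" e] by auto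
    show ?case
    proof (rule compiled_operands[OF EFold(1) T(1) EFold(2) T(2) 1(2) refl])
      fix m2 assume m2: "good R m2" "env_repr R m2 b env" "repr R m2 (m2 ?d) ?l" "repr R m2 (m2 (?d + 1)) ?i"
        "vty ?l (TList s)" "vty ?i t" "5 \<le> ?d"
      have "computes Pr R (vfold_time ?f (\<lambda>r a x. tm e (env @ [r, a, x])) ?l ?i) ?a m2
          (Suc (?a + clen e + 6)) ?d (vfold ?f ?l ?i)"
      proof (rule fold_loop[where s = s and t = t and a' = "?a + clen e + 2" and I = "\<lambda>m. env_repr R m b env"])
        fix m x y u
        assume h: "good R m" "env_repr R m b env" "repr R m (m ?d) (P x y)" "repr R m (m (?d + 1)) u"
          "repr R m (m (?d + 2)) x" "vty (P x y) (TList s)" "vty u t"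
        have "env_repr R m b (((env @ [P x y]) @ [u]) @ [x])"
          unfolding env_repr_snoc using h by simp
        then show "computes Pr R (tm e (env @ [P x y, u, x])) (?a + 2) m (?a + clen e + 2) (?d + 3) (?f (P x y) u x)"
          by (intro compiledD[OF EFold(3) T(3)])
            (use 1 h in \<open>auto intro!: list_all2_appendI simp: numeral_3_eq_3 numeral_2_eq_2 add.assoc\<close>)
      next
        fix x y u assume "vty (P x y) (TList s)" "vty u t"
        then show "vty (?f (P x y) u x) t"
          by (intro infer_sound[OF T(3)]) (use 1(2) in \<open>auto intro!: list_all2_appendI\<close>)
      qed (use 1 m2 dR in \<open>auto simp: add.commute add.left_commute eval_nat_numeral intro: env_repr_extends\<close>)
      then show "computes Pr R (vfold_time ?f (\<lambda>r a x. tm e (env @ [r, a, x])) ?l ?i) ?a m2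
          (a + clen (EFold l i e)) ?d (eval (EFold l i e) env)"
        by (simp add: algebra_simps eval_nat_numeral)
    qed (use 1 in simp_all)
  qed
next
  case (EIter n i e)
  show ?case unfolding compiled_def tm.simps
  proof (intro allI impI, goal_cases)
    case (1 G t env a b m)
    let ?d = "b + length env" and ?a = "a + clen n + clen i" and ?n = "eval n env"
    let ?i = "eval i (env @ [?n])" and ?f = "\<lambda>c a. eval e (env @ [c, a])"
    from 1(1) have T: "infer n G = Some TNat" "infer i (G @ [TNat]) = Some t"
      "infer e (G @ [TNat, t]) = Some t"
      by (auto split: option.splits ty.splits if_splits)
    show ?case
    proof (rule compiled_operands[OF EIter(1) T(1) EIter(2) T(2) 1(2) refl])
      fix m2 assume m2: "good R m2" "env_repr R m2 b env" "repr R m2 (m2 ?d) ?n" "repr R m2 (m2 (?d + 1)) ?i"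
        "vty ?n TNat" "vty ?i t" "5 \<le> ?d" "?d + 1 < R"
      have "computes Pr R (viter_time ?f (\<lambda>c a. tm e (env @ [c, a])) (num ?n) ?i) ?a m2
          (Suc (?a + clen e + 4)) ?d (viter ?f (num ?n) ?i)"
      proof (rule iter_loop[where t = t and a' = "?a + clen e + 1" and I = "\<lambda>m. env_repr R m b env"])
        fix m k u
        assume h: "good R m" "env_repr R m b env" "m ?d = k" "repr R m (m (?d + 1)) u" "vty u t"
        have "env_repr R m b ((env @ [N k]) @ [u])"
          unfolding env_repr_snoc using h by simp
        then show "computes Pr R (tm e (env @ [N k, u])) (?a + 1) m (?a + clen e + 1) (?d + 2) (?f (N k) u)"
          by (intro compiledD[OF EIter(3) T(3)])
            (use 1 h in \<open>auto intro!: list_all2_appendI simp: numeral_2_eq_2 add.assoc\<close>)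
      next
        fix k u assume "vty u t"
        then show "vty (?f (N k) u) t"
          by (intro infer_sound[OF T(3)]) (use 1(2) in \<open>auto intro!: list_all2_appendI\<close>)
      next
        show "m2 ?d = num ?n" using m2(3) vty_NatD[OF m2(5)] by auto
      qed (use 1 m2 in \<open>auto simp: add.commute add.left_commute eval_nat_numeral intro: env_repr_extends\<close>)
      then show "computes Pr R (viter_time ?f (\<lambda>c a. tm e (env @ [c, a])) (num ?n) ?i) ?a m2
          (a + clen (EIter n i e)) ?d (eval (EIter n i e) env)"
        by (simp add: algebra_simps eval_nat_numeral)
    qed (use 1 in simp_all)
  qed
qed

theorem comp_correct:
  assumes "infer e G = Some t" "list_all2 vty env G" "code_at Pr a (compile e b (b + length env) a)"
    "5 \<le> b" "maxreg e (b + length env) < R" "good R m" "env_repr R m b env"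
  shows "computes Pr R (tm e env) a m (a + clen e) (b + length env) (eval e env)"
  using compiled assms unfolding compiled_def by blast

section \<open>Reading the input\<close>

definition val_list :: "val list \<Rightarrow> val" where
  "val_list xs = foldr P xs (N 0)"

definition nats :: "nat list \<Rightarrow> val" where
  "nats xs = val_list (map N xs)"

lemma val_list_simps [simp]:
  "val_list [] = N 0" "val_list (x # xs) = P x (val_list xs)"
  by (simp_all add: val_list_def)

lemma nats_simps [simp]: "nats [] = N 0" "nats (x # xs) = P (N x) (nats xs)"
  by (simp_all add: nats_def)

lemma vty_nats [simp]: "vty (nats xs) (TList TNat)"
  by (induction xs) auto

text \<open>Cell 0 walks through the target addresses and cell 1 holds the increment 1, so the
  original cell 1 has to be saved separately beforehand.\<close>

definition save_code :: "nat \<Rightarrow> nat \<Rightarrow> instr list" where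
  "save_code j R = concat (map (\<lambda>i. [Add 0 0 1, Store 0 i]) [j..<R])"

text \<open>With B = 2^R |x|, the saving phase leaves B + R - 2 in cell 0. Subtracting R - 1 gives B
  - 1, the displacement of the saved cells, and adding 1 gives the first heap address. The length
  itself has been lost through doubling, so the reading loop counts down from B in steps of
  2^R.\<close>

definition setup_code :: "nat \<Rightarrow> instr list" where
  "setup_code R = [Const 1 (R - 1), Sub 10 0 1, Const 2 1, Add 3 0 2, Const 0 0, Const 1 0,
     Const 5 0, Add 6 10 2, Const 7 1, Const 8 (2 ^ R), Const 11 R]"

text \<open>Register 7 is the input position. Positions below \<open>R\<close> are read from the
  saved copy, with displacement B - 1 from register 10; the others are still in place. Consing in
  order of position produces the reversed input.\<close>

definition read_code :: "nat \<Rightarrow> instr list" where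
  "read_code l = [Jz 6 (l + 15), Sub 6 6 8, Sub 9 11 7, Jz 9 (l + 6), Add 9 7 10, Jmp (l + 7),
     Add 9 7 0, Load 9 9, Store 3 9, Add 9 3 2, Store 9 5, Add 5 3 0, Add 3 9 2, Add 7 7 2, Jmp l]"

definition prologue :: "nat \<Rightarrow> instr list" where
  "prologue R = replicate R (Add 0 0 0) @ [Store 0 1, Const 1 1] @ save_code 2 R @
     setup_code R @ read_code (R + 2 + 2 * (R - 2) + 11)"

lemma length_save_code [simp]: "length (save_code j R) = 2 * (R - j)"
  unfolding save_code_def by (induction R) (auto simp: Suc_diff_le)

lemma length_setup_code [simp]: "length (setup_code R) = 11"
  by (simp add: setup_code_def)

lemma length_prologue: "length (prologue R) = R + 2 + 2 * (R - 2) + 26"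
  by (simp add: prologue_def read_code_def)

lemma silent_double:
  "code_at Pr a (replicate k (Add 0 0 0)) \<Longrightarrow> silent Pr k a m (a + k) (m(0 := 2 ^ k * m 0))"
proof (induction k arbitrary: a m)
  case (Suc k)
  have "silent Pr k (Suc a) (m(0 := m 0 + m 0)) (Suc a + k)
      ((m(0 := m 0 + m 0))(0 := 2 ^ k * (m(0 := m 0 + m 0)) 0))"
    by (rule Suc.IH) (use Suc.prems in simp)
  then have "silent Pr k (Suc a) (m(0 := m 0 + m 0)) (a + Suc k) (m(0 := 2 ^ Suc k * m 0))"
    by (simp add: algebra_simps mult_2[symmetric])
  moreover have "ins_at Pr a (Add 0 0 0)" using Suc.prems by simp
  ultimately show ?case by (rule silent_Add[rotated])
qed simp

text \<open>Cell \<open>i\<close> moves to address \<open>B + i - 1\<close>, where \<open>B\<close>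
  itself holds the old cell 1. The premise \<open>R \<le> B\<close> makes sure that no save
  overwrites a cell that has yet to be saved.\<close>

lemma silent_saves:
  assumes "j \<le> R" "2 \<le> j" "R \<le> B"
    and "code_at Pr a (save_code j R)"
    and "m 1 = 1" "m 0 = B + j - 2"
  shows "\<exists>m'. silent Pr (2 * (R - j)) a m (a + 2 * (R - j)) m' \<and> m' 0 = B + R - 2 \<and>
    (\<forall>i. j \<le> i \<and> i < R \<longrightarrow> m' (B + i - 1) = m i) \<and>
    (\<forall>q. q \<noteq> 0 \<and> (q < B + j - 1 \<or> B + R - 1 \<le> q) \<longrightarrow> m' q = m q)"
  using assms
proof (induction j arbitrary: a m rule: inc_induct)
  case base
  then show ?case by (intro exI[of _ m]) auto
next
  case (step j)
  let ?m = "m(0 := B + j - 1, B + j - 1 := m j)"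
  have up: "[j..<R] = j # [Suc j..<R]" using step.hyps by (simp add: upt_conv_Cons)
  have code: "ins_at Pr a (Add 0 0 1)" "ins_at Pr (Suc a) (Store 0 j)"
    "code_at Pr (Suc (Suc a)) (save_code (Suc j) R)"
    using step.prems(3) unfolding save_code_def up by auto
  have pr: "B + j - 1 = Suc (B + j - 2)" using step.prems(1) by simp
  have s: "silent Pr (Suc (Suc 0)) a m (Suc (Suc a)) ?m"
    apply (rule silent_Add[OF code(1)])
    apply (rule silent_Store[OF code(2)])
    using step.prems(1,4,5) pr by (simp add: fun_upd_def silent_def)
  have "\<exists>m'. silent Pr (2 * (R - Suc j)) (Suc (Suc a)) ?m (Suc (Suc a) + 2 * (R - Suc j)) m' \<and> m' 0 = B + R - 2 \<and>
    (\<forall>i. Suc j \<le> i \<and> i < R \<longrightarrow> m' (B + i - 1) = ?m i) \<and>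
    (\<forall>q. q \<noteq> 0 \<and> (q < B + Suc j - 1 \<or> B + R - 1 \<le> q) \<longrightarrow> m' q = ?m q)"
    by (rule step.IH) (use step code(3) in auto)
  then obtain m' where m': "silent Pr (2 * (R - Suc j)) (Suc (Suc a)) ?m (Suc (Suc a) + 2 * (R - Suc j)) m'"
    "m' 0 = B + R - 2" "\<And>i. Suc j \<le> i \<Longrightarrow> i < R \<Longrightarrow> m' (B + i - 1) = ?m i"
    "\<And>q. q \<noteq> 0 \<Longrightarrow> q < B + Suc j - 1 \<or> B + R - 1 \<le> q \<Longrightarrow> m' q = ?m q" by blast
  have n: "Suc (Suc 0) + 2 * (R - Suc j) = 2 * (R - j)"
    "Suc (Suc a) + 2 * (R - Suc j) = a + 2 * (R - j)" using step.hyps by auto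
  have s2: "silent Pr (2 * (R - j)) a m (a + 2 * (R - j)) m'"
    using silent_trans[OF s m'(1)] unfolding n .
  have 1: "m' (B + i - 1) = m i" if "j \<le> i" "i < R" for i
  proof (cases "i = j")
    case True
    then show ?thesis using m'(4)[of "B + j - 1"] step.prems step.hyps by auto
  next
    case False
    then show ?thesis using m'(3)[of i] that step.prems step.hyps by auto
  qed
  have 2: "m' q = m q" if "q \<noteq> 0" "q < B + j - 1 \<or> B + R - 1 \<le> q" for q
  proof -
    have "q < B + Suc j - 1 \<or> B + R - 1 \<le> q" using that(2) step.hyps by linarith
    then have "m' q = ?m q" using m'(4) that(1) by blast
    also have "\<dots> = m q" using that step.hyps step.prems(1) by auto
    finally show ?thesis .
  qed
  from s2 m'(2) 1 2 show ?case by blast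
qed

text \<open>The free pointer starts at or above \<open>B + R - 1\<close>, beyond the input and the
  saved block, so building the list destroys nothing still to be read. A round takes at most 4 + 3 +
  7 steps: loop test and choice of the source, fetching, consing.\<close>

lemma read_loop:
  fixes x :: "nat list" and l :: nat
  assumes R: "12 \<le> R" "R \<le> B" "length x < B"
    and code': "code_at Pr l (read_code l)"
    and j: "k + j = length x"
    and "good R m" "repr R m (m 5) (nats (rev (take j x)))" "m 6 = 2 ^ R * k" "m 7 = j + 1"
      "m 8 = 2 ^ R" "m 10 = B - 1" "m 11 = R" "B + R - 1 \<le> m 3"
      "\<And>i. 1 \<le> i \<Longrightarrow> i \<le> length x \<Longrightarrow> i < R \<Longrightarrow> m (B + i - 1) = x ! (i - 1)"
      "\<And>i. R \<le> i \<Longrightarrow> i \<le> length x \<Longrightarrow> m i = x ! (i - 1)"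
  shows "\<exists>m' t. silent Pr t l m (l + 15) m' \<and> t \<le> 15 * k + 1 \<and> good R m' \<and> repr R m' (m' 5) (nats (rev x))"
  using assms(5-)
proof (induction k arbitrary: j m)
  case 0
  note code = code'[unfolded read_code_def]
  from 0 have "silent Pr (Suc 0) l m (l + 15) m" using code by (intro silent_Jz[of _ _ 6 "l + 15"]) auto
  with 0 show ?case by (intro exI[of _ m] exI[of _ "Suc 0"]) auto
next
  case (Suc k)
  note code = code'[unfolded read_code_def]
  have jl: "j < length x" using Suc.prems by simp
  have g: "m 0 = 0" "m 1 = 0" "m 2 = 1" "R \<le> m 3" using Suc.prems(2) by (auto simp: good_def)
  let ?h = "m 3"
  have h: "R \<le> ?h" "B + R - 1 \<le> ?h" using g Suc.prems by auto
  let ?m1 = "m(6 := 2 ^ R * k, 9 := x ! j)"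
  let ?m0 = "m(6 := 2 ^ R * k, 9 := R - (j + 1))"
  have s0: "silent Pr (Suc (Suc (Suc (Suc 0)))) l m (if j + 1 < R then l + 4 else l + 6) ?m0"
    apply (rule silent_Jz[of _ _ 6 "l + 15"])
    using code apply simp
    using Suc.prems(4) apply (simp split del: if_split)
    apply (rule silent_Sub[of _ _ 6 6 8])
    using code apply simp
    apply (rule silent_Sub[of _ _ 9 11 7])
    using code apply simp
    apply (rule silent_Jz[of _ _ 9 "l + 6"])
    using code apply simp
    using Suc.prems(4-8) by (auto simp: silent_def fun_eq_iff)
  have "\<exists>t\<le>3. silent Pr t (if j + 1 < R then l + 4 else l + 6) ?m0 (l + 8) ?m1"
  proof (cases "j + 1 < R")
    case True
    have xj: "m (B + j) = x ! j" using Suc.prems(10)[of "Suc j"] jl True by simp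
    have "silent Pr (Suc (Suc (Suc 0))) (l + 4) ?m0 (l + 8) ?m1"
      apply (rule silent_Add[of _ _ 9 7 10])
      using code apply (simp add: eval_nat_numeral)
      apply (rule silent_Jmp[of _ _ "l + 7"])
      using code apply (simp add: eval_nat_numeral)
      apply (rule silent_Load[of _ _ 9 9])
      using code apply (simp add: eval_nat_numeral)
      using Suc.prems(4-8) xj R by (auto simp: silent_def fun_eq_iff add.commute)
    with True show ?thesis by (intro exI[of _ "Suc (Suc (Suc 0))"]) simp
  next
    case False
    have xj: "m (Suc j) = x ! j" using Suc.prems(11)[of "Suc j"] jl False by simp
    have "silent Pr (Suc (Suc 0)) (l + 6) ?m0 (l + 8) ?m1"
      apply (rule silent_Add[of _ _ 9 7 0])
      using code apply (simp add: eval_nat_numeral)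
      apply (rule silent_Load[of _ _ 9 9])
      using code apply (simp add: eval_nat_numeral)
      using Suc.prems(4-8) xj R g False by (auto simp: silent_def fun_eq_iff)
    with False show ?thesis by (intro exI[of _ "Suc (Suc 0)"]) simp
  qed
  then obtain t0 where t0: "t0 \<le> 3" "silent Pr t0 (if j + 1 < R then l + 4 else l + 6) ?m0 (l + 8) ?m1"
    by blast
  have s1: "silent Pr (Suc (Suc (Suc (Suc 0))) + t0) l m (l + 8) ?m1" by (rule silent_trans[OF s0 t0(2)])
  let ?m2 = "?m1(?h := x ! j, Suc ?h := m 5, 9 := Suc ?h, 5 := ?h, 3 := Suc (Suc ?h), 7 := j + 2)"
  have ne: "?h \<noteq> 0" "?h \<noteq> 2" "?h \<noteq> 3" "?h \<noteq> 5" "?h \<noteq> 6" "?h \<noteq> 7" "?h \<noteq> 8" "?h \<noteq> 9" "?h \<noteq> 10" "?h \<noteq> 11" "?h \<noteq> 1"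
    "Suc ?h \<noteq> 0" "Suc ?h \<noteq> 2" "Suc ?h \<noteq> 3" "Suc ?h \<noteq> 5" "Suc ?h \<noteq> 6" "Suc ?h \<noteq> 7" "Suc ?h \<noteq> 8" "Suc ?h \<noteq> 9" "Suc ?h \<noteq> 10" "Suc ?h \<noteq> 11" "Suc ?h \<noteq> 1"
    using h R by auto
  have s2: "silent Pr (Suc (Suc (Suc (Suc (Suc (Suc (Suc 0))))))) (l + 8) ?m1 l ?m2"
    apply (rule silent_Store[of _ _ 3 9])
    using code apply (simp add: eval_nat_numeral)
    apply (rule silent_Add[of _ _ 9 3 2])
    using code apply (simp add: eval_nat_numeral)
    apply (rule silent_Store[of _ _ 9 5])
    using code apply (simp add: eval_nat_numeral)
    apply (rule silent_Add[of _ _ 5 3 0])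
    using code apply (simp add: eval_nat_numeral)
    apply (rule silent_Add[of _ _ 3 9 2])
    using code apply (simp add: eval_nat_numeral)
    apply (rule silent_Add[of _ _ 7 7 2])
    using code apply (simp add: eval_nat_numeral)
    apply (rule silent_Jmp[of _ _ l])
    using code apply (simp add: eval_nat_numeral)
    using Suc.prems(5) ne g by (auto simp: silent_def fun_eq_iff)
  have e: "extends R m ?m2" using ne R h by (auto simp: extends_def)
  have "\<exists>m' t. silent Pr t l ?m2 (l + 15) m' \<and> t \<le> 15 * k + 1 \<and> good R m' \<and> repr R m' (m' 5) (nats (rev x))"
  proof (rule Suc.IH)
    show "k + Suc j = length x" using Suc.prems by simp
    show "good R ?m2" using ne R h g by (auto simp: good_def)
    have "repr R ?m2 (m 5) (nats (rev (take j x)))" using repr_extends[OF Suc.prems(3) e] .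
    then show "repr R ?m2 (?m2 5) (nats (rev (take (Suc j) x)))"
      using ne h jl by (simp add: take_Suc_conv_app_nth)
    show "?m2 6 = 2 ^ R * k" "?m2 7 = Suc j + 1" "?m2 8 = 2 ^ R" "?m2 10 = B - 1" "?m2 11 = R"
      "B + R - 1 \<le> ?m2 3"
      using ne Suc.prems h by auto
    show "?m2 (B + i - 1) = x ! (i - 1)" if "1 \<le> i" "i \<le> length x" "i < R" for i
      using Suc.prems(10)[OF that] that h R by auto
    show "?m2 i = x ! (i - 1)" if "R \<le> i" "i \<le> length x" for i
      using Suc.prems(11)[OF that] that h R by auto
  qed
  then obtain m' t where m': "silent Pr t l ?m2 (l + 15) m'" "t \<le> 15 * k + 1" "good R m'"
    "repr R m' (m' 5) (nats (rev x))"
    by blast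
  have "Suc (Suc (Suc (Suc 0))) + t0 + (Suc (Suc (Suc (Suc (Suc (Suc (Suc 0)))))) + t) \<le> 15 * Suc k + 1"
    using t0(1) m' by simp
  then show ?case using silent_trans[OF s1 silent_trans[OF s2 m'(1)]] m'(3,4) by blast
qed

text \<open>The input occupies the low addresses that are needed as registers. Repeated doubling of the
  length in cell 0 gives an address beyond the input without using any other register; from there
  on the first R cells are saved.\<close>
lemma prologue_correct:
  assumes R: "12 \<le> R" and x: "x \<noteq> []" and code: "code_at Pr 0 (prologue R)"
  shows "\<exists>m' t. silent Pr t 0 (mem (init_conf x)) (length (prologue R)) m' \<and>
    t \<le> 4 * R + 20 + 15 * length x \<and> good R m' \<and> repr R m' (m' 5) (nats (rev x))"
proof -
  let ?m0 = "mem (init_conf x)" and ?L = "length x"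
  let ?B = "2 ^ R * ?L"
  have L: "1 \<le> ?L" using x by (simp add: Suc_le_eq)
  \<comment> \<open>R doublings of a positive length exceed both R and the length, so from address
    \<open>?B\<close> on there is neither a register nor an input cell.\<close>
  have RB: "R < ?B" using less_exp[of R] mult_le_mono2[OF L, of "2 ^ R"] by linarith
  have "1 < (2::nat) ^ R" using less_exp[of R] R by linarith
  then have LB: "?L < ?B" using L mult_less_mono1[of 1 "2 ^ R" ?L] by linarith
  let ?l = "R + 2 + 2 * (R - 2) + 11"
  have c1: "code_at Pr 0 (replicate R (Add 0 0 0))"
    and c2: "ins_at Pr R (Store 0 1)" "ins_at Pr (Suc R) (Const 1 1)"
    and c3: "code_at Pr (R + 2) (save_code 2 R)"
    and c4': "code_at Pr (R + 2 + 2 * (R - 2)) (setup_code R)"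
    and c5: "code_at Pr ?l (read_code ?l)"
    using code by (simp_all add: prologue_def add.assoc)
  note c4 = c4'[unfolded setup_code_def]
  have m00: "?m0 0 = ?L" by (simp add: init_conf_def)
  have s1: "silent Pr R 0 ?m0 (0 + R) (?m0(0 := ?B))"
    using silent_double[OF c1, of ?m0] unfolding m00 .
  let ?m1 = "?m0(0 := ?B, ?B := ?m0 1, 1 := 1)"
  have s2: "silent Pr (Suc (Suc 0)) (0 + R) (?m0(0 := ?B)) (R + 2) ?m1"
    apply (rule silent_Store[of _ _ 0 1])
    using c2 apply simp
    apply (rule silent_Const[of _ _ 1 1])
    using c2 apply simp
    by (simp add: silent_def fun_upd_def)
  have "\<exists>m'. silent Pr (2 * (R - 2)) (R + 2) ?m1 (R + 2 + 2 * (R - 2)) m' \<and> m' 0 = ?B + R - 2 \<and>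
    (\<forall>i. 2 \<le> i \<and> i < R \<longrightarrow> m' (?B + i - 1) = ?m1 i) \<and>
    (\<forall>q. q \<noteq> 0 \<and> (q < ?B + 2 - 1 \<or> ?B + R - 1 \<le> q) \<longrightarrow> m' q = ?m1 q)"
    by (rule silent_saves[OF _ _ _ c3]) (use R RB in auto)
  then obtain m2 where m2: "silent Pr (2 * (R - 2)) (R + 2) ?m1 (R + 2 + 2 * (R - 2)) m2"
    "m2 0 = ?B + R - 2" "\<And>i. 2 \<le> i \<Longrightarrow> i < R \<Longrightarrow> m2 (?B + i - 1) = ?m1 i"
    "\<And>q. q \<noteq> 0 \<Longrightarrow> q < ?B + 2 - 1 \<or> ?B + R - 1 \<le> q \<Longrightarrow> m2 q = ?m1 q" by blast
  let ?m3 = "m2(1 := 0, 10 := ?B - 1, 2 := 1, 3 := ?B + R - 1, 0 := 0, 5 := 0, 6 := ?B, 7 := 1, 8 := 2 ^ R, 11 := R)"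
  have ar: "?B + R - 2 - (R - Suc 0) = ?B - Suc 0" "Suc (?B + R - 2) = ?B + R - Suc 0"
    "Suc (?B - Suc 0) = ?B" using R RB by linarith+
  have s3: "silent Pr (Suc (Suc (Suc (Suc (Suc (Suc (Suc (Suc (Suc (Suc (Suc 0))))))))))) (R + 2 + 2 * (R - 2)) m2 ?l ?m3"
    apply (rule silent_Const[of _ _ 1 "R - 1"])
    using c4 apply simp
    apply (rule silent_Sub[of _ _ 10 0 1])
    using c4 apply simp
    apply (rule silent_Const[of _ _ 2 1])
    using c4 apply simp
    apply (rule silent_Add[of _ _ 3 0 2])
    using c4 apply simp
    apply (rule silent_Const[of _ _ 0 0])
    using c4 apply simp
    apply (rule silent_Const[of _ _ 1 0])
    using c4 apply simp
    apply (rule silent_Const[of _ _ 5 0])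
    using c4 apply simp
    apply (rule silent_Add[of _ _ 6 10 2])
    using c4 apply simp
    apply (rule silent_Const[of _ _ 7 1])
    using c4 apply simp
    apply (rule silent_Const[of _ _ 8 "2 ^ R"])
    using c4 apply simp
    apply (rule silent_Const[of _ _ 11 R])
    using c4 apply simp
    using m2(2) ar by (auto simp: silent_def fun_eq_iff)
  have "\<exists>m' t. silent Pr t ?l ?m3 (?l + 15) m' \<and> t \<le> 15 * ?L + 1 \<and> good R m' \<and> repr R m' (m' 5) (nats (rev x))"
  proof (rule read_loop[where B = ?B and j = 0, OF _ _ _ c5])
    show "?m3 (?B + i - 1) = x ! (i - 1)" if "1 \<le> i" "i \<le> ?L" "i < R" for i
    proof (cases "i = 1")
      case True
      then show ?thesis using m2(4)[of ?B] RB R L by (auto simp: init_conf_def)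
    next
      case False
      then show ?thesis using m2(3)[of i] that RB R LB by (auto simp: init_conf_def)
    qed
    show "?m3 i = x ! (i - 1)" if "R \<le> i" "i \<le> ?L" for i
      using m2(4)[of i] that LB R by (auto simp: init_conf_def)
  qed (use R RB LB in \<open>auto simp: good_def\<close>)
  then obtain m' t where t: "silent Pr t ?l ?m3 (?l + 15) m'" "t \<le> 15 * ?L + 1" "good R m'"
    "repr R m' (m' 5) (nats (rev x))" by blast
  have "silent Pr (R + (Suc (Suc 0) + (2 * (R - 2) +
      (Suc (Suc (Suc (Suc (Suc (Suc (Suc (Suc (Suc (Suc (Suc 0)))))))))) + t)))) 0 ?m0 (?l + 15) m'"
    by (intro silent_trans[OF s1] silent_trans[OF s2] silent_trans[OF m2(1)] silent_trans[OF s3] t(1))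
  moreover have "?l + 15 = length (prologue R)" by (simp add: length_prologue)
  ultimately show ?thesis using t R by (intro exI[of _ m'] exI conjI) (assumption | simp)+
qed

section \<open>Generators\<close>

abbreviation cfg :: "nat \<Rightarrow> (nat \<Rightarrow> nat) \<Rightarrow> nat list \<Rightarrow> conf" where
  "cfg a m b \<equiv> \<lparr>pc = a, mem = m, buf = b\<rparr>"

text \<open>Register 8 points to the pair returned by the step code. Its tail goes to register 7,
  where the next round expects the state, and register 9 walks along the output list. An empty
  output jumps past \<open>Emit\<close> (offset 10) to the test of the state (offset 11), and a null
  state leads to \<open>Halt\<close> (offset 13).\<close>

definition emit_code :: "nat \<Rightarrow> nat \<Rightarrow> instr list" where
  "emit_code l a = [Load 9 8, Add 8 8 2, Load 7 8, Jz 9 (a + 11), Load 8 9, Out 8, Add 9 9 2,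
     Load 9 9, Jz 9 (a + 10), Jmp (a + 4), Emit, Jz 7 (a + 13), Jmp l, Halt]"

text \<open>The expression s maps a state to an output (empty for no output) and a new state (null for
  termination).\<close>
definition generator :: "exp \<Rightarrow> exp \<Rightarrow> exp \<Rightarrow> instr list" where
  "generator p i s = (let R = 12 + maxreg p 6 + maxreg i 7 + maxreg s 8; a0 = length (prologue R);
     a1 = a0 + clen p; a2 = a1 + clen i; a3 = a2 + clen s in
     prologue R @ compile p 5 6 a0 @ compile i 6 7 a1 @ compile s 6 8 a2 @ emit_code a2 a3)"

section \<open>Traces, their outputs and their gaps\<close>

definition nones :: "nat list option list \<Rightarrow> nat" where
  "nones tr = length (takeWhile (\<lambda>e. e = None) tr)"

definition outs :: "nat list option list \<Rightarrow> nat list list" where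
  "outs tr = map the (filter (\<lambda>e. e \<noteq> None) tr)"

text \<open>Bounding the leading gap of every suffix covers the gaps before, between and after
  outputs uniformly, and allows a trace to be extended at its front.\<close>

definition gaps_le :: "nat \<Rightarrow> nat list option list \<Rightarrow> bool" where
  "gaps_le B tr \<longleftrightarrow> (\<forall>i\<le>length tr. nones (drop i tr) \<le> B)"

lemma outs_append [simp]: "outs (xs @ ys) = outs xs @ outs ys"
  by (simp add: outs_def)

lemma outs_simps [simp]: "outs [] = []" "outs [Some x] = [x]"
  by (simp_all add: outs_def)

lemma outs_replicate [simp]: "outs (replicate n None) = []"
  by (simp add: outs_def)

lemma nones_append_le: "nones (xs @ ys) \<le> length (filter (\<lambda>e. e = None) xs) + nones ys"
  by (induction xs) (auto simp: nones_def)

lemma filter_drop_le: "length (filter Q (drop i xs)) \<le> length (filter Q xs)"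
  by (metis append_take_drop_id filter_append le_add2 length_append)

text \<open>All silent steps of \<open>xs\<close> are counted, even those separated by an output.
  This is coarse, but \<open>xs\<close> is only ever the start-up phase or a single round.\<close>

lemma gaps_le_append:
  assumes "gaps_le B ys" "length (filter (\<lambda>e. e = None) xs) + nones ys \<le> B"
  shows "gaps_le B (xs @ ys)"
  unfolding gaps_le_def
proof (intro allI impI)
  fix i assume i: "i \<le> length (xs @ ys)"
  show "nones (drop i (xs @ ys)) \<le> B"
  proof (cases "i \<le> length xs")
    case True
    have "nones (drop i xs @ ys) \<le> length (filter (\<lambda>e. e = None) xs) + nones ys"
      using nones_append_le[of "drop i xs" ys] filter_drop_le[of "\<lambda>e. e = None" i xs] by linarith
    with assms(2) True show ?thesis by simp
  next
    case False
    with assms(1) i show ?thesis by (simp add: gaps_le_def)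
  qed
qed

lemma nones_ge:
  assumes "i \<le> j" "j \<le> length tr" "\<forall>l\<in>{i..<j}. tr ! l = None"
  shows "j - i \<le> nones (drop i tr)"
proof -
  have "take (j - i) (drop i tr) = takeWhile (\<lambda>e. e = None) (take (j - i) (drop i tr))"
    using assms by (intro takeWhile_eq_all_conv[THEN iffD2, symmetric]) (auto simp: in_set_conv_nth)
  moreover have "length (takeWhile Q (take n xs)) \<le> length (takeWhile Q xs)" for Q n and xs :: "'a list"
    by (induction xs arbitrary: n) (auto simp: take_Cons split: nat.split)
  ultimately have "length (take (j - i) (drop i tr)) \<le> nones (drop i tr)"
    unfolding nones_def by metis
  then show ?thesis using assms by simp
qed

lemma run_events:
  assumes "run Pr (conf_at Pr x k) tr C"
  shows "conf_at Pr x (k + length tr) = C \<and> (\<forall>l<length tr. event Pr x (k + l) = tr ! l)"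
  using assms
proof (induction tr arbitrary: k)
  case (Cons e es)
  from Cons.prems have e: "event Pr x k = e" and r: "run Pr (conf_at Pr x (Suc k)) es C"
    by (auto simp: event_def)
  from Cons.IH[OF r] e show ?case
    by (auto simp: less_Suc_eq_0_disj)
qed simp

lemma run_enumerates:
  assumes r: "run Pr (init_conf x) tr C" and h: "halted Pr C" and d: "distinct (outs tr)"
    and g: "gaps_le B tr"
  shows "enumerates_with_delay Pr x (set (outs tr)) B"
proof -
  have c: "conf_at Pr x (length tr) = C" "\<And>l. l < length tr \<Longrightarrow> event Pr x l = tr ! l"
    using run_events[of Pr x 0 tr C] r by auto
  have "map (event Pr x) [0..<length tr] = tr"
    by (rule nth_equalityI) (auto simp: c)
  then have o: "outputs_until Pr x (length tr) = outs tr"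
    by (simp add: outputs_until_def outs_def)
  have "j - i \<le> B" if "i \<le> j" "j \<le> length tr" "\<forall>l\<in>{i..<j}. event Pr x l = None" for i j
  proof -
    have "\<forall>l\<in>{i..<j}. tr ! l = None" using that c(2) by auto
    then have "j - i \<le> nones (drop i tr)" using nones_ge that by blast
    also have "\<dots> \<le> B" using g that by (simp add: gaps_le_def)
    finally show ?thesis .
  qed
  then show ?thesis unfolding enumerates_with_delay_def using c h o d
    by (intro exI[of _ "length tr"]) auto
qed

section \<open>One round of a generator\<close>

lemma run_step:
  assumes "ins_at Pr a i" "i \<noteq> Halt" "exec i (cfg a m b) = (C, e)" "run Pr C es C'"
  shows "run Pr (cfg a m b) (e # es) C'"
  using assms by (auto simp: ins_at_def step_def halted_def)

lemma output_step:
  assumes code: "code_at Pr a (emit_code l a)" and R: "12 \<le> R"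
    and m: "good R m" "repr R m (m 9) (nats (x # xs))"
  shows "run Pr (cfg (a + 4) m b) (replicate 5 None)
      (cfg (if m (Suc (m 9)) = 0 then a + 10 else a + 9) (m(8 := x, 9 := m (Suc (m 9)))) (b @ [x]))"
proof -
  note code = code[unfolded emit_code_def]
  have h: "R \<le> m 9" "m (m 9) = x" "m 0 = 0" "m 2 = 1" using m by (auto simp: good_def)
  have n: "replicate 5 None = [None, None, None, None, None :: nat list option]"
    by (simp add: eval_nat_numeral)
  show ?thesis unfolding n
    apply (rule run_step[of _ _ "Load 8 9"])
    using code apply (simp add: eval_nat_numeral)
    apply simp apply simp
    apply (rule run_step[of _ _ "Out 8"])
    using code apply (simp add: eval_nat_numeral)
    apply simp apply simp
    apply (rule run_step[of _ _ "Add 9 9 2"])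
    using code apply (simp add: eval_nat_numeral)
    apply simp apply simp
    apply (rule run_step[of _ _ "Load 9 9"])
    using code apply (simp add: eval_nat_numeral)
    apply simp apply simp
    apply (rule run_step[of _ _ "Jz 9 (a + 10)"])
    using code apply (simp add: eval_nat_numeral)
    apply simp apply simp
    using h R by (auto simp: fun_eq_iff)
qed

lemma output_loop:
  assumes code: "code_at Pr a (emit_code l a)" and R: "12 \<le> R"
    and "good R m" "repr R m (m 9) (nats (x # xs))"
  shows "\<exists>m' t. run Pr (cfg (a + 4) m b) (replicate t None) (cfg (a + 10) m' (b @ x # xs)) \<and>
      t \<le> 6 * (length xs + 1) \<and> good R m' \<and> extends R m m' \<and> keeps 8 m m'"
  using assms(3-)
proof (induction xs arbitrary: m x b)
  case Nil
  let ?m = "m(8 := x, 9 := m (Suc (m 9)))"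
  have "run Pr (cfg (a + 4) m b) (replicate 5 None) (cfg (a + 10) ?m (b @ [x]))"
    using output_step[OF code R Nil, of b] Nil(2) by simp
  moreover have "good R ?m" "extends R m ?m" "keeps 8 m ?m" "5 \<le> 6 * (length [] + 1)"
    using Nil(1) R by (auto simp: good_def extends_def keeps_def)
  ultimately show ?case by blast
next
  case (Cons y ys)
  let ?p = "m (Suc (m 9))"
  have h: "repr R m ?p (nats (y # ys))" "?p \<noteq> 0" using Cons.prems R by auto
  let ?m = "m(8 := x, 9 := ?p)"
  have s: "run Pr (cfg (a + 4) m b) (replicate 5 None) (cfg (a + 9) ?m (b @ [x]))"
    using output_step[OF code R Cons.prems, of b] h(2) by simp
  have j: "run Pr (cfg (a + 9) ?m (b @ [x])) (replicate 1 None) (cfg (a + 4) ?m (b @ [x]))"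
    using code by (simp add: emit_code_def ins_at_def step_def halted_def eval_nat_numeral)
  have m: "good R ?m" "extends R m ?m" "keeps 8 m ?m"
    using Cons.prems R by (auto simp: good_def extends_def keeps_def)
  have "repr R ?m (?m 9) (nats (y # ys))" using repr_extends[OF h(1) m(2)] by simp
  from Cons.IH[OF m(1) this, of "b @ [x]"] obtain m' t where
    m': "run Pr (cfg (a + 4) ?m (b @ [x])) (replicate t None) (cfg (a + 10) m' ((b @ [x]) @ y # ys))"
      "t \<le> 6 * (length ys + 1)" "good R m'" "extends R ?m m'" "keeps 8 ?m m'" by blast
  have "run Pr (cfg (a + 4) m b) (replicate (5 + (1 + t)) None) (cfg (a + 10) m' (b @ x # y # ys))"
    unfolding replicate_add run_append using s j m'(1) by fastforce
  moreover have "5 + (1 + t) \<le> 6 * (length (y # ys) + 1)" using m'(2) by simp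
  ultimately show ?case
    using m'(3) extends_trans[OF m(2) m'(4)] keeps_trans[OF m(3) m'(5)] by blast
qed

lemma silent_run: "silent Pr n a m a' m' \<Longrightarrow>
    run Pr (cfg a m b) (replicate n None) (cfg a' m' b)"
  by (simp add: silent_def)

text \<open>Each number of the output costs at most 6 steps, 5 to append it and one to jump back.
  The constant 6 is made of 4 steps unpacking the result and at most 2 for the test of the new state
  and the jump.\<close>

lemma round_correct:
  assumes code: "code_at Pr l (compile s 6 8 l)" "code_at Pr a (emit_code l a)" "a = l + clen s"
    and ty: "infer s [tg, ts] = Some t" "vty G tg" "vty S ts"
    and R: "12 \<le> R" "maxreg s 8 < R"
    and m: "good R m" "repr R m (m 6) G" "repr R m (m 7) S"
    and ev: "eval s [G, S] = P (nats out) S'"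
  shows "\<exists>m' i j. run Pr (cfg l m [])
      (replicate i None @ (if out = [] then [] else [Some out]) @ replicate j None)
      (cfg (if S' = N 0 then a + 13 else l) m' []) \<and>
      i + j \<le> tm s [G, S] + 6 * length out + 6 \<and> good R m' \<and> repr R m' (m' 6) G \<and> repr R m' (m' 7) S'"
proof -
  note ec = code(2)[unfolded emit_code_def]
  have "computes Pr R (tm s [G, S]) l m (l + clen s) (6 + length [G, S]) (eval s [G, S])"
    by (rule comp_correct[OF ty(1)]) (use ty code R m in \<open>auto simp: env_repr_def less_Suc_eq\<close>)
  then obtain m1 where m1: "silent Pr (tm s [G, S]) l m a m1" "good R m1" "extends R m m1" "keeps 8 m m1"
    "repr R m1 (m1 8) (P (nats out) S')"
    unfolding computes_def using ev code(3) by auto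
  have g1: "m1 0 = 0" "m1 2 = 1" "R \<le> m1 3" using m1(2) by (auto simp: good_def)
  let ?p = "m1 8"
  have h: "R \<le> ?p" "Suc ?p < m1 3" "repr R m1 (m1 ?p) (nats out)" "repr R m1 (m1 (Suc ?p)) S'"
    using m1(5) by auto
  let ?m2 = "m1(9 := m1 ?p, 8 := Suc ?p, 7 := m1 (Suc ?p))"
  have ne: "?p \<noteq> 9" "?p \<noteq> 8" "Suc ?p \<noteq> 9" "Suc ?p \<noteq> 8" using h R by auto
  have s2: "silent Pr (Suc (Suc (Suc (Suc 0)))) a m1 (if m1 ?p = 0 then a + 11 else a + 4) ?m2"
    apply (rule silent_Load[of _ _ 9 8])
    using ec apply simp
    apply (rule silent_Add[of _ _ 8 8 2])
    using ec apply simp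
    apply (rule silent_Load[of _ _ 7 8])
    using ec apply simp
    apply (rule silent_Jz[of _ _ 9 "a + 11"])
    using ec apply simp
    using g1 ne by (auto simp: silent_def fun_eq_iff)
  have m2: "good R ?m2" "extends R m1 ?m2" "keeps 7 m1 ?m2"
    using m1(2) R by (auto simp: good_def extends_def keeps_def)
  have z: "m1 ?p = 0 \<longleftrightarrow> out = []"
    using repr_zero_iff[OF m1(2) h(3)] by (cases out) auto
  have G2: "repr R ?m2 (?m2 6) G"
    using repr_extends[OF m(2) extends_trans[OF m1(3) m2(2)]] m1(4) by (simp add: keeps_def)
  have S2: "repr R ?m2 (?m2 7) S'" using repr_extends[OF h(4) m2(2)] by simp
  have s12: "run Pr (cfg l m []) (replicate (tm s [G, S] + 4) None)
      (cfg (if out = [] then a + 11 else a + 4) ?m2 [])"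
    using silent_run[OF silent_trans[OF m1(1) s2], of "[]"] z by (simp add: eval_nat_numeral)
  have fin: "\<exists>j\<le>2. run Pr (cfg (a + 11) m3 []) (replicate j None)
      (cfg (if S' = N 0 then a + 13 else l) m3 [])"
    if m3: "good R m3" "repr R m3 (m3 7) S'" for m3
  proof (cases "S' = N 0")
    case True
    with m3 have "silent Pr (Suc 0) (a + 11) m3 (a + 13) m3"
      by (intro silent_Jz[of _ _ 7 "a + 13"]) (use ec in \<open>auto simp: eval_nat_numeral\<close>)
    with True show ?thesis by (intro exI[of _ "Suc 0"]) (auto intro: silent_run simp del: replicate.simps)
  next
    case False
    then have "m3 7 \<noteq> 0" using repr_zero_iff[OF m3] by simp
    then have nz: "(if m3 7 = 0 then a + 13 else Suc (a + 11)) = Suc (a + 11)" by simp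
    have "silent Pr (Suc (Suc 0)) (a + 11) m3 l m3"
      apply (rule silent_Jz[of _ _ 7 "a + 13"])
      using ec apply (simp add: eval_nat_numeral)
      unfolding nz
      apply (rule silent_Jmp[of _ _ l])
      using ec apply (simp add: eval_nat_numeral)
      by simp
    with False show ?thesis by (intro exI[of _ "Suc (Suc 0)"]) (auto intro: silent_run simp del: replicate.simps)
  qed
  show ?thesis
  proof (cases "out = []")
    case True
    from fin[OF m2(1) S2] obtain j where j: "j \<le> 2" "run Pr (cfg (a + 11) ?m2 []) (replicate j None)
      (cfg (if S' = N 0 then a + 13 else l) ?m2 [])" by blast
    have "run Pr (cfg l m []) (replicate (tm s [G, S] + 4) None @ replicate j None)
      (cfg (if S' = N 0 then a + 13 else l) ?m2 [])"
      unfolding run_append using s12 j True by (intro exI) auto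
    then show ?thesis using True j m2 G2 S2
      by (intro exI[of _ ?m2] exI[of _ "tm s [G, S] + 4"] exI[of _ j]) auto
  next
    case False
    then obtain x xs where out: "out = x # xs" by (cases out) auto
    have "repr R ?m2 (?m2 9) (nats (x # xs))" using repr_extends[OF h(3) m2(2)] out by simp
    from output_loop[OF code(2) R(1) m2(1) this, of "[]"] obtain m3 t where
      m3: "run Pr (cfg (a + 4) ?m2 []) (replicate t None)
        (cfg (a + 10) m3 ([] @ x # xs))" "t \<le> 6 * (length xs + 1)"
        "good R m3" "extends R ?m2 m3" "keeps 8 ?m2 m3" by blast
    have G3: "repr R m3 (m3 6) G" "repr R m3 (m3 7) S'"
      using repr_extends[OF G2 m3(4)] repr_extends[OF S2 m3(4)] m3(5) by (simp_all add: keeps_def)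
    have s12': "run Pr (cfg l m []) (replicate (tm s [G, S] + 4) None)
        (cfg (a + 4) ?m2 [])" using s12 False by (simp del: run.simps)
    have m3': "run Pr (cfg (a + 4) ?m2 []) (replicate t None)
        (cfg (a + 10) m3 (x # xs))" using m3(1) by (simp del: run.simps)
    have em: "run Pr (cfg (a + 10) m3 (x # xs)) [Some (x # xs)]
        (cfg (a + 11) m3 [])"
      by (rule run_step[of _ _ Emit]) (use ec in \<open>auto simp: eval_nat_numeral\<close>)
    from fin[OF m3(3) G3(2)] obtain j where j: "j \<le> 2" "run Pr (cfg (a + 11) m3 []) (replicate j None)
      (cfg (if S' = N 0 then a + 13 else l) m3 [])" by blast
    have "run Pr (cfg l m [])
      (replicate (tm s [G, S] + 4) None @ replicate t None @ [Some (x # xs)] @ replicate j None)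
      (cfg (if S' = N 0 then a + 13 else l) m3 [])"
      unfolding run_append using s12' m3' em j(2) by blast
    then show ?thesis using False j m3 G3 out
      by (intro exI[of _ m3] exI[of _ "tm s [G, S] + 4 + t"] exI[of _ j]) (auto simp: replicate_add)
  qed
qed

text \<open>Phi bounds the number of rounds before the next output, and rest_of is the set of the outputs
  still to come.\<close>
lemma rounds_correct:
  fixes Inv :: "val \<Rightarrow> bool" and rest_of :: "val \<Rightarrow> nat list set" and Phi :: "val \<Rightarrow> nat"
  assumes code: "code_at Pr l (compile s 6 8 l)" "code_at Pr a (emit_code l a)" "a = l + clen s"
    and ty: "infer s [tg, ts] = Some (TPair (TList TNat) ts)" "vty G tg"
    and R: "12 \<le> R" "maxreg s 8 < R"
    and inv: "\<And>S. Inv S \<Longrightarrow> S \<noteq> N 0 \<and> vty S ts \<and> finite (rest_of S) \<and> Phi S \<le> K"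
    and step: "\<And>S. Inv S \<Longrightarrow> \<exists>out S' rest. eval s [G, S] = P (nats out) S' \<and>
      tm s [G, S] + 6 * length out + 6 \<le> D \<and>
      (S' = N 0 \<and> rest = {} \<or> Inv S' \<and> rest = rest_of S') \<and>
      (out = [] \<and> rest_of S = rest \<and> (S' = N 0 \<or> Phi S' < Phi S) \<or>
       out \<noteq> [] \<and> out \<notin> rest \<and> rest_of S = insert out rest)"
    and "Inv S" "good R m" "repr R m (m 6) G" "repr R m (m 7) S"
  shows "\<exists>tr m'. run Pr (cfg l m []) tr (cfg (a + 13) m' []) \<and>
    distinct (outs tr) \<and> set (outs tr) = rest_of S \<and> nones tr \<le> (Phi S + 1) * D \<and> gaps_le ((K + 2) * D) tr"
  using assms(10-)
\<comment> \<open>A lexicographic measure in one number: an output lowers the cardinality and may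
  reset \<open>Phi\<close>, which never exceeds \<open>K\<close>.\<close>
proof (induction "card (rest_of S) * (K + 1) + Phi S" arbitrary: S m rule: less_induct)
  case less
  from step[OF less.prems(1)] obtain out S' rest where st: "eval s [G, S] = P (nats out) S'"
    "tm s [G, S] + 6 * length out + 6 \<le> D" "S' = N 0 \<and> rest = {} \<or> Inv S' \<and> rest = rest_of S'"
    "out = [] \<and> rest_of S = rest \<and> (S' = N 0 \<or> Phi S' < Phi S) \<or>
       out \<noteq> [] \<and> out \<notin> rest \<and> rest_of S = insert out rest" by blast
  from inv[OF less.prems(1)] have S: "S \<noteq> N 0" "vty S ts" "finite (rest_of S)" "Phi S \<le> K" by auto
  from round_correct[OF code ty(1,2) S(2) R less.prems(2-4) st(1)] obtain m1 i j where
    r: "run Pr (cfg l m [])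
      (replicate i None @ (if out = [] then [] else [Some out]) @ replicate j None)
      (cfg (if S' = N 0 then a + 13 else l) m1 [])"
    "i + j \<le> tm s [G, S] + 6 * length out + 6" "good R m1" "repr R m1 (m1 6) G" "repr R m1 (m1 7) S'"
    by blast
  let ?b = "replicate i None @ (if out = [] then [] else [Some out]) @ replicate j None"
  have ij: "i + j \<le> D" using r(2) st(2) by simp
  have fb: "length (filter (\<lambda>e. e = None) ?b) \<le> D" using ij by simp
  have ob: "outs ?b = (if out = [] then [] else [out])" by (simp add: outs_def)
  have "\<exists>tr m'. run Pr (cfg (if S' = N 0 then a + 13 else l) m1 []) tr
      (cfg (a + 13) m' []) \<and>
    distinct (outs tr) \<and> set (outs tr) = rest \<and>
    nones tr \<le> (if S' = N 0 then 0 else (Phi S' + 1) * D) \<and> gaps_le ((K + 2) * D) tr"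
  proof (cases "S' = N 0")
    case True
    with st(3) inv have "rest = {}" by blast
    with True show ?thesis
      by (intro exI[of _ "[]"] exI[of _ m1]) (auto simp: outs_def nones_def gaps_le_def)
  next
    case False
    with st(3) have S': "Inv S'" "rest = rest_of S'" by auto
    from inv[OF S'(1)] have fin: "finite (rest_of S')" "Phi S' \<le> K" by auto
    have "card (rest_of S') * (K + 1) + Phi S' < card (rest_of S) * (K + 1) + Phi S"
    proof (cases "out = []")
      case True
      with st(4) S' False show ?thesis by auto
    next
      case out: False
      with st(4) S' have "card (rest_of S) = Suc (card (rest_of S'))" using fin by auto
      with fin(2) show ?thesis by simp
    qed
    from less.hyps[OF this S'(1) r(3-5)] False S'(2) show ?thesis by auto
  qed
  then obtain tr m' where tr: "run Pr (cfg (if S' = N 0 then a + 13 else l) m1 []) tr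
      (cfg (a + 13) m' [])" "distinct (outs tr)" "set (outs tr) = rest"
    "nones tr \<le> (if S' = N 0 then 0 else (Phi S' + 1) * D)" "gaps_le ((K + 2) * D) tr" by blast
  have PK: "(if S' = N 0 then 0 else (Phi S' + 1) * D) \<le> (K + 1) * D"
    using st(3) inv[of S'] by (auto intro!: mult_le_mono1)
  have "run Pr (cfg l m []) (?b @ tr) (cfg (a + 13) m' [])"
    using r(1) tr(1) run_append by blast
  moreover have "distinct (outs (?b @ tr))"
    unfolding outs_append ob using tr(2,3) st(4) by auto
  moreover have "set (outs (?b @ tr)) = rest_of S"
    unfolding outs_append ob using tr(3) st(4) by auto
  moreover have "nones (?b @ tr) \<le> (Phi S + 1) * D"
  proof (cases "out = []")
    case True
    have "nones (?b @ tr) \<le> D + nones tr" using nones_append_le[of ?b tr] fb by linarith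
    also have "\<dots> \<le> D + (if S' = N 0 then 0 else (Phi S' + 1) * D)" using tr(4) by simp
    also have "\<dots> \<le> (Phi S + 1) * D"
    proof (cases "S' = N 0")
      case False
      with True st(4) have "Phi S' + 1 \<le> Phi S" by auto
      then have "(Phi S' + 1) * D \<le> Phi S * D" by (rule mult_le_mono1)
      with False show ?thesis by simp
    qed simp
    finally show ?thesis .
  next
    case False
    then have "nones (?b @ tr) = i" by (simp add: nones_def takeWhile_append)
    also have "i \<le> D" using ij by simp
    also have "D \<le> (Phi S + 1) * D" by simp
    finally show ?thesis .
  qed
  \<comment> \<open>A gap may begin in this round, at a cost of at most \<open>D\<close>, and then
    last for up to \<open>K + 1\<close> rounds, the round of the next output included.\<close>
  moreover have "gaps_le ((K + 2) * D) (?b @ tr)"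
  proof (rule gaps_le_append[OF tr(5)])
    have "length (filter (\<lambda>e. e = None) ?b) + nones tr \<le> D + (K + 1) * D" using fb tr(4) PK by linarith
    also have "\<dots> = (K + 2) * D" by simp
    finally show "length (filter (\<lambda>e. e = None) ?b) + nones tr \<le> (K + 2) * D" .
  qed
  ultimately show ?case by blast
qed

theorem generator_correct:
  fixes Inv :: "val \<Rightarrow> bool" and rest_of :: "val \<Rightarrow> nat list set" and Phi :: "val \<Rightarrow> nat"
  assumes ty: "infer p [TList TNat] = Some tg" "infer i [tg] = Some ts"
      "infer s [tg, ts] = Some (TPair (TList TNat) ts)"
    and x: "x \<noteq> []" and G: "G = eval p [nats (rev x)]"
    and inv: "\<And>S. Inv S \<Longrightarrow> S \<noteq> N 0 \<and> finite (rest_of S) \<and> Phi S \<le> K \<and> vty S ts"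
    and step: "\<And>S. Inv S \<Longrightarrow> \<exists>out S' rest. eval s [G, S] = P (nats out) S' \<and>
      tm s [G, S] + 6 * length out + 6 \<le> D \<and>
      (S' = N 0 \<and> rest = {} \<or> Inv S' \<and> rest = rest_of S') \<and>
      (out = [] \<and> rest_of S = rest \<and> (S' = N 0 \<or> Phi S' < Phi S) \<or>
       out \<noteq> [] \<and> out \<notin> rest \<and> rest_of S = insert out rest)"
    and init: "Inv (eval i [G])"
    and B: "4 * (12 + maxreg p 6 + maxreg i 7 + maxreg s 8) + 20 + 15 * length x +
      tm p [nats (rev x)] + tm i [G] + (K + 2) * D \<le> B"
  shows "enumerates_with_delay (generator p i s) x (rest_of (eval i [G])) B"
proof -
  define Pr where "Pr = generator p i s"
  \<comment> \<open>The summand 12 makes room for registers 0 to 11 of the prologue. Registers 5, 6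
    and 7 hold the reversed input, the preprocessed input and the state, which explains the bases
    and result registers passed to \<open>compile\<close>.\<close>
  define R where "R = 12 + maxreg p 6 + maxreg i 7 + maxreg s 8"
  let ?a0 = "length (prologue R)"
  let ?a1 = "?a0 + clen p"
  let ?a2 = "?a1 + clen i"
  let ?a3 = "?a2 + clen s"
  have "Pr = prologue R @ compile p 5 6 ?a0 @ compile i 6 7 ?a1 @ compile s 6 8 ?a2 @ emit_code ?a2 ?a3"
    by (simp add: Pr_def R_def generator_def Let_def)
  then have "code_at Pr 0 (prologue R @ compile p 5 6 ?a0 @ compile i 6 7 ?a1 @ compile s 6 8 ?a2 @ emit_code ?a2 ?a3)"
    using code_at_self[of "[]" _ "[]"] by (metis append_Nil append_Nil2 list.size(3))
  then have c: "code_at Pr 0 (prologue R)" "code_at Pr ?a0 (compile p 5 6 ?a0)"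
    "code_at Pr ?a1 (compile i 6 7 ?a1)" "code_at Pr ?a2 (compile s 6 8 ?a2)" "code_at Pr ?a3 (emit_code ?a2 ?a3)"
    by (simp_all add: add.assoc)
  have R: "12 \<le> R" "maxreg p 6 < R" "maxreg i 7 < R" "maxreg s 8 < R" by (simp_all add: R_def)
  from prologue_correct[OF R(1) x c(1)] obtain m0 t0 where
    m0: "silent Pr t0 0 (mem (init_conf x)) ?a0 m0" "t0 \<le> 4 * R + 20 + 15 * length x" "good R m0"
      "repr R m0 (m0 5) (nats (rev x))" by blast
  have "computes Pr R (tm p [nats (rev x)]) ?a0 m0 ?a1 (5 + length [nats (rev x)]) (eval p [nats (rev x)])"
    by (rule comp_correct[OF ty(1)]) (use c R m0 in \<open>auto simp: env_repr_def\<close>)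
  then obtain m1 where m1: "silent Pr (tm p [nats (rev x)]) ?a0 m0 ?a1 m1" "good R m1" "repr R m1 (m1 6) G"
    unfolding computes_def G by auto
  have vG: "vty G tg" unfolding G by (rule infer_sound[OF ty(1)]) simp
  have "computes Pr R (tm i [G]) ?a1 m1 ?a2 (6 + length [G]) (eval i [G])"
    by (rule comp_correct[OF ty(2)]) (use c R m1 vG in \<open>auto simp: env_repr_def\<close>)
  then obtain m2 where m2: "silent Pr (tm i [G]) ?a1 m1 ?a2 m2" "good R m2" "extends R m1 m2" "keeps 7 m1 m2"
    "repr R m2 (m2 7) (eval i [G])"
    unfolding computes_def by auto
  have G2: "repr R m2 (m2 6) G" using repr_extends[OF m1(3) m2(3)] m2(4) by (simp add: keeps_def)
  let ?t = "t0 + (tm p [nats (rev x)] + tm i [G])"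
  have "silent Pr ?t 0 (mem (init_conf x)) ?a2 m2"
    by (rule silent_trans[OF m0(1) silent_trans[OF m1(1) m2(1)]])
  from silent_run[OF this, of "[]"] have r1: "run Pr (init_conf x) (replicate ?t None) (cfg ?a2 m2 [])"
    by (simp add: init_conf_def)
  have inv': "\<And>S. Inv S \<Longrightarrow> S \<noteq> N 0 \<and> vty S ts \<and> finite (rest_of S) \<and> Phi S \<le> K" using inv by blast
  from rounds_correct[where Inv = Inv and rest_of = rest_of and Phi = Phi and K = K and D = D,
      OF c(4,5) refl ty(3) vG R(1,4) inv' step init m2(2) G2 m2(5)]
  obtain tr m' where tr: "run Pr (cfg ?a2 m2 []) tr (cfg (?a3 + 13) m' [])"
    "distinct (outs tr)" "set (outs tr) = rest_of (eval i [G])" "nones tr \<le> (Phi (eval i [G]) + 1) * D"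
    "gaps_le ((K + 2) * D) tr" by blast
  have r: "run Pr (init_conf x) (replicate ?t None @ tr) (cfg (?a3 + 13) m' [])"
    using r1 tr(1) run_append by blast
  have h: "halted Pr (cfg (?a3 + 13) m' [])"
    using c(5) by (simp add: emit_code_def halted_def ins_at_def eval_nat_numeral)
  have "(Phi (eval i [G]) + 1) * D \<le> (K + 2) * D"
    using inv[OF init] by (intro mult_le_mono1) simp
  then have n: "?t + nones tr \<le> B" using m0(2) tr(4) B unfolding R_def by linarith
  have gB: "gaps_le B tr" using tr(5) B unfolding gaps_le_def by (meson add_leD2 order_trans)
  have "gaps_le B (replicate ?t None @ tr)"
    by (rule gaps_le_append[OF gB]) (use n in simp)
  from run_enumerates[OF r h _ this] tr(2,3) show ?thesis unfolding Pr_def by simp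
qed

section \<open>Representative families\<close>

text \<open>The empty list signals failure. This is unambiguous because the families hold nonempty
  lists only, whence the recurring premise \<open>[] \<notin> set F\<close>.\<close>

definition find_disjoint :: "nat list \<Rightarrow> nat list list \<Rightarrow> nat list" where
  "find_disjoint A F = foldl (\<lambda>acc X. if set X \<inter> set A = {} then X else acc) [] F"

text \<open>One level of Monien's search tree. A node is a list \<open>A\<close> of forbidden
  elements; it selects a member of \<open>F\<close> disjoint from \<open>A\<close> and gets one
  child for each element of that member. The second component collects the selected members.\<close>

definition rep_round :: "nat list list \<Rightarrow> nat list list \<times> nat list list \<Rightarrow> nat list list \<times> nat list list" where
  "rep_round F = (\<lambda>(fr, out). foldl (\<lambda>(fr', out') A.
     let X = find_disjoint A F in
     if X = [] then (fr', out') else (foldl (\<lambda>fr'' x. (x # A) # fr'') fr' X, X # out')) ([], out) fr)"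

text \<open>The tree has \<open>Suc q\<close> levels because its nodes forbid 0 to \<open>q\<close>
  elements.\<close>

definition rep_family :: "nat list list \<Rightarrow> nat \<Rightarrow> nat list list" where
  "rep_family F q = snd ((rep_round F ^^ Suc q) ([[]], []))"

lemma find_disjoint:
  assumes "[] \<notin> set F"
  shows "find_disjoint A F = [] \<longleftrightarrow> (\<forall>X\<in>set F. set X \<inter> set A \<noteq> {})"
    "find_disjoint A F \<noteq> [] \<Longrightarrow> find_disjoint A F \<in> set F \<and> set (find_disjoint A F) \<inter> set A = {}"
proof -
  have "(find_disjoint A F = [] \<longleftrightarrow> (\<forall>X\<in>set F. set X \<inter> set A \<noteq> {})) \<and>
    (find_disjoint A F \<noteq> [] \<longrightarrow> find_disjoint A F \<in> set F \<and> set (find_disjoint A F) \<inter> set A = {})"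
    using assms by (induction F rule: rev_induct) (auto simp: find_disjoint_def)
  then show "find_disjoint A F = [] \<longleftrightarrow> (\<forall>X\<in>set F. set X \<inter> set A \<noteq> {})"
    "find_disjoint A F \<noteq> [] \<Longrightarrow> find_disjoint A F \<in> set F \<and> set (find_disjoint A F) \<inter> set A = {}"
    by auto
qed

lemma set_foldl_Cons: "set (foldl (\<lambda>a x. f x # a) b xs) = set b \<union> f ` set xs"
  by (induction xs arbitrary: b) auto

lemma length_foldl_Cons [simp]: "length (foldl (\<lambda>a x. f x # a) b xs) = length b + length xs"
  by (induction xs arbitrary: b) auto

lemma rep_round_foldl:
  "foldl (\<lambda>(fr', out') A. let X = find_disjoint A F in
     if X = [] then (fr', out') else (foldl (\<lambda>fr'' x. (x # A) # fr'') fr' X, X # out')) (a, b) fr = (a', b') \<Longrightarrow>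
   set a' = set a \<union> {x # A | x A. A \<in> set fr \<and> x \<in> set (find_disjoint A F)} \<and>
   set b' = set b \<union> {find_disjoint A F | A. A \<in> set fr \<and> find_disjoint A F \<noteq> []}"
proof (induction fr arbitrary: a b)
  case (Cons A fr)
  show ?case
  proof (cases "find_disjoint A F = []")
    case True
    with Cons.prems have "foldl (\<lambda>(fr', out') A. let X = find_disjoint A F in
       if X = [] then (fr', out') else (foldl (\<lambda>fr'' x. (x # A) # fr'') fr' X, X # out')) (a, b) fr = (a', b')"
      by simp
    from Cons.IH[OF this] True show ?thesis by auto
  next
    case False
    with Cons.prems have "foldl (\<lambda>(fr', out') A. let X = find_disjoint A F in
       if X = [] then (fr', out') else (foldl (\<lambda>fr'' x. (x # A) # fr'') fr' X, X # out'))
       (foldl (\<lambda>fr'' x. (x # A) # fr'') a (find_disjoint A F), find_disjoint A F # b) fr = (a', b')"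
      by (simp add: Let_def)
    from Cons.IH[OF this] False show ?thesis by (auto simp: set_foldl_Cons)
  qed
qed simp

lemma rep_round_sets:
  "set (fst (rep_round F (fr, out))) = {x # A | x A. A \<in> set fr \<and> x \<in> set (find_disjoint A F)}"
  "set (snd (rep_round F (fr, out))) = set out \<union> {find_disjoint A F | A. A \<in> set fr \<and> find_disjoint A F \<noteq> []}"
proof -
  obtain a' b' where "rep_round F (fr, out) = (a', b')" by fastforce
  from rep_round_foldl[OF this[unfolded rep_round_def prod.case]] this
  show "set (fst (rep_round F (fr, out))) = {x # A | x A. A \<in> set fr \<and> x \<in> set (find_disjoint A F)}"
    "set (snd (rep_round F (fr, out))) = set out \<union> {find_disjoint A F | A. A \<in> set fr \<and> find_disjoint A F \<noteq> []}"
    by auto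
qed

lemma length_find_disjoint:
  assumes "\<And>X. X \<in> set F \<Longrightarrow> length X \<le> p"
  shows "length (find_disjoint A F) \<le> p"
  using assms unfolding find_disjoint_def by (induction F rule: rev_induct) auto

lemma rep_round_length:
  assumes "\<And>X. X \<in> set F \<Longrightarrow> length X \<le> p"
  shows "length (fst (rep_round F (fr, out))) \<le> p * length fr"
    "length (snd (rep_round F (fr, out))) \<le> length out + length fr"
proof -
  have f: "length (find_disjoint A F) \<le> p" for A
    using length_find_disjoint assms by blast
  have "length (fst (foldl (\<lambda>(fr', out') A. let X = find_disjoint A F in
     if X = [] then (fr', out') else (foldl (\<lambda>fr'' x. (x # A) # fr'') fr' X, X # out')) (a, b) fr)) \<le> length a + p * length fr \<and>
    length (snd (foldl (\<lambda>(fr', out') A. let X = find_disjoint A F in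
     if X = [] then (fr', out') else (foldl (\<lambda>fr'' x. (x # A) # fr'') fr' X, X # out')) (a, b) fr)) \<le> length b + length fr" for a b
  proof (induction fr arbitrary: a b)
    case (Cons A fr)
    show ?case
    proof (cases "find_disjoint A F = []")
      case True
      with Cons[of a b] show ?thesis by auto
    next
      case False
      with Cons[of "foldl (\<lambda>fr'' x. (x # A) # fr'') a (find_disjoint A F)" "find_disjoint A F # b"] f[of A]
      show ?thesis by (auto simp: Let_def)
    qed
  qed simp
  from this[of "[]" out]
  show "length (fst (rep_round F (fr, out))) \<le> p * length fr"
    "length (snd (rep_round F (fr, out))) \<le> length out + length fr"
    by (simp_all add: rep_round_def)
qed

text \<open>The sum of both lengths serves as a potential: every frontier node is replaced by at
  most \<open>p\<close> children and contributes at most one member, so the sum grows at most by the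
  factor \<open>p + 1\<close>.\<close>

lemma rep_rounds_length:
  assumes "\<And>X. X \<in> set F \<Longrightarrow> length X \<le> p"
  shows "length (fst ((rep_round F ^^ r) ([[]], []))) + length (snd ((rep_round F ^^ r) ([[]], []))) \<le> (p + 1) ^ r"
proof (induction r)
  case (Suc r)
  obtain fr out where fo: "(rep_round F ^^ r) ([[]], []) = (fr, out)" by fastforce
  have "length (fst (rep_round F (fr, out))) + length (snd (rep_round F (fr, out))) \<le>
      p * length fr + (length out + length fr)"
    using assms by (intro add_mono rep_round_length) auto
  also have "\<dots> \<le> (p + 1) * (length fr + length out)" by (simp add: algebra_simps)
  also have "\<dots> \<le> (p + 1) * (p + 1) ^ r" using Suc fo by (intro mult_le_mono2) simp
  finally show ?case using fo by simp
qed simp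

lemma rep_rounds_element_length:
  "A \<in> set (fst ((rep_round F ^^ r) ([[]], []))) \<Longrightarrow> length A = r"
proof (induction r arbitrary: A)
  case (Suc r)
  obtain fr out where fo: "(rep_round F ^^ r) ([[]], []) = (fr, out)" by fastforce
  with Suc show ?case by (auto simp: rep_round_sets)
qed simp

lemma rep_family_subset:
  assumes "[] \<notin> set F"
  shows "set (rep_family F q) \<subseteq> set F"
proof -
  have "set (snd ((rep_round F ^^ r) ([[]], []))) \<subseteq> set F" for r
  proof (induction r)
    case (Suc r)
    obtain fr out where fo: "(rep_round F ^^ r) ([[]], []) = (fr, out)" by fastforce
    with Suc find_disjoint(2)[OF assms] show ?case by (auto simp: rep_round_sets)
  qed simp
  then show ?thesis unfolding rep_family_def by blast
qed

text \<open>Follow the branch of the search tree whose forbidden elements all lie in Y.\<close>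
lemma rep_family_represents:
  assumes F: "[] \<notin> set F" and Z: "Z \<in> set F" "set Z \<inter> Y = {}" and Y: "finite Y" "card Y \<le> q"
  shows "\<exists>X\<in>set (rep_family F q). set X \<inter> Y = {}"
proof (rule ccontr)
  assume no: "\<not> ?thesis"
  have mono: "set (snd ((rep_round F ^^ r) ([[]], []))) \<subseteq> set (snd ((rep_round F ^^ (r + d)) ([[]], [])))" for r d
  proof (induction d)
    case (Suc d)
    obtain fr out where "(rep_round F ^^ (r + d)) ([[]], []) = (fr, out)" by fastforce
    with Suc show ?case by (auto simp: rep_round_sets)
  qed simp
  \<comment> \<open>While every collected member meets \<open>Y\<close>, a node with forbidden
    elements in \<open>Y\<close> has a child with one more of them. The node never fails to find a
    member, because \<open>Z\<close> is disjoint from its forbidden elements.\<close>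
  have "r \<le> Suc q \<Longrightarrow> \<exists>A\<in>set (fst ((rep_round F ^^ r) ([[]], []))). distinct A \<and> set A \<subseteq> Y" for r
  proof (induction r)
    case (Suc r)
    then obtain A where A: "A \<in> set (fst ((rep_round F ^^ r) ([[]], [])))" "distinct A" "set A \<subseteq> Y" by auto
    obtain fr out where fo: "(rep_round F ^^ r) ([[]], []) = (fr, out)" by fastforce
    let ?X = "find_disjoint A F"
    have "set Z \<inter> set A = {}" using Z A by blast
    then have X: "?X \<noteq> []" using find_disjoint(1)[OF F] Z by blast
    then have XA: "set ?X \<inter> set A = {}" using find_disjoint(2)[OF F] by blast
    have "?X \<in> set (snd ((rep_round F ^^ Suc r) ([[]], [])))"
      using fo A X by (auto simp: rep_round_sets)
    then have "?X \<in> set (rep_family F q)" using mono[of "Suc r" "q - r"] Suc.prems unfolding rep_family_def by auto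
    with no obtain x where x: "x \<in> set ?X" "x \<in> Y" by blast
    then have "x # A \<in> set (fst ((rep_round F ^^ Suc r) ([[]], [])))"
      using fo A by (auto simp: rep_round_sets)
    moreover have "distinct (x # A)" "set (x # A) \<subseteq> Y" using A x XA by auto
    ultimately show ?case by blast
  qed simp
  \<comment> \<open>On this level the branch would have \<open>q + 1\<close> distinct forbidden
    elements, all of them in \<open>Y\<close>.\<close>
  from this[of "Suc q"] obtain A where A: "A \<in> set (fst ((rep_round F ^^ Suc q) ([[]], [])))" "distinct A" "set A \<subseteq> Y"
    by blast
  from rep_rounds_element_length[OF A(1)] have "length A = Suc q" .
  with A(2,3) Y show False using card_mono[OF Y(1) A(3)] distinct_card[OF A(2)] by simp
qed

section \<open>Long paths\<close>

text \<open>In the computed structures edges are stored as (target, source) and paths in reverse, so that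
  the last vertex is the head of the list.\<close>
definition candidates :: "(nat \<times> nat) list \<Rightarrow> nat list list \<Rightarrow> nat \<Rightarrow> nat list list" where
  "candidates D L v = foldl (\<lambda>acc z. if v \<in> set z then acc
     else if (v, hd z) \<in> set D then (v # z) # acc else acc) [] L"

text \<open>Families are kept apart by end vertex, since a representative must end where the path it
  replaces ends in order to be continued in the same way.\<close>

definition level :: "(nat \<times> nat) list \<Rightarrow> nat list \<Rightarrow> nat list \<Rightarrow> nat \<Rightarrow> nat list list \<Rightarrow> nat list list" where
  "level D V B q L = foldl (\<lambda>acc v. if v \<in> set B then acc
     else foldl (\<lambda>a x. x # a) acc (rep_family (candidates D L v) q)) [] V"

definition reach_round :: "(nat \<times> nat) list \<Rightarrow> nat list \<Rightarrow> nat list \<Rightarrow> nat list" where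
  "reach_round D B R = foldl (\<lambda>R e. if snd e \<in> set R then if fst e \<in> set R then R
     else if fst e \<in> set B then R else fst e # R else R) R D"

definition reach :: "(nat \<times> nat) list \<Rightarrow> nat \<Rightarrow> nat list \<Rightarrow> nat \<Rightarrow> nat list" where
  "reach D n B v = (reach_round D B ^^ n) [v]"

definition long_path :: "(nat \<times> nat) list \<Rightarrow> nat \<Rightarrow> nat list \<Rightarrow> nat \<Rightarrow> nat \<Rightarrow> nat \<Rightarrow> bool" where
  "long_path D n B k c t = foldl (\<lambda>acc X. if t \<in> set (reach D n (foldl (\<lambda>a x. x # a) B (tl X)) (hd X))
     then True else acc) False ((level D [0..<n] B (k + k) ^^ k) [[c]])"

abbreviation walk :: "(nat \<times> nat) list \<Rightarrow> nat list \<Rightarrow> bool" where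
  "walk D \<equiv> successively (\<lambda>u v. (v, u) \<in> set D)"

definition free_path :: "(nat \<times> nat) list \<Rightarrow> nat \<Rightarrow> nat set \<Rightarrow> nat \<Rightarrow> nat list \<Rightarrow> bool" where
  "free_path D n B c p \<longleftrightarrow> p \<noteq> [] \<and> hd p = c \<and> distinct p \<and> set p \<subseteq> {..<n} - B \<and> walk D p"

lemma candidates_set:
  "set (candidates D L v) = {v # z | z. z \<in> set L \<and> v \<notin> set z \<and> (v, hd z) \<in> set D}"
proof -
  have "set (foldl (\<lambda>acc z. if v \<in> set z then acc
     else if (v, hd z) \<in> set D then (v # z) # acc else acc) a L) =
     set a \<union> {v # z | z. z \<in> set L \<and> v \<notin> set z \<and> (v, hd z) \<in> set D}" for a
    by (induction L arbitrary: a) auto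
  then show ?thesis by (simp add: candidates_def)
qed

lemma candidates_length: "length (candidates D L v) \<le> length L"
proof -
  have "length (foldl (\<lambda>acc z. if v \<in> set z then acc
     else if (v, hd z) \<in> set D then (v # z) # acc else acc) a L) \<le> length a + length L" for a
  proof (induction L arbitrary: a)
    case (Cons z L)
    from Cons[of a] Cons[of "(v # z) # a"] show ?case by auto
  qed simp
  from this[of "[]"] show ?thesis by (simp add: candidates_def)
qed

lemma level_set: "set (level D V B q L) = (\<Union>v\<in>set V - set B. set (rep_family (candidates D L v) q))"
proof -
  have "set (foldl (\<lambda>acc v. if v \<in> set B then acc
     else foldl (\<lambda>a x. x # a) acc (rep_family (candidates D L v) q)) a V) =
     set a \<union> (\<Union>v\<in>set V - set B. set (rep_family (candidates D L v) q))" for a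
    by (induction V arbitrary: a) (auto simp: set_foldl_Cons[where f = "\<lambda>x. x", simplified])
  then show ?thesis by (simp add: level_def)
qed

lemma level_length:
  assumes "\<And>v. v \<in> set V \<Longrightarrow> length (rep_family (candidates D L v) q) \<le> w"
  shows "length (level D V B q L) \<le> length V * w"
proof -
  have "length (foldl (\<lambda>acc v. if v \<in> set B then acc
     else foldl (\<lambda>a x. x # a) acc (rep_family (candidates D L v) q)) a V) \<le> length a + length V * w" for a
    using assms
  proof (induction V arbitrary: a)
    case (Cons v V)
    have "length (rep_family (candidates D L v) q) \<le> w" using Cons.prems by simp
    with Cons.IH[of a] Cons.IH[of "foldl (\<lambda>a x. x # a) a (rep_family (candidates D L v) q)"] Cons.prems
    show ?case by fastforce
  qed simp
  from this[of "[]"] show ?thesis by (simp add: level_def)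
qed

lemma free_path_snoc:
  assumes "z \<noteq> []"
  shows "free_path D n B c (rev (v # z)) \<longleftrightarrow>
    free_path D n B c (rev z) \<and> (v, hd z) \<in> set D \<and> v \<notin> set z \<and> v < n \<and> v \<notin> B"
  using assms by (auto simp: free_path_def successively_append_iff last_rev)

lemma free_path_take: "free_path D n B c (xs @ v # ys) \<Longrightarrow> free_path D n B c (xs @ [v])"
  using successively_append_iff[of "\<lambda>u v. (v, u) \<in> set D" "xs @ [v]" ys]
  by (cases xs) (auto simp: free_path_def)

lemma levels_sound:
  assumes "c < n" "c \<notin> set B"
  shows "z \<in> set ((level D [0..<n] B q ^^ i) [[c]]) \<Longrightarrow> length z = Suc i \<and> free_path D n (set B) c (rev z)"
proof (induction i arbitrary: z)
  case 0
  with assms show ?case by (auto simp: free_path_def)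
next
  case (Suc i)
  let ?L = "(level D [0..<n] B q ^^ i) [[c]]"
  from Suc.prems obtain v where v: "v < n" "v \<notin> set B" "z \<in> set (rep_family (candidates D ?L v) q)"
    by (auto simp: level_set)
  have "[] \<notin> set (candidates D ?L v)" by (auto simp: candidates_set)
  from rep_family_subset[OF this] v(3) have "z \<in> set (candidates D ?L v)" by blast
  then obtain y where y: "z = v # y" "y \<in> set ?L" "v \<notin> set y" "(v, hd y) \<in> set D"
    by (auto simp: candidates_set)
  from Suc.IH[OF y(2)] have "length y = Suc i" "free_path D n (set B) c (rev y)" by auto
  moreover from this have "y \<noteq> []" by auto
  ultimately show ?case using y v free_path_snoc[of y D n "set B" c v] by auto
qed

text \<open>Splitting off the last vertex \<open>v\<close> moves it into the set to be avoided, for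
  otherwise it could not be appended again to the replacement. The avoided set thus grows by one for
  each edge, whence \<open>card Y + i \<le> q\<close>; for k edges and k avoided vertices this is
  the \<open>k + k\<close> in \<open>long_path\<close>.\<close>

lemma levels_represent:
  assumes "free_path D n (set B) c (rev z)" "length z = Suc i" "set z \<inter> Y = {}" "finite Y" "card Y + i \<le> q"
  shows "\<exists>z'\<in>set ((level D [0..<n] B q ^^ i) [[c]]). hd z' = hd z \<and> set z' \<inter> Y = {}"
  using assms
proof (induction i arbitrary: z Y)
  case 0
  then have "z = [c]" by (cases z) (auto simp: free_path_def)
  with 0 show ?case by simp
next
  case (Suc i)
  let ?L = "(level D [0..<n] B q ^^ i) [[c]]"
  from Suc.prems(2) obtain v y where z: "z = v # y" "length y = Suc i" by (cases z) auto
  then have "y \<noteq> []" by auto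
  from free_path_snoc[OF this] Suc.prems(1) z have
    y: "free_path D n (set B) c (rev y)" "(v, hd y) \<in> set D" "v \<notin> set y" "v < n" "v \<notin> set B" by auto
  have "card (insert v Y) \<le> Suc (card Y)" using Suc.prems(4) by (simp add: card_insert_if)
  with Suc.IH[OF y(1) z(2), of "insert v Y"] Suc.prems y(3) z(1) obtain y' where
    y': "y' \<in> set ?L" "hd y' = hd y" "set y' \<inter> insert v Y = {}" by fastforce
  have "v # y' \<in> set (candidates D ?L v)" using y' y by (auto simp: candidates_set)
  moreover have ne: "[] \<notin> set (candidates D ?L v)" by (auto simp: candidates_set)
  moreover have "set (v # y') \<inter> Y = {}" using y' Suc.prems z by auto
  ultimately obtain X where X: "X \<in> set (rep_family (candidates D ?L v) q)" "set X \<inter> Y = {}"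
    using rep_family_represents[OF ne _ _ Suc.prems(4), of "v # y'" q] Suc.prems(5) by auto
  from rep_family_subset[OF ne] X(1) have "X \<in> set (candidates D ?L v)" by blast
  then have "hd X = v" by (auto simp: candidates_set)
  moreover have "X \<in> set ((level D [0..<n] B q ^^ Suc i) [[c]])"
    using X(1) y by (auto simp: level_set)
  ultimately show ?case using X(2) z by auto
qed

section \<open>Reachability around a forbidden set\<close>

definition spanned :: "(nat \<times> nat) list \<Rightarrow> nat \<Rightarrow> nat set \<Rightarrow> bool" where
  "spanned D v R \<longleftrightarrow> (\<forall>w\<in>R. \<exists>p. p \<noteq> [] \<and> hd p = v \<and> last p = w \<and> distinct p \<and> set p \<subseteq> R \<and> walk D p)"

text \<open>The witnessing paths stay inside \<open>R\<close>, so appending a vertex from outside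
  \<open>R\<close> keeps them simple.\<close>

lemma spanned_insert:
  assumes R: "spanned D v R" and u: "u \<in> R" "w \<notin> R" "(w, u) \<in> set D"
  shows "spanned D v (insert w R)"
  unfolding spanned_def
proof
  fix x assume "x \<in> insert w R"
  then consider "x = w" | "x \<in> R" by blast
  then show "\<exists>p. p \<noteq> [] \<and> hd p = v \<and> last p = x \<and> distinct p \<and> set p \<subseteq> insert w R \<and> walk D p"
  proof cases
    case 1
    from R u(1) obtain p where p: "p \<noteq> []" "hd p = v" "last p = u" "distinct p" "set p \<subseteq> R" "walk D p"
      unfolding spanned_def by blast
    have "walk D (p @ [w])" "distinct (p @ [w])" using p u by (auto simp: successively_append_iff)
    with p 1 show ?thesis by (intro exI[of _ "p @ [w]"]) auto
  next
    case 2
    with R show ?thesis unfolding spanned_def by blast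
  qed
qed

lemma reach_round_sound:
  assumes "spanned D v (set R)" "set R \<subseteq> insert v ({..<n} - set B)" "fst ` set D \<subseteq> {..<n}"
  shows "spanned D v (set (reach_round D B R)) \<and> set (reach_round D B R) \<subseteq> insert v ({..<n} - set B)"
proof -
  let ?f = "\<lambda>R e. if snd e \<in> set R then if fst e \<in> set R then R
     else if fst e \<in> set B then R else fst e # R else R"
  have "set D' \<subseteq> set D \<Longrightarrow> spanned D v (set (foldl ?f R D')) \<and>
    set (foldl ?f R D') \<subseteq> insert v ({..<n} - set B)" for D'
  proof (induction D' rule: rev_induct)
    case Nil
    then show ?case using assms by auto
  next
    case (snoc e D')
    then have "fst e < n" "(fst e, snd e) \<in> set D" using assms(3) by auto
    with snoc spanned_insert[of D v "set (foldl ?f R D')" "snd e" "fst e"] show ?case by auto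
  qed
  from this[of D] show ?thesis unfolding reach_round_def by simp
qed

lemma reach_sound:
  assumes "fst ` set D \<subseteq> {..<n}"
  shows "spanned D v (set ((reach_round D B ^^ i) [v])) \<and>
    set ((reach_round D B ^^ i) [v]) \<subseteq> insert v ({..<n} - set B)"
proof (induction i)
  case 0
  have "\<exists>p. p \<noteq> [] \<and> hd p = v \<and> last p = v \<and> distinct p \<and> set p \<subseteq> {v} \<and> walk D p"
    by (rule exI[of _ "[v]"]) simp
  then show ?case by (simp add: spanned_def)
next
  case (Suc i)
  then show ?case using reach_round_sound[of D v "(reach_round D B ^^ i) [v]" n B] assms
    by simp
qed

lemma reach_round_distinct: "distinct R \<Longrightarrow> distinct (reach_round D B R)"
  unfolding reach_round_def by (induction D arbitrary: R) auto

lemma reach_round_mono: "set R \<subseteq> set (reach_round D B R)"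
  unfolding reach_round_def
proof (induction D arbitrary: R)
  case (Cons e D)
  from Cons[of R] Cons[of "fst e # R"] show ?case by auto
qed simp

lemma reach_round_step:
  assumes "u \<in> set R" "(w, u) \<in> set D" "w \<notin> set B"
  shows "w \<in> set (reach_round D B R)"
  using assms
proof (induction D arbitrary: R)
  case (Cons e D)
  let ?R = "if snd e \<in> set R then if fst e \<in> set R then R
     else if fst e \<in> set B then R else fst e # R else R"
  have eq: "reach_round (e # D) B R = reach_round D B ?R" by (simp add: reach_round_def)
  show ?case
  proof (cases "e = (w, u)")
    case True
    then have "w \<in> set ?R" using Cons.prems by auto
    then show ?thesis unfolding eq using reach_round_mono by blast
  next
    case False
    then show ?thesis unfolding eq using Cons by auto
  qed
qed simp

lemma reach_complete:
  assumes "p \<noteq> []" "hd p = v" "set (tl p) \<inter> set B = {}" "walk D p" "length p \<le> Suc i"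
  shows "last p \<in> set ((reach_round D B ^^ i) [v])"
  using assms
proof (induction i arbitrary: p)
  case 0
  then show ?case by (cases p) auto
next
  case (Suc i)
  show ?case
  proof (cases "length p = 1")
    case True
    with Suc.prems have "last p = v" by (cases p) auto
    moreover have "v \<in> set ((reach_round D B ^^ j) [v])" for j
      by (induction j) (use reach_round_mono in auto)
    ultimately show ?thesis by metis
  next
    case False
    then obtain p' w where p: "p = p' @ [w]" "p' \<noteq> []"
      using Suc.prems(1) by (cases p rule: rev_cases) auto
    then have "last p' \<in> set ((reach_round D B ^^ i) [v])"
      using Suc.prems by (intro Suc.IH) (auto simp: successively_append_iff)
    moreover have "(w, last p') \<in> set D" using Suc.prems p by (auto simp: successively_append_iff)
    moreover have "w \<notin> set B" using Suc.prems(3) p by auto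
    ultimately show ?thesis using p by (auto intro: reach_round_step)
  qed
qed

section \<open>Correctness of the long path test\<close>

lemma long_path_iff_reach:
  "long_path D n B k c t \<longleftrightarrow> (\<exists>X\<in>set ((level D [0..<n] B (k + k) ^^ k) [[c]]).
     t \<in> set (reach D n (foldl (\<lambda>a x. x # a) B (tl X)) (hd X)))"
proof -
  have "foldl (\<lambda>acc X. if Q X then True else acc) b L \<longleftrightarrow> b \<or> (\<exists>X\<in>set L. Q X)" for Q b and L :: "nat list list"
    by (induction L arbitrary: b) auto
  then show ?thesis by (simp add: long_path_def)
qed

text \<open>Exchange argument: if a replacement for the first k + 1 vertices of a shortest path of length
  at least k meets the rest of that path, then it does so before the last k vertices, and leaving
  it at its first vertex on the path gives a shorter path that is still long enough.\<close>
lemma shortest_exchange: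
  assumes p: "free_path D n B c (A @ v # T)" "length A = k"
    and min: "\<And>p'. free_path D n B c p' \<Longrightarrow> last p' = last (A @ v # T) \<Longrightarrow> k < length p' \<Longrightarrow>
      length (A @ v # T) \<le> length p'"
    and q: "free_path D n B c (A' @ [v])" "length A' = k"
    and Y: "set (A' @ [v]) \<inter> set (drop (length T - k) T) = {}"
  shows "set A' \<inter> set T = {}"
proof (rule ccontr)
  assume "set A' \<inter> set T \<noteq> {}"
  then obtain w where "w \<in> set A'" "w \<in> set T" by blast
  then obtain A1 w A2 where A: "A' = A1 @ w # A2" "w \<in> set T" "\<forall>x\<in>set A1. x \<notin> set T"
    using split_list_first_prop[of A' "\<lambda>x. x \<in> set T"] by blast
  obtain T1 T2 where T: "T = T1 @ w # T2" using A(2) split_list by metis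
  have lw: "length T1 < length T - k"
  proof (rule ccontr)
    assume "\<not> ?thesis"
    then have "w \<in> set (drop (length T - k) T)" by (simp add: T)
    with Y A(1) show False by auto
  qed
  let ?p = "A1 @ w # T2"
  have "free_path D n B c ?p"
    using p(1) q(1) A T unfolding free_path_def
    by (auto simp: successively_append_iff successively_Cons hd_append split: if_splits)
  moreover have "last ?p = last (A @ v # T)" by (simp add: T)
  \<comment> \<open>By \<open>lw\<close> at least \<open>k\<close> vertices of \<open>T\<close>
    follow \<open>w\<close>, and \<open>w\<close> itself is one more.\<close>
  moreover have "k < length ?p" using lw by (simp add: T)
  \<comment> \<open>This is absurd: \<open>A1\<close> is shorter than \<open>A\<close>, and
    \<open>T2\<close> is a proper part of \<open>T\<close>.\<close>
  ultimately have "length (A @ v # T) \<le> length ?p" using min by blast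
  then show False using p(2) q(2) A(1) by (simp add: T)
qed

theorem long_path_correct:
  assumes c: "c < n" "c \<notin> set B" and D: "fst ` set D \<subseteq> {..<n}"
  shows "long_path D n B k c t \<longleftrightarrow> (\<exists>p. free_path D n (set B) c p \<and> last p = t \<and> k < length p)"
proof
  assume "long_path D n B k c t"
  then obtain X where X: "X \<in> set ((level D [0..<n] B (k + k) ^^ k) [[c]])"
    "t \<in> set (reach D n (foldl (\<lambda>a x. x # a) B (tl X)) (hd X))"
    unfolding long_path_iff_reach by blast
  let ?B = "foldl (\<lambda>a x. x # a) B (tl X)"
  have B: "set ?B = set B \<union> set (tl X)" by (simp add: set_foldl_Cons[where f = "\<lambda>x. x", simplified])
  from levels_sound[OF c X(1)] have X': "length X = Suc k" "free_path D n (set B) c (rev X)" by auto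
  then obtain v z where z: "X = v # z" by (cases X) auto
  have "set ((reach_round D ?B ^^ n) [v]) \<subseteq> insert v ({..<n} - set ?B)"
    "\<exists>p. p \<noteq> [] \<and> hd p = v \<and> last p = t \<and> distinct p \<and> set p \<subseteq> set ((reach_round D ?B ^^ n) [v]) \<and> walk D p"
    using reach_sound[where D = D and n = n and B = ?B and v = v and i = n, OF D] X(2)
    unfolding spanned_def reach_def z list.sel by auto
  then obtain p where p: "p \<noteq> []" "hd p = v" "last p = t" "distinct p" "walk D p"
    "set p \<subseteq> insert v ({..<n} - set ?B)" by blast
  then obtain p' where p': "p = v # p'" by (cases p) auto
  have s: "set p' \<subseteq> {..<n} - (set B \<union> set z)" using p(4,6) B by (auto simp: p' z)
  have h: "hd (rev z @ v # p') = hd (rev z @ [v])" by (cases "rev z") auto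
  have "free_path D n (set B) c (rev z @ v # p')"
    using p X'(2) s h unfolding free_path_def p' z
    by (auto simp: successively_append_iff)
  then show "\<exists>p. free_path D n (set B) c p \<and> last p = t \<and> k < length p"
    using X'(1) p(3) unfolding z p' by (intro exI[of _ "rev z @ v # p'"]) auto
next
  assume "\<exists>p. free_path D n (set B) c p \<and> last p = t \<and> k < length p"
  \<comment> \<open>The exchange argument needs a shortest path among those that are long
    enough.\<close>
  then obtain p where p: "free_path D n (set B) c p" "last p = t" "k < length p"
    and min: "\<And>p'. free_path D n (set B) c p' \<Longrightarrow> last p' = t \<Longrightarrow> k < length p' \<Longrightarrow> length p \<le> length p'"
    using exists_least_iff[of "\<lambda>l. \<exists>p. free_path D n (set B) c p \<and> last p = t \<and> k < length p \<and> length p = l"]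
    by (metis linorder_not_less)
  define A v T where "A = take k p" and "v = p ! k" and "T = drop (Suc k) p"
  have pA: "p = A @ v # T" unfolding A_def v_def T_def using p(3) by (rule id_take_nth_drop)
  have lA: "length A = k" using p(3) by (simp add: A_def)
  \<comment> \<open>The last \<open>k\<close> vertices of the rest, or all of them if there are
    fewer; \<open>k\<close> vertices are all that the families can be asked to avoid.\<close>
  let ?Y = "set (drop (length T - k) T)"
  have "free_path D n (set B) c (rev (v # rev A))"
    using free_path_take[of D n "set B" c A v T] p(1) pA by simp
  moreover have "set (v # rev A) \<inter> ?Y = {}"
    using p(1) unfolding pA free_path_def by (auto dest: in_set_dropD)
  moreover have "card ?Y \<le> k" using card_length[of "drop (length T - k) T"] by simp
  ultimately obtain z where z: "z \<in> set ((level D [0..<n] B (k + k) ^^ k) [[c]])" "hd z = v" "set z \<inter> ?Y = {}"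
    using levels_represent[of D n B c "v # rev A" k ?Y "k + k"] lA by auto
  from levels_sound[OF c z(1)] have z': "length z = Suc k" "free_path D n (set B) c (rev z)" by auto
  then obtain A' where A': "z = v # rev A'" using z(2) by (cases z) (auto, metis rev_rev_ident)
  have "set A' \<inter> set T = {}"
  proof (rule shortest_exchange[of D n "set B" c A v T k A'])
    show "free_path D n (set B) c (A @ v # T)" "length A = k" using p(1) pA lA by auto
    show "length (A @ v # T) \<le> length p'" if "free_path D n (set B) c p'" "last p' = last (A @ v # T)"
      "k < length p'" for p'
      using min[OF that(1)] that p(2) pA by auto
  qed (use z' z(3) A' in auto)
  moreover have "walk D (v # T)" "distinct (v # T)" "set (v # T) \<inter> set B = {}" "set (v # T) \<subseteq> {..<n}"
    using p(1) unfolding pA free_path_def by (auto simp: successively_append_iff)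
  \<comment> \<open>So the \<open>n\<close> rounds of \<open>reach\<close> suffice for the whole
    rest of the path.\<close>
  moreover have "length (v # T) \<le> n"
    using card_mono[of "{..<n}" "set (v # T)"] distinct_card[OF calculation(3)] calculation(5) by simp
  ultimately have "last (v # T) \<in> set (reach D n (foldl (\<lambda>a x. x # a) B (rev A')) v)"
    unfolding reach_def
    by (intro reach_complete) (auto simp: set_foldl_Cons[where f = "\<lambda>x. x", simplified])
  moreover have "last (v # T) = t" using p(2) pA by auto
  ultimately show "long_path D n B k c t"
    unfolding long_path_iff_reach using z(1) A' by (intro bexI[of _ z]) auto
qed

section \<open>The program\<close>

definition flag :: "bool \<Rightarrow> val" where
  "flag b = N (if b then 1 else 0)"

definition natss :: "nat list list \<Rightarrow> val" where
  "natss L = val_list (map nats L)"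

definition arcs :: "(nat \<times> nat) list \<Rightarrow> val" where
  "arcs D = val_list (map (\<lambda>e. P (N (fst e)) (N (snd e))) D)"

lemma flag_eq_0 [simp]: "flag b = N 0 \<longleftrightarrow> \<not> b"
  by (simp add: flag_def)

lemma natss_simps [simp]: "natss [] = N 0" "natss (x # xs) = P (nats x) (natss xs)"
  by (simp_all add: natss_def)

lemma nats_eq_0 [simp]: "nats xs = N 0 \<longleftrightarrow> xs = []"
  by (cases xs) auto

lemma vhd_nats [simp]: "xs \<noteq> [] \<Longrightarrow> vhd (nats xs) = N (hd xs)"
  by (cases xs) auto

lemma vtl_nats [simp]: "vtl (nats xs) = nats (tl xs)"
  by (cases xs) auto

section \<open>Simulation and cost rules for loops\<close>

lemma vfold_sim:
  assumes "\<And>r A x. x \<in> set xs \<Longrightarrow> Inv A \<Longrightarrow> g r (h A) (f x) = h (F A x) \<and> t r (h A) (f x) \<le> T \<and> Inv (F A x)"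
    and "Inv A"
  shows "vfold g (val_list (map f xs)) (h A) = h (foldl F A xs) \<and>
    vfold_time g t (val_list (map f xs)) (h A) \<le> length xs * (T + 6) + 2"
  using assms
proof (induction xs arbitrary: A)
  case (Cons x xs)
  let ?r = "P (f x) (val_list (map f xs))"
  have 1: "g ?r (h A) (f x) = h (F A x)" "t ?r (h A) (f x) \<le> T" "Inv (F A x)"
    using Cons.prems by auto
  from Cons.IH[OF Cons.prems(1) 1(3)] 1 show ?case by simp
qed simp

text \<open>Data refinement: \<open>f\<close> and \<open>h\<close> encode list elements and
  accumulators, and \<open>F\<close> is the step on the decoded side. Value and cost are proved
  together because the cost of a round depends on size bounds for the current accumulator, which
  \<open>Inv\<close> provides.\<close>

lemma EFold_run:
  assumes "eval l env = val_list (map f xs)" "eval i (env @ [eval l env]) = h A" "Inv A"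
    and "\<And>r A x. x \<in> set xs \<Longrightarrow> Inv A \<Longrightarrow> eval b (env @ [r, h A, f x]) = h (F A x) \<and>
      tm b (env @ [r, h A, f x]) \<le> T \<and> Inv (F A x)"
    and "h (foldl F A xs) = v" "tm l env + tm i (env @ [eval l env]) + (length xs * (T + 6) + 2) \<le> C"
  shows "eval (EFold l i b) env = v \<and> tm (EFold l i b) env \<le> C"
  using vfold_sim[where xs = xs and g = "\<lambda>r a x. eval b (env @ [r, a, x])" and h = h and f = f and F = F
      and T = T and t = "\<lambda>r a x. tm b (env @ [r, a, x])" and Inv = Inv and A = A, OF assms(4,3)] assms(1,2,5,6)
  by simp

text \<open>The invariant is indexed by the number of rounds already done, running opposite to the
  counter. Later it is instantiated to equality with the j-th iterate, so that facts about the
  iterates become size bounds.\<close>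

lemma viter_sim:
  assumes "\<And>c j A. j < k \<Longrightarrow> Inv (j + i) A \<Longrightarrow> g (N c) (h A) = h (F A) \<and> t (N c) (h A) \<le> T \<and> Inv (Suc (j + i)) (F A)"
    and "Inv i A"
  shows "viter g k (h A) = h ((F ^^ k) A) \<and> viter_time g t k (h A) \<le> k * (T + 4) + 2"
  using assms
proof (induction k arbitrary: A i)
  case (Suc k)
  have 1: "g (N (Suc k)) (h A) = h (F A)" "t (N (Suc k)) (h A) \<le> T" "Inv (Suc i) (F A)"
    using Suc.prems(1)[of 0 A "Suc k"] Suc.prems(2) by auto
  have "viter g k (h (F A)) = h ((F ^^ k) (F A)) \<and> viter_time g t k (h (F A)) \<le> k * (T + 4) + 2"
  proof (rule Suc.IH[of "Suc i"])
    fix c j A' assume "j < k" "Inv (j + Suc i) A'"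
    then show "g (N c) (h A') = h (F A') \<and> t (N c) (h A') \<le> T \<and> Inv (Suc (j + Suc i)) (F A')"
      using Suc.prems(1)[of "Suc j" A' c] by simp
  qed (use 1 in auto)
  with 1 show ?case by (simp add: funpow_Suc_right del: funpow.simps)
qed simp

lemma EIter_run:
  assumes "eval n env = N k" "eval i (env @ [N k]) = h A" "Inv 0 A"
    and "\<And>c j A. j < k \<Longrightarrow> Inv j A \<Longrightarrow> eval b (env @ [N c, h A]) = h (F A) \<and>
      tm b (env @ [N c, h A]) \<le> T \<and> Inv (Suc j) (F A)"
    and "h ((F ^^ k) A) = v" "tm n env + tm i (env @ [N k]) + (k * (T + 4) + 2) \<le> C"
  shows "eval (EIter n i b) env = v \<and> tm (EIter n i b) env \<le> C"
  using viter_sim[where k = k and g = "\<lambda>c a. eval b (env @ [c, a])" and h = h and F = F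
      and T = T and t = "\<lambda>c a. tm b (env @ [c, a])" and Inv = Inv and A = A and i = 0] assms
  by simp

text \<open>One number \<open>M\<close> bounds all list lengths and counters, so each nested loop
  raises the exponent by one and its overhead goes into the coefficient. Membership, disjointness,
  finding a member, one round, a family, one level and all levels thus receive the exponents 1 to
  7.\<close>

lemma loop_bound:
  fixes l M T k k' c c' e e' :: nat
  assumes "l \<le> M" "1 \<le> M" "T \<le> c * M ^ e" "e' = Suc e" "c + k + k' \<le> c'"
  shows "l * (T + k) + k' \<le> c' * M ^ e'"
proof -
  have 1: "1 \<le> M ^ e" "1 \<le> M ^ Suc e" using one_le_power[OF assms(2)] by blast+
  have "T + k \<le> (c + k) * M ^ e"
    using assms(3) mult_le_mono2[OF 1(1), of k] unfolding add_mult_distrib mult_1_right by linarith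
  then have "l * (T + k) \<le> M * ((c + k) * M ^ e)" using assms(1) by (rule mult_le_mono[rotated])
  moreover have "k' \<le> k' * M ^ Suc e" using mult_le_mono2[OF 1(2), of k'] unfolding mult_1_right .
  moreover have "M * ((c + k) * M ^ e) + k' * M ^ Suc e = (c + k + k') * M ^ e'"
    by (simp add: algebra_simps assms(4))
  ultimately have "l * (T + k) + k' \<le> (c + k + k') * M ^ e'" by linarith
  also have "\<dots> \<le> c' * M ^ e'" using assms(5) by (rule mult_le_mono1)
  finally show ?thesis .
qed

text \<open>Calls are inlined: the arguments become the topmost variables and the callee counts its
  levels from the first of them. Arguments pushed earlier leave the levels in later ones
  unchanged.\<close>

definition call :: "exp \<Rightarrow> exp list \<Rightarrow> exp" where
  "call f es = foldr ELet es (ELocal (length es) f)"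

section \<open>The expressions of the program\<close>

abbreviation "TN \<equiv> TNat"
abbreviation "TNs \<equiv> TList TNat"
abbreviation "TNss \<equiv> TList (TList TNat)"
abbreviation "TArcs \<equiv> TList (TPair TNat TNat)"

text \<open>Subtraction is truncated, so the two differences are both zero only for equal
  numbers.\<close>

definition neq_exp :: exp where
  "neq_exp = EAdd (ESub (EVar 0) (EVar 1)) (ESub (EVar 1) (EVar 0))"

text \<open>How to read levels: in a loop with m variables in scope, the body of a fold finds the
  remaining list at level m, the accumulator at m + 1 and the element at m + 2; the body of an
  iteration finds the counter at m and the accumulator at m + 1. Here m is 2. Zero means
  false.\<close>

definition mem_exp :: exp where
  "mem_exp = EFold (EVar 1) (ENum 0) (EIf (call neq_exp [EVar 0, EVar 4]) (EVar 3) (ENum 1))"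

definition disj_exp :: exp where
  "disj_exp = EFold (EVar 1) (ENum 1) (EIf (call mem_exp [EVar 4, EVar 0]) (ENum 0) (EVar 3))"

definition find_exp :: exp where
  "find_exp = EFold (EVar 1) (ENil TNs) (EIf (call disj_exp [EVar 0, EVar 4]) (EVar 4) (EVar 3))"

definition arc_exp :: exp where
  "arc_exp = EFold (EVar 0) (ENum 0) (EIf (call neq_exp [EHd (EVar 5), EVar 1]) (EVar 4)
     (EIf (call neq_exp [ETl (EVar 5), EVar 2]) (EVar 4) (ENum 1)))"

definition round_exp :: exp where
  "round_exp = EFold (EVar 1) (ECons (ENil TNss) (EVar 2))
     (ELet (call find_exp [EVar 5, EVar 0]) (EIf (EVar 6)
       (ECons (EFold (EVar 6) (EHd (EVar 4)) (ECons (ECons (EVar 9) (EVar 5)) (EVar 8)))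
         (ECons (EVar 6) (ETl (EVar 4)))) (EVar 4)))"

definition rep_exp :: exp where
  "rep_exp = ETl (EIter (EAdd (EVar 1) (ENum 1)) (ECons (ECons (ENil TNs) (ENil TNss)) (ENil TNss))
     (call round_exp [EVar 0, EHd (EVar 3), ETl (EVar 3)]))"

definition cand_exp :: exp where
  "cand_exp = EFold (EVar 1) (ENil TNss) (EIf (call mem_exp [EVar 2, EVar 5]) (EVar 4)
     (EIf (call arc_exp [EVar 0, EVar 2, EHd (EVar 5)]) (ECons (ECons (EVar 2) (EVar 5)) (EVar 4)) (EVar 4)))"

definition app_exp :: exp where
  "app_exp = EFold (EVar 0) (EVar 1) (ECons (EVar 4) (EVar 3))"

definition level_exp :: exp where
  "level_exp = EFold (EVar 1) (ENil TNss) (EIf (call mem_exp [EVar 7, EVar 2]) (EVar 6)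
     (call app_exp [call rep_exp [call cand_exp [EVar 0, EVar 4, EVar 7], EVar 3], EVar 6]))"

definition levels_exp :: exp where
  "levels_exp = EIter (EVar 3) (ECons (ECons (EVar 4) (ENil TNs)) (ENil TNss))
     (call level_exp [EVar 0, EVar 1, EVar 2, EAdd (EVar 3) (EVar 3), EVar 6])"

definition reach_round_exp :: exp where
  "reach_round_exp = EFold (EVar 0) (EVar 2) (EIf (call mem_exp [ETl (EVar 5), EVar 4])
     (EIf (call mem_exp [EHd (EVar 5), EVar 4]) (EVar 4)
       (EIf (call mem_exp [EHd (EVar 5), EVar 1]) (EVar 4) (ECons (EHd (EVar 5)) (EVar 4)))) (EVar 4))"

definition reach_exp :: exp where
  "reach_exp = EIter (EVar 1) (ECons (EVar 3) (ENil TNs)) (call reach_round_exp [EVar 0, EVar 2, EVar 5])"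

definition range_exp :: exp where
  "range_exp = EIter (EVar 0) (ENil TNs) (ECons (ESub (EVar 1) (ENum 1)) (EVar 2))"

definition long_exp :: exp where
  "long_exp = EFold (call levels_exp [EVar 0, call range_exp [EVar 1], EVar 2, EVar 3, EVar 4]) (ENum 0)
     (EIf (call mem_exp [EVar 5, call reach_exp [EVar 0, EVar 1, call app_exp [ETl (EVar 8), EVar 2], EHd (EVar 8)]])
       (ENum 1) (EVar 7))"

definition len_exp :: exp where
  "len_exp = EFold (EVar 0) (ENum 0) (EAdd (EVar 2) (ENum 1))"

definition ok_exp :: exp where
  "ok_exp = EIf (call mem_exp [EVar 5, EVar 6]) (ENum 0)
     (EIf (EIf (EVar 6) (call arc_exp [EVar 0, EVar 5, EHd (EVar 6)])
         (EIf (call neq_exp [EVar 5, EVar 2]) (ENum 0) (ENum 1)))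
       (call long_exp [EVar 0, EVar 1, EVar 6, ESub (EVar 4) (call len_exp [EVar 6]), EVar 5, EVar 3])
       (ENum 0))"

text \<open>The state lists the next child to be tried, followed by the current path in reverse. The
  bindings give levels 2 to 8 the meaning n, s, t, k, arcs, child, path. The branches enter the
  child, skip it, return to the parent and try the next sibling, or stop with the null
  state.\<close>

definition step_exp :: exp where
  "step_exp = ELet (ETl (EHd (EVar 0))) (ELet (EHd (EHd (EVar 0))) (ELet (ETl (EHd (ETl (EVar 0))))
     (ELet (EHd (EHd (ETl (EVar 0)))) (ELet (ETl (ETl (EVar 0))) (ELet (EHd (EVar 1)) (ELet (ETl (EVar 1))
     (EIf (ESub (EVar 2) (EVar 7))
       (EIf (call ok_exp [EVar 6, EVar 2, EVar 3, EVar 4, EVar 5, EVar 7, EVar 8])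
         (ECons (EIf (call neq_exp [EVar 7, EVar 4]) (ENil TNs) (call app_exp [ECons (EVar 7) (EVar 8), ENil TNs]))
           (ECons (ENum 0) (ECons (EVar 7) (EVar 8))))
         (ECons (ENil TNs) (ECons (EAdd (EVar 7) (ENum 1)) (EVar 8))))
       (EIf (EVar 8) (ECons (ENil TNs) (ECons (EAdd (EHd (EVar 8)) (ENum 1)) (ETl (EVar 8))))
         (ECons (ENil TNs) (ENil TNs))))))))))"

text \<open>The accumulator pairs a pending number, stored as a list of at most one element, with
  the arcs completed so far.\<close>

definition parse_exp :: exp where
  "parse_exp = ETl (EFold (EVar 0) (ECons (ENil TNs) (ENil TArcs))
     (EIf (EHd (EVar 2)) (ECons (ENil TNs) (ECons (ECons (EHd (EHd (EVar 2))) (EVar 3)) (ETl (EVar 2))))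
       (ECons (ECons (EVar 3) (ENil TNs)) (ETl (EVar 2)))))"

definition init_exp :: exp where
  "init_exp = ECons (ENum 0) (ENil TNs)"

lemma infer_program:
  "infer parse_exp [TNs] = Some TArcs"
  "infer init_exp [TArcs] = Some TNs"
  "infer step_exp [TArcs, TNs] = Some (TPair TNs TNs)"
  by (simp_all add: parse_exp_def init_exp_def step_exp_def ok_exp_def len_exp_def long_exp_def
      range_exp_def reach_exp_def reach_round_exp_def levels_exp_def level_exp_def app_exp_def
      cand_exp_def rep_exp_def round_exp_def arc_exp_def find_exp_def disj_exp_def mem_exp_def
      neq_exp_def call_def)

section \<open>Correctness and cost of the expressions\<close>

lemma neq_exp: "eval neq_exp [N x, N y] = N 0 \<longleftrightarrow> x = y" "tm neq_exp [N x, N y] = 7"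
  by (auto simp: neq_exp_def)

lemma mem_exp:
  assumes "1 \<le> M" "length xs \<le> M"
  shows "eval mem_exp [N x, nats xs] = flag (x \<in> set xs) \<and> tm mem_exp [N x, nats xs] \<le> 30 * M"
proof -
  have "foldl (\<lambda>a y. if x = y then True else a) b xs \<longleftrightarrow> b \<or> x \<in> set xs" for b
    by (induction xs arbitrary: b) auto
  then show ?thesis unfolding mem_exp_def using assms
    by (intro EFold_run[where f = N and h = flag and F = "\<lambda>a y. if x = y then True else a" and A = False
          and T = 14 and Inv = "\<lambda>_. True" and xs = xs])
      (auto simp: nats_def call_def neq_exp flag_def)
qed

lemma disj_exp:
  assumes "1 \<le> M" "length A \<le> M" "length X \<le> M"
  shows "eval disj_exp [nats A, nats X] = flag (set X \<inter> set A = {}) \<and> tm disj_exp [nats A, nats X] \<le> 50 * M ^ 2"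
  unfolding disj_exp_def
proof (rule EFold_run[where f = N and h = flag and F = "\<lambda>a y. if y \<in> set A then False else a" and A = True
      and T = "38 * M" and Inv = "\<lambda>_. True" and xs = X], goal_cases)
  case (4 r b x)
  then show ?case using mem_exp[OF assms(1,2), of x] assms(1) by (auto simp: call_def flag_def)
next
  case 5
  have "foldl (\<lambda>a y. if y \<in> set A then False else a) b X \<longleftrightarrow> b \<and> set X \<inter> set A = {}" for b
    by (induction X arbitrary: b) auto
  then show ?case by simp
next
  case 6
  have "length X * (38 * M + 6) + 4 \<le> 50 * M ^ 2"
    by (rule loop_bound[where e = 1]) (use assms in auto)
  then show ?case by simp
qed (auto simp: nats_def flag_def)

lemma find_exp:
  assumes "1 \<le> M" "length A \<le> M" "length F \<le> M" "\<And>X. X \<in> set F \<Longrightarrow> length X \<le> M"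
  shows "eval find_exp [nats A, natss F] = nats (find_disjoint A F) \<and> tm find_exp [nats A, natss F] \<le> 70 * M ^ 3"
  unfolding find_exp_def
proof (rule EFold_run[where f = nats and h = nats and F = "\<lambda>acc X. if set X \<inter> set A = {} then X else acc" and A = "[]"
      and T = "58 * M ^ 2" and Inv = "\<lambda>_. True" and xs = F], goal_cases)
  case (4 r acc X)
  then show ?case
    using disj_exp[OF assms(1,2) assms(4), of X] one_le_power[OF assms(1), of 2] by (simp add: call_def)
next
  case 6
  have "length F * (58 * M ^ 2 + 6) + 4 \<le> 70 * M ^ 3"
    by (rule loop_bound[where e = 2]) (use assms in auto)
  then show ?case by simp
qed (auto simp: natss_def find_disjoint_def)

lemma arc_exp:
  assumes "1 \<le> M" "length D \<le> M"
  shows "eval arc_exp [arcs D, N v, N u] = flag ((v, u) \<in> set D) \<and> tm arc_exp [arcs D, N v, N u] \<le> 50 * M"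
proof -
  let ?F = "\<lambda>a e. if fst e = v then if snd e = u then True else a else a"
  have "foldl ?F b D \<longleftrightarrow> b \<or> (v, u) \<in> set D" for b
  proof (induction D arbitrary: b)
    case (Cons e D)
    then show ?case by (cases e) simp
  qed simp
  then show ?thesis unfolding arc_exp_def using assms
    by (intro EFold_run[where f = "\<lambda>e. P (N (fst e)) (N (snd e))" and h = flag and F = ?F and A = False
          and T = 34 and Inv = "\<lambda>_. True" and xs = D])
      (auto simp: arcs_def call_def neq_exp flag_def)
qed

lemma app_exp:
  assumes "1 \<le> M" "length xs \<le> M"
  shows "eval app_exp [val_list (map f xs), val_list (map f ys)] = val_list (map f (foldl (\<lambda>a x. x # a) ys xs)) \<and>
    tm app_exp [val_list (map f xs), val_list (map f ys)] \<le> 20 * M"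
  unfolding app_exp_def using assms
  by (intro EFold_run[where f = f and h = "\<lambda>zs. val_list (map f zs)" and F = "\<lambda>a x. x # a" and A = ys
        and T = 7 and Inv = "\<lambda>_. True" and xs = xs]) auto

lemma round_exp:
  assumes "1 \<le> M" "length F \<le> M" "\<And>X. X \<in> set F \<Longrightarrow> length X \<le> M"
    and "length fr \<le> M" "\<And>A. A \<in> set fr \<Longrightarrow> length A \<le> M"
  shows "eval round_exp [natss F, natss fr, natss out] =
      (case rep_round F (fr, out) of (a, b) \<Rightarrow> P (natss a) (natss b)) \<and>
    tm round_exp [natss F, natss fr, natss out] \<le> 170 * M ^ 4"
  unfolding round_exp_def
proof (rule EFold_run[where f = nats and h = "\<lambda>(a, b). P (natss a) (natss b)" and A = "([], out)"
      and F = "\<lambda>(fr', out') A. let X = find_disjoint A F in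
       if X = [] then (fr', out') else (foldl (\<lambda>fr'' x. (x # A) # fr'') fr' X, X # out')"
      and T = "140 * M ^ 3" and Inv = "\<lambda>_. True" and xs = fr], goal_cases)
  case (4 r ab A)
  then have lA: "length A \<le> M" using assms(5) by simp
  obtain a b where ab: "ab = (a, b)" by fastforce
  let ?X = "find_disjoint A F"
  let ?env = "[natss F, natss fr, natss out, r, P (natss a) (natss b), nats A, nats ?X]"
  let ?in = "EFold (EVar 6) (EHd (EVar 4)) (ECons (ECons (EVar 9) (EVar 5)) (EVar 8))"
  have f: "eval find_exp [nats A, natss F] = nats ?X" "tm find_exp [nats A, natss F] \<le> 70 * M ^ 3"
    using find_exp[OF assms(1) lA assms(2,3)] by auto
  have lX: "length ?X \<le> M" using length_find_disjoint assms(3) by blast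
  have inn: "eval ?in ?env = natss (foldl (\<lambda>fr'' x. (x # A) # fr'') a ?X) \<and> tm ?in ?env \<le> 30 * M"
    using assms(1) lX
    by (intro EFold_run[where f = N and h = natss and A = a and F = "\<lambda>fr'' x. (x # A) # fr''"
          and T = 13 and Inv = "\<lambda>_. True" and xs = ?X]) (auto simp: nats_def)
  have pw: "M \<le> M ^ 3" "1 \<le> M ^ 3" using one_le_power[OF assms(1), of 3] self_le_power[OF assms(1), of 3] by simp_all
  show ?case
    using f inn pw by (auto simp: ab call_def Let_def simp del: eval.simps(12) tm.simps(12))
next
  case 6
  have "length fr * (140 * M ^ 3 + 6) + 15 \<le> 170 * M ^ 4"
    by (rule loop_bound[where e = 3]) (use assms in auto)
  then show ?case by simp
qed (auto simp: natss_def rep_round_def)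

lemma rep_exp:
  assumes "1 \<le> p" "(p + 1) ^ Suc q \<le> M" "length F \<le> M" "\<And>X. X \<in> set F \<Longrightarrow> length X \<le> p"
  shows "eval rep_exp [natss F, N q] = natss (rep_family F q) \<and> tm rep_exp [natss F, N q] \<le> 220 * M ^ 5"
proof -
  \<comment> \<open>The lists of forbidden elements have up to \<open>q\<close> entries, so
    \<open>M\<close> has to bound \<open>q\<close> as well.\<close>
  have "Suc q < (p + 1) ^ Suc q"
    using assms(1) less_exp[of "Suc q"] power_mono[of 2 "p + 1" "Suc q"] by linarith
  then have qM: "Suc q \<le> M" using assms(2) by simp
  have "p + 1 \<le> (p + 1) ^ Suc q" by (rule self_le_power) auto
  then have pM: "p \<le> M" using assms(2) by simp
  have M: "1 \<le> M" using qM by simp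
  let ?body = "call round_exp [EVar 0, EHd (EVar 3), ETl (EVar 3)]"
  let ?init = "ECons (ECons (ENil TNs) (ENil TNss)) (ENil TNss)"
  let ?h = "\<lambda>(a, b). P (natss a) (natss b)"
  let ?it = "(rep_round F ^^ Suc q) ([[]], [])"
  have "eval (EIter (EAdd (EVar 1) (ENum 1)) ?init ?body) [natss F, N q] = ?h ?it \<and>
    tm (EIter (EAdd (EVar 1) (ENum 1)) ?init ?body) [natss F, N q] \<le> 218 * M ^ 5"
  \<comment> \<open>The invariant pins the state to the j-th iterate, which makes the bounds on size
    and depth of the search tree available in every round.\<close>
  proof (rule EIter_run[where k = "Suc q" and h = ?h and A = "([[]], [])" and F = "rep_round F"
        and T = "180 * M ^ 4" and Inv = "\<lambda>j ab. ab = (rep_round F ^^ j) ([[]], [])"], goal_cases)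
    case j: (4 c j ab)
    obtain a b where ab: "ab = (a, b)" by fastforce
    have "length a + length b \<le> (p + 1) ^ j" using rep_rounds_length[where r = j and F = F and p = p, OF assms(4)]
      unfolding j(2)[symmetric] ab by simp
    also have "\<dots> \<le> (p + 1) ^ Suc q" using j by (intro power_increasing) auto
    finally have la: "length a \<le> M" using assms(2) by simp
    have le: "length A \<le> M" if "A \<in> set a" for A
      using rep_rounds_element_length[where A = A and r = j and F = F, folded j(2), unfolded ab] that j(1) qM by simp
    have lF: "length X \<le> M" if "X \<in> set F" for X using assms(4)[OF that] pM by simp
    have "rep_round F ab = (rep_round F ^^ Suc j) ([[]], [])" using j(2) by simp
    with round_exp[OF M assms(3) lF la le, of b] show ?case
      using one_le_power[OF M, of 4] by (simp add: ab call_def)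
  next
    case 6
    have "Suc q * (180 * M ^ 4 + 4) + 30 \<le> 218 * M ^ 5"
      by (rule loop_bound[where e = 4]) (use qM in auto)
    then show ?case by simp
  qed auto
  then show ?thesis unfolding rep_exp_def rep_family_def
    using one_le_power[OF M, of 5]
    by (cases ?it) (auto simp del: eval.simps(13) tm.simps(13) funpow.simps)
qed

lemma cand_exp:
  assumes "1 \<le> M" "length D \<le> M" "length L \<le> M" "\<And>z. z \<in> set L \<Longrightarrow> z \<noteq> [] \<and> length z \<le> M"
  shows "eval cand_exp [arcs D, natss L, N v] = natss (candidates D L v) \<and>
    tm cand_exp [arcs D, natss L, N v] \<le> 140 * M ^ 2"
  unfolding cand_exp_def
proof (rule EFold_run[where f = nats and h = natss and A = "[]"
      and F = "\<lambda>acc z. if v \<in> set z then acc else if (v, hd z) \<in> set D then (v # z) # acc else acc"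
      and T = "120 * M" and Inv = "\<lambda>_. True" and xs = L], goal_cases)
  case (4 r acc z)
  then have z: "z \<noteq> []" "length z \<le> M" using assms(4) by auto
  show ?case
    using mem_exp[OF assms(1) z(2), of v] arc_exp[OF assms(1,2), of v "hd z"] assms(1) z(1)
    by (auto simp: call_def)
next
  case 6
  have "length L * (120 * M + 6) + 4 \<le> 140 * M ^ 2"
    by (rule loop_bound[where e = 1]) (use assms in auto)
  then show ?case by simp
qed (auto simp: natss_def candidates_def)

lemma length_rep_family:
  assumes "\<And>X. X \<in> set F \<Longrightarrow> length X \<le> p"
  shows "length (rep_family F q) \<le> (p + 1) ^ Suc q"
  using rep_rounds_length[where r = "Suc q" and F = F and p = p, OF assms] unfolding rep_family_def by linarith

lemma level_exp:
  assumes p: "1 \<le> p" "(p + 1) ^ Suc q \<le> M"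
    and "length D \<le> M" "length V \<le> M" "length B \<le> M" "length L \<le> M"
    and L: "\<And>z. z \<in> set L \<Longrightarrow> z \<noteq> [] \<and> length z < p"
  shows "eval level_exp [arcs D, nats V, nats B, N q, natss L] = natss (level D V B q L) \<and>
    tm level_exp [arcs D, nats V, nats B, N q, natss L] \<le> 470 * M ^ 6"
proof -
  have "p + 1 \<le> (p + 1) ^ Suc q" by (rule self_le_power) auto
  then have pM: "p \<le> M" and M: "1 \<le> M" using p by auto
  have lL: "z \<noteq> [] \<and> length z \<le> M" if "z \<in> set L" for z using L[OF that] pM by auto
  show ?thesis unfolding level_exp_def
  proof (rule EFold_run[where f = N and h = natss and A = "[]"
        and F = "\<lambda>acc v. if v \<in> set B then acc else foldl (\<lambda>a x. x # a) acc (rep_family (candidates D L v) q)"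
        and T = "450 * M ^ 5" and Inv = "\<lambda>_. True" and xs = V], goal_cases)
    case (4 r acc v)
    have c: "eval cand_exp [arcs D, natss L, N v] = natss (candidates D L v)"
      "tm cand_exp [arcs D, natss L, N v] \<le> 140 * M ^ 2"
      using cand_exp[OF M assms(3,6) lL] by auto
    have lc: "length X \<le> p" if "X \<in> set (candidates D L v)" for X
      using that L by (fastforce simp: candidates_set)
    have cl: "length (candidates D L v) \<le> M" using candidates_length[of D L v] assms(6) by simp
    have rf: "eval rep_exp [natss (candidates D L v), N q] = natss (rep_family (candidates D L v) q)"
      "tm rep_exp [natss (candidates D L v), N q] \<le> 220 * M ^ 5"
      using rep_exp[OF p cl lc] by auto
    have rl: "length (rep_family (candidates D L v) q) \<le> M"
      using length_rep_family[where q = q and F = "candidates D L v" and p = p, OF lc] p(2) by simp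
    have ap: "eval app_exp [natss (rep_family (candidates D L v) q), natss acc] =
        natss (foldl (\<lambda>a x. x # a) acc (rep_family (candidates D L v) q))"
      "tm app_exp [natss (rep_family (candidates D L v) q), natss acc] \<le> 20 * M"
      using app_exp[OF M rl, of nats acc] unfolding natss_def by auto
    have pw: "M \<le> M ^ 5" "M ^ 2 \<le> M ^ 5" "1 \<le> M ^ 5" 
      using one_le_power[OF M, of 5] self_le_power[OF M, of 5] power_increasing[OF _ M, of 2 5] by simp_all
    show ?case
      using mem_exp[OF M assms(5), of v] c rf ap pw by (auto simp: call_def)
  next
    case 6
    have "length V * (450 * M ^ 5 + 6) + 4 \<le> 470 * M ^ 6"
      by (rule loop_bound[where e = 5]) (use assms M in auto)
    then show ?case by simp
  qed (auto simp: nats_def level_def)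
qed

lemma le_of_mult_power:
  fixes n k M :: nat
  assumes "n * (k + 2) ^ j \<le> M"
  shows "n \<le> M"
proof -
  have "n * 1 \<le> n * (k + 2) ^ j" by (intro mult_le_mono2 one_le_power) simp
  with assms show ?thesis by linarith
qed

text \<open>There is one family for each of the \<open>n\<close> end vertices, formed from paths
  with at most k + 1 vertices for 2k forbidden ones. This number is the model for \<open>M\<close>
  in all later bounds.\<close>

lemma length_levels:
  assumes c: "c < n" "c \<notin> set B" and j: "j \<le> k"
  shows "length ((level D [0..<n] B (k + k) ^^ j) [[c]]) \<le> n * (k + 2) ^ Suc (k + k)"
  using j
proof (induction j)
  case 0
  have "1 * 1 \<le> n * (k + 2) ^ Suc (k + k)" using c(1) by (intro mult_le_mono) (auto simp: Suc_le_eq)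
  then show ?case by simp
next
  case (Suc j)
  let ?L = "(level D [0..<n] B (k + k) ^^ j) [[c]]"
  have "length (level D [0..<n] B (k + k) ?L) \<le> length [0..<n] * (k + 2) ^ Suc (k + k)"
  proof (rule level_length)
    fix v
    have "length X \<le> Suc k" if "X \<in> set (candidates D ?L v)" for X
      using that levels_sound[where i = j and D = D and q = "k + k", OF c] Suc.prems by (fastforce simp: candidates_set)
    from length_rep_family[where q = "k + k" and F = "candidates D ?L v" and p = "Suc k", OF this]
    show "length (rep_family (candidates D ?L v) (k + k)) \<le> (k + 2) ^ Suc (k + k)" by simp
  qed
  then show ?case by simp
qed

lemma levels_exp:
  assumes c: "c < n" "c \<notin> set B" and M: "n * (k + 2) ^ Suc (k + k) \<le> M" "length D \<le> M" "length B \<le> M"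
  shows "eval levels_exp [arcs D, nats [0..<n], nats B, N k, N c] = natss ((level D [0..<n] B (k + k) ^^ k) [[c]]) \<and>
    tm levels_exp [arcs D, nats [0..<n], nats B, N k, N c] \<le> 530 * M ^ 7"
proof -
  let ?w = "(k + 2) ^ Suc (k + k)"
  have w: "?w \<le> M" using M(1) c(1) by (intro le_trans[OF _ M(1)]) simp
  have nM: "n \<le> M" using M(1) by (rule le_of_mult_power)
  have kM: "k \<le> M" using w self_le_power[of "k + 2" "Suc (k + k)"] by linarith
  have M1: "1 \<le> M" using nM c by simp
  let ?f = "level D [0..<n] B (k + k)"
  show ?thesis unfolding levels_exp_def
  proof (rule EIter_run[where k = k and h = natss and A = "[[c]]" and F = ?f and T = "500 * M ^ 6"
        and Inv = "\<lambda>j L. L = (?f ^^ j) [[c]]"], goal_cases)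
    case j: (4 a j L)
    have L: "z \<noteq> [] \<and> length z < Suc k" if "z \<in> set L" for z
      using levels_sound[where z = z and i = j and D = D and q = "k + k", OF c] that j by auto
    have lL: "length L \<le> M" using length_levels[where j = j and k = k and D = D, OF c] j M(1) by simp
    have wp: "(Suc k + 1) ^ Suc (k + k) \<le> M" using w by simp
    show ?case
      using level_exp[OF _ wp M(2) _ M(3) lL L, of "[0..<n]"] nM one_le_power[OF M1, of 6] j by (simp add: call_def)
  next
    case 6
    have "k * (500 * M ^ 6 + 4) + 20 \<le> 530 * M ^ 7"
      by (rule loop_bound[where e = 6]) (use kM M1 in auto)
    then show ?case by simp
  qed auto
qed

lemma reach_bounds:
  assumes "fst ` set D \<subseteq> {..<n}" "v < n"
  shows "distinct ((reach_round D B ^^ j) [v])" "set ((reach_round D B ^^ j) [v]) \<subseteq> {..<n}"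
    "length ((reach_round D B ^^ j) [v]) \<le> n"
proof -
  show d: "distinct ((reach_round D B ^^ j) [v])"
    by (induction j) (auto intro: reach_round_distinct)
  have "set ((reach_round D B ^^ j) [v]) \<subseteq> insert v ({..<n} - set B)"
    using reach_sound[where D = D and n = n and i = j, OF assms(1)] by blast
  then show s: "set ((reach_round D B ^^ j) [v]) \<subseteq> {..<n}" using assms(2) by auto
  show "length ((reach_round D B ^^ j) [v]) \<le> n"
    using card_mono[OF _ s] distinct_card[OF d] by simp
qed

lemma reach_round_exp:
  assumes "1 \<le> M" "fst ` set D \<subseteq> {..<n}" "n \<le> M" "length D \<le> M" "length B \<le> M"
    "distinct R" "set R \<subseteq> {..<n}"
  shows "eval reach_round_exp [arcs D, nats B, nats R] = nats (reach_round D B R) \<and>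
    tm reach_round_exp [arcs D, nats B, nats R] \<le> 160 * M ^ 2"
proof -
  let ?f = "\<lambda>R e. if snd e \<in> set R then if fst e \<in> set R then R
     else if fst e \<in> set B then R else fst e # R else R"
  show ?thesis unfolding reach_round_exp_def
  proof (rule EFold_run[where f = "\<lambda>e. P (N (fst e)) (N (snd e))" and h = nats and A = R and F = ?f
        and T = "140 * M" and Inv = "\<lambda>R. distinct R \<and> set R \<subseteq> {..<n}" and xs = D], goal_cases)
    case (4 r R e)
    then have R: "distinct R \<and> set R \<subseteq> {..<n}" by simp
    have "fst e < n" using assms(2) 4(1) by auto
    moreover have "length R \<le> M"
      using card_mono[of "{..<n}" "set R"] distinct_card[of R] R assms(3) by simp
    ultimately show ?case
      using mem_exp[OF assms(1), of R "snd e"] mem_exp[OF assms(1), of R "fst e"]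
        mem_exp[OF assms(1,5), of "fst e"] assms(1) R
      by (simp add: call_def)
  next
    case 6
    have "length D * (140 * M + 6) + 4 \<le> 160 * M ^ 2"
      by (rule loop_bound[where e = 1]) (use assms in auto)
    then show ?case by simp
  qed (use assms in \<open>auto simp: arcs_def reach_round_def\<close>)
qed

lemma reach_exp:
  assumes "1 \<le> M" "fst ` set D \<subseteq> {..<n}" "n \<le> M" "length D \<le> M" "length B \<le> M" "v < n"
  shows "eval reach_exp [arcs D, N n, nats B, N v] = nats (reach D n B v) \<and>
    tm reach_exp [arcs D, N n, nats B, N v] \<le> 200 * M ^ 3"
  unfolding reach_exp_def
proof (rule EIter_run[where k = n and h = nats and A = "[v]" and F = "reach_round D B" and T = "170 * M ^ 2"
      and Inv = "\<lambda>j R. R = (reach_round D B ^^ j) [v]"], goal_cases)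
  case j: (4 a j R)
  have "distinct R" "set R \<subseteq> {..<n}" unfolding j(2) by (rule reach_bounds[OF assms(2,6)]; assumption)+
  from reach_round_exp[OF assms(1-5) this] one_le_power[OF assms(1), of 2] j(2)
  show ?case by (simp add: call_def)
next
  case 6
  have "n * (170 * M ^ 2 + 4) + 20 \<le> 200 * M ^ 3"
    by (rule loop_bound[where e = 2]) (use assms in auto)
  then show ?case by simp
qed (auto simp: reach_def)

lemma range_iter:
  "k \<le> n \<Longrightarrow> viter (\<lambda>c a. P (N (num c - Suc 0)) a) k (nats [k..<n]) = nats [0..<n] \<and>
    viter_time (\<lambda>c a. P (N (num c - Suc 0)) a) (\<lambda>c a. 9) k (nats [k..<n]) = k * 13 + 2"
proof (induction k)
  case (Suc k)
  then have "P (N k) (nats [Suc k..<n]) = nats [k..<n]" by (simp add: upt_conv_Cons)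
  with Suc show ?case by simp
qed simp

lemma range_exp:
  assumes "1 \<le> M" "n \<le> M"
  shows "eval range_exp [N n] = nats [0..<n] \<and> tm range_exp [N n] \<le> 20 * M"
  using range_iter[of n n] assms by (simp add: range_exp_def)

lemma long_exp:
  assumes c: "c < n" "c \<notin> set B" and M: "n * (k + 2) ^ Suc (k + k) \<le> M" "length D \<le> M" "length B \<le> n"
    and D: "fst ` set D \<subseteq> {..<n}"
  shows "eval long_exp [arcs D, N n, nats B, N k, N c, N t] = flag (long_path D n B k c t) \<and>
    tm long_exp [arcs D, N n, nats B, N k, N c, N t] \<le> 900 * M ^ 7"
proof -
  let ?L = "(level D [0..<n] B (k + k) ^^ k) [[c]]"
  let ?F = "\<lambda>acc X. if t \<in> set (reach D n (foldl (\<lambda>a x. x # a) B (tl X)) (hd X)) then True else acc"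
  \<comment> \<open>Room is needed for the prefix together with the \<open>k\<close> additional
    vertices that reachability has to avoid, hence \<open>n + k + 1 \<le> M\<close>.\<close>
  have "k + 2 \<le> (k + 2) ^ Suc (k + k)" by (rule self_le_power) auto
  then have "n * (k + 2) \<le> M" using M(1) by (meson le_trans mult_le_mono2)
  moreover have "n + k + 1 \<le> n * (k + 2)" using c(1) by (cases n) auto
  ultimately have nk: "n + k + 1 \<le> M" by simp
  then have M1: "1 \<le> M" and nM: "n \<le> M" and BM: "length B \<le> M" using M(3) by auto
  let ?env = "[arcs D, N n, nats B, N k, N c, N t]"
  let ?l = "call levels_exp [EVar 0, call range_exp [EVar 1], EVar 2, EVar 3, EVar 4]"
  have l: "eval ?l ?env = natss ?L" "tm ?l ?env \<le> 530 * M ^ 7 + 20 * M + 20"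
    using levels_exp[OF c M(1,2) BM] range_exp[OF M1 nM] by (simp_all add: call_def)
  show ?thesis unfolding long_exp_def
  proof (rule EFold_run[where f = nats and h = flag and A = False and F = ?F and T = "280 * M ^ 3"
        and Inv = "\<lambda>_. True" and xs = ?L], goal_cases)
    case (4 r acc X)
    from levels_sound[OF c 4(1)] have X: "length X = Suc k" "free_path D n (set B) c (rev X)" by auto
    then have X0: "X \<noteq> []" by auto
    have "set X \<subseteq> {..<n} - set B" using X(2) by (simp add: free_path_def)
    with hd_in_set[OF X0] have v: "hd X < n" by blast
    let ?B = "foldl (\<lambda>a x. x # a) B (tl X)"
    have lB: "length ?B \<le> M" using nk M(3) X(1) by (simp add: length_foldl_Cons[where f = "\<lambda>x. x"])
    have tX: "length (tl X) \<le> M" using X(1) nk by simp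
    have a: "eval app_exp [nats (tl X), nats B] = nats ?B" "tm app_exp [nats (tl X), nats B] \<le> 20 * M"
      using app_exp[OF M1 tX, of N B] by (simp_all add: nats_def)
    have rc: "eval reach_exp [arcs D, N n, nats ?B, N (hd X)] = nats (reach D n ?B (hd X))"
      "tm reach_exp [arcs D, N n, nats ?B, N (hd X)] \<le> 200 * M ^ 3"
      using reach_exp[OF M1 D nM M(2) lB v] by auto
    have lr: "length (reach D n ?B (hd X)) \<le> M"
      using reach_bounds(3)[where B = ?B and j = n, OF D v] nM by (simp add: reach_def)
    have pw: "M \<le> M ^ 3" "1 \<le> M ^ 3" using one_le_power[OF M1, of 3] self_le_power[OF M1, of 3] by simp_all
    show ?case
      using mem_exp[OF M1 lr, of t] a rc pw X0 by (auto simp: call_def flag_def)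
  next
    case 6
    have "length ?L \<le> M" using length_levels[where j = k and k = k and D = D, OF c] M(1) by simp
    then have "length ?L * (280 * M ^ 3 + 6) + 30 \<le> 320 * M ^ 4"
      by (intro loop_bound[where e = 3]) (use M1 in auto)
    moreover have "M ^ 4 \<le> M ^ 7" "M \<le> M ^ 7"
      using power_increasing[OF _ M1, of 4 7] self_le_power[OF M1, of 7] by simp_all
    ultimately show ?case using l(2) by simp
  qed (use l in \<open>auto simp: natss_def flag_def long_path_def\<close>)
qed

lemma len_exp:
  assumes "1 \<le> M" "length xs \<le> M"
  shows "eval len_exp [nats xs] = N (length xs) \<and> tm len_exp [nats xs] \<le> 20 * M"
proof -
  have "foldl (\<lambda>a y. Suc a) b xs = b + length xs" for b
    by (induction xs arbitrary: b) auto
  then show ?thesis unfolding len_exp_def using assms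
    by (intro EFold_run[where f = N and h = N and F = "\<lambda>a y. Suc a" and A = 0
          and T = 3 and Inv = "\<lambda>_. True" and xs = xs]) (auto simp: nats_def)
qed

text \<open>The list pre is the current path in reverse.\<close>
definition extendable :: "(nat \<times> nat) list \<Rightarrow> nat \<Rightarrow> nat \<Rightarrow> nat \<Rightarrow> nat \<Rightarrow> nat \<Rightarrow> nat list \<Rightarrow> bool" where
  "extendable D n s t k c pre \<longleftrightarrow> c \<notin> set pre \<and> (if pre = [] then c = s else (c, hd pre) \<in> set D) \<and>
     long_path D n pre (k - length pre) c t"

lemma ok_exp:
  assumes c: "c < n" and M: "n * (k + 2) ^ Suc (k + k) \<le> M" "length D \<le> M" "length pre \<le> n"
    and D: "fst ` set D \<subseteq> {..<n}"
  shows "eval ok_exp [arcs D, N n, N s, N t, N k, N c, nats pre] = flag (extendable D n s t k c pre) \<and>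
    tm ok_exp [arcs D, N n, N s, N t, N k, N c, nats pre] \<le> 1200 * M ^ 7"
proof -
  have nM: "n \<le> M" using M(1) by (rule le_of_mult_power)
  then have M1: "1 \<le> M" and pM: "length pre \<le> M" using c M(3) by auto
  let ?k = "k - length pre"
  \<comment> \<open>Below a prefix only the missing length is demanded; the bound for the full
    parameter covers it by monotonicity.\<close>
  have "(?k + 2) ^ Suc (?k + ?k) \<le> (k + 2) ^ Suc (?k + ?k)" by (intro power_mono) auto
  also have "\<dots> \<le> (k + 2) ^ Suc (k + k)" by (intro power_increasing) auto
  finally have Mk: "n * (?k + 2) ^ Suc (?k + ?k) \<le> M" using M(1) by (meson le_trans mult_le_mono2)
  have m: "eval mem_exp [N c, nats pre] = flag (c \<in> set pre)" "tm mem_exp [N c, nats pre] \<le> 30 * M"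
    using mem_exp[OF M1 pM] by auto
  have a: "eval arc_exp [arcs D, N c, N (hd pre)] = flag ((c, hd pre) \<in> set D)"
    "tm arc_exp [arcs D, N c, N (hd pre)] \<le> 50 * M"
    using arc_exp[OF M1 M(2)] by auto
  have l: "eval len_exp [nats pre] = N (length pre)" "tm len_exp [nats pre] \<le> 20 * M"
    using len_exp[OF M1 pM] by auto
  have g: "eval long_exp [arcs D, N n, nats pre, N ?k, N c, N t] = flag (long_path D n pre ?k c t)"
    "tm long_exp [arcs D, N n, nats pre, N ?k, N c, N t] \<le> 900 * M ^ 7" if "c \<notin> set pre"
    using long_exp[OF c that Mk M(2,3) D] by auto
  have pw: "M \<le> M ^ 7" "1 \<le> M ^ 7" using one_le_power[OF M1, of 7] self_le_power[OF M1, of 7] by simp_all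
  show ?thesis
  proof (cases "c \<in> set pre")
    case True
    then show ?thesis using m pw by (simp add: ok_exp_def call_def extendable_def) (simp add: flag_def)
  next
    case False
    note g = g[OF False]
    show ?thesis
    proof (cases "pre = []")
      case True
      then show ?thesis using m g pw l False
        by (cases "c = s") (simp_all add: ok_exp_def call_def extendable_def neq_exp, simp_all add: flag_def)
    next
      case pre: False
      then show ?thesis using m g pw l a False
        by (cases "(c, hd pre) \<in> set D")
          (simp_all add: ok_exp_def call_def extendable_def neq_exp, simp_all add: flag_def)
    qed
  qed
qed

text \<open>The parser treats the header like edges: in the reversed input, the numbers n, s, t, k
  yield the pairs \<open>(k, t)\<close> and \<open>(s, n)\<close>, which end up in front of the
  arcs.\<close>

definition graph :: "nat \<Rightarrow> nat \<Rightarrow> nat \<Rightarrow> nat \<Rightarrow> (nat \<times> nat) list \<Rightarrow> val" where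
  "graph n s t k D = arcs ((s, n) # (k, t) # D)"

lemma step_exp:
  assumes M: "n * (k + 2) ^ Suc (k + k) \<le> M" "length D \<le> M" "length pre \<le> n" "1 \<le> n"
    and D: "fst ` set D \<subseteq> {..<n}"
  shows "eval step_exp [graph n s t k D, nats (c # pre)] =
     (if c < n then if extendable D n s t k c pre
        then P (nats (if c = t then rev (c # pre) else [])) (nats (0 # c # pre))
        else P (nats []) (nats (Suc c # pre))
      else P (nats []) (nats (if pre = [] then [] else Suc (hd pre) # tl pre))) \<and>
    tm step_exp [graph n s t k D, nats (c # pre)] \<le> 1400 * M ^ 7"
proof -
  have nM: "n \<le> M" using M(1) by (rule le_of_mult_power)
  have M1: "1 \<le> M" using nM M(4) by simp
  \<comment> \<open>The path with the new vertex may have \<open>n + 1\<close> entries before the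
    test rejects it, and \<open>n + 1\<close> is at most \<open>2 * n\<close>.\<close>
  have "2 \<le> (k + 2) ^ Suc (k + k)" using self_le_power[of "k + 2" "Suc (k + k)"] by linarith
  then have "n * 2 \<le> M" using M(1) by (meson le_trans mult_le_mono2)
  then have pM: "length (c # pre) \<le> M" using M(3,4) by simp
  have pw: "M \<le> M ^ 7" "1 \<le> M ^ 7" using one_le_power[OF M1, of 7] self_le_power[OF M1, of 7] by simp_all
  have "foldl (\<lambda>a x. x # a) b xs = rev xs @ b" for b xs :: "nat list"
    by (induction xs arbitrary: b) auto
  then have ap: "eval app_exp [P (N c) (nats pre), N 0] = nats (rev (c # pre))"
    "tm app_exp [P (N c) (nats pre), N 0] \<le> 20 * M"
    using app_exp[OF M1 pM, of N "[]"] by (simp_all add: nats_def)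
  have env: "vtl (vhd (graph n s t k D)) = N n" "vhd (vhd (graph n s t k D)) = N s"
    "vtl (vhd (vtl (graph n s t k D))) = N t" "vhd (vhd (vtl (graph n s t k D))) = N k"
    "vtl (vtl (graph n s t k D)) = arcs D"
    by (simp_all add: graph_def arcs_def)
  show ?thesis
  proof (cases "c < n")
    case True
    note o = ok_exp[OF True M(1,2,3) D, of s t]
    show ?thesis using o pw ap True
      by (cases "c = t"; cases "extendable D n s t k c pre")
        (simp_all add: step_exp_def call_def env neq_exp)
  next
    case False
    then show ?thesis using pw by (simp add: step_exp_def env)
  qed
qed

lemma parse_exp:
  "eval parse_exp [nats (rev (encode n es s t k))] = graph n s t k (map prod.swap es) \<and>
    tm parse_exp [nats (rev (encode n es s t k))] \<le> 40 * length (encode n es s t k) + 40"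
proof -
  let ?F = "\<lambda>(pend, ps) x. case pend of None \<Rightarrow> (Some x, ps) | Some y \<Rightarrow> (None, (y, x) # ps)"
  let ?h = "\<lambda>(pend, ps). P (case pend of None \<Rightarrow> N 0 | Some y \<Rightarrow> nats [y]) (arcs ps)"
  let ?x = "rev (encode n es s t k)"
  let ?i = "ECons (ENil TNs) (ENil TArcs)"
  let ?b = "EIf (EHd (EVar 2)) (ECons (ENil TNs) (ECons (ECons (EHd (EHd (EVar 2))) (EVar 3)) (ETl (EVar 2))))
       (ECons (ECons (EVar 3) (ENil TNs)) (ETl (EVar 2)))"
  \<comment> \<open>In the reversed input the target of an edge precedes its source, so pairing
    consecutive numbers gives swapped pairs, and prepending them restores the order of
    \<open>es\<close>.\<close>
  have "foldl ?F (None, ps) (rev (concat (map (\<lambda>(u, v). [u, v]) es))) = (None, map prod.swap es @ ps)" for ps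
    by (induction es arbitrary: ps) auto
  then have f: "foldl ?F (None, []) ?x = (None, (s, n) # (k, t) # map prod.swap es)"
    by (simp add: encode_def)
  have "eval (EFold (EVar 0) ?i ?b) [nats ?x] = ?h (foldl ?F (None, []) ?x) \<and>
    tm (EFold (EVar 0) ?i ?b) [nats ?x] \<le> length ?x * (32 + 6) + 20"
  proof (rule EFold_run[where f = N and h = ?h and A = "(None, [])" and F = ?F and T = 32
        and Inv = "\<lambda>_. True" and xs = ?x])
    fix r and A :: "nat option \<times> (nat \<times> nat) list" and x
    obtain pend ps where A: "A = (pend, ps)" by fastforce
    show "eval ?b ([nats ?x] @ [r, ?h A, N x]) = ?h (?F A x) \<and> tm ?b ([nats ?x] @ [r, ?h A, N x]) \<le> 32 \<and> True"
      by (cases pend) (simp_all add: A arcs_def)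
  qed (auto simp: nats_def arcs_def)
  then show ?thesis unfolding f
    by (simp add: parse_exp_def graph_def del: eval.simps(12) tm.simps(12))
qed

section \<open>Depth-first search\<close>

lemma answers_iff:
  "p \<in> answers n es s t k \<longleftrightarrow> free_path (map prod.swap es) n {} s p \<and> last p = t \<and> k < length p"
proof -
  have "walk (map prod.swap es) p \<longleftrightarrow> (\<forall>i. Suc i < length p \<longrightarrow> (p ! i, p ! Suc i) \<in> set es)"
    by (auto simp: successively_conv_nth)
  moreover have "{0..<n} = {..<n}" by auto
  ultimately show ?thesis
    by (cases p) (auto simp: answers_def simple_path_def path_length_def free_path_def)
qed

lemma finite_answers: "finite (answers n es s t k)"
proof (rule finite_subset)
  show "answers n es s t k \<subseteq> {p. set p \<subseteq> {..<n} \<and> length p \<le> n}"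
  proof
    fix p assume "p \<in> answers n es s t k"
    then have p: "set p \<subseteq> {..<n}" "distinct p" by (auto simp: answers_iff free_path_def)
    from card_mono[OF _ p(1)] distinct_card[OF p(2)] p(1)
    show "p \<in> {p. set p \<subseteq> {..<n} \<and> length p \<le> n}" by simp
  qed
qed (simp add: finite_lists_length_le)

locale enumeration =
  fixes n :: nat and es :: "(nat \<times> nat) list" and s t k :: nat
  assumes wf: "wf_graph n es" and s: "s < n" and t: "t < n"
begin

abbreviation "D \<equiv> map prod.swap es"
abbreviation "ans \<equiv> answers n es s t k"

lemma D_bound: "fst ` set D \<subseteq> {..<n}"
  using wf by (auto simp: wf_graph_def)

definition stem :: "nat list \<Rightarrow> bool" where
  "stem pre \<longleftrightarrow> pre = [] \<or> free_path D n {} s (rev pre)"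

lemma stem_props:
  assumes "stem pre"
  shows "distinct pre" "set pre \<subseteq> {..<n}" "length pre \<le> n"
proof -
  show d: "distinct pre" "set pre \<subseteq> {..<n}" using assms by (auto simp: stem_def free_path_def)
  show "length pre \<le> n" using card_mono[OF _ d(2)] distinct_card[OF d(1)] by simp
qed

text \<open>An answer through the prefix splits at \<open>c\<close>: its second part avoids the
  prefix and must have at least \<open>k - length pre\<close> edges. Truncated subtraction is right
  here, as a prefix that is already long enough demands nothing more. Hence the search enters no
  dead end.\<close>

lemma extendable_iff:
  assumes pre: "stem pre" and c: "c < n"
  shows "extendable D n s t k c pre \<longleftrightarrow> (\<exists>q. rev pre @ c # q \<in> ans)"
proof
  assume e: "extendable D n s t k c pre"
  then have c': "c \<notin> set pre" "if pre = [] then c = s else (c, hd pre) \<in> set D"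
    "long_path D n pre (k - length pre) c t" by (auto simp: extendable_def)
  from c'(3) obtain p where p: "free_path D n (set pre) c p" "last p = t" "k - length pre < length p"
    using long_path_correct[OF c c'(1) D_bound] by blast
  then obtain q where q: "p = c # q" by (cases p) (auto simp: free_path_def)
  have "free_path D n {} s (rev pre @ c # q)"
  proof (cases "pre = []")
    case True
    with p c' q show ?thesis by (auto simp: free_path_def)
  next
    case False
    then show ?thesis using pre p(1) c' unfolding q free_path_def stem_def
      by (auto simp: successively_append_iff last_rev hd_append)
  qed
  then have "rev pre @ c # q \<in> ans" using p q by (auto simp: answers_iff)
  then show "\<exists>q. rev pre @ c # q \<in> ans" ..
next
  assume "\<exists>q. rev pre @ c # q \<in> ans"
  then obtain q where q: "free_path D n {} s (rev pre @ c # q)" "last (c # q) = t" "k < length pre + length (c # q)"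
    by (auto simp: answers_iff)
  have c': "c \<notin> set pre" using q(1) by (auto simp: free_path_def)
  have "free_path D n (set pre) c (c # q)"
    using q(1) unfolding free_path_def by (auto simp: successively_append_iff)
  moreover have "k - length pre < length (c # q)" using q(3) by auto
  ultimately have "long_path D n pre (k - length pre) c t"
    using q(2) long_path_correct[OF c c' D_bound] by blast
  moreover have "if pre = [] then c = s else (c, hd pre) \<in> set D"
    using q(1) unfolding free_path_def by (auto simp: successively_append_iff last_rev)
  ultimately show "extendable D n s t k c pre" using c' by (simp add: extendable_def)
qed

lemma stem_Cons:
  assumes "rev pre @ c # q \<in> ans"
  shows "stem (c # pre)"
  using assms free_path_take[of D n "{}" s "rev pre" c q] by (simp add: stem_def answers_iff)

text \<open>The answers still to come when the depth-first search looks at child c of the node pre: those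
  below pre with next vertex at least c, and those that branch off later at an ancestor.\<close>
definition below :: "nat \<Rightarrow> nat list \<Rightarrow> nat list set" where
  "below c pre = {p \<in> ans. \<exists>c' q. c \<le> c' \<and> p = rev pre @ c' # q}"

fun remaining :: "nat \<Rightarrow> nat list \<Rightarrow> nat list set" where
  "remaining c [] = below c []"
| "remaining c (a # pre) = below c (a # pre) \<union> remaining (Suc a) pre"

lemma remaining_below: "remaining c pre = below c pre \<union> (case pre of [] \<Rightarrow> {} | a # pre' \<Rightarrow> remaining (Suc a) pre')"
  by (cases pre) auto

lemma remaining_subset: "remaining c pre \<subseteq> ans"
  by (induction pre arbitrary: c) (auto simp: below_def)

lemma below_Suc: "below c pre = below (Suc c) pre \<union> {p \<in> ans. \<exists>q. p = rev pre @ c # q}"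
  by (auto simp: below_def Suc_le_eq order_le_less)

lemma below_Cons: "{p \<in> ans. \<exists>q. p = rev pre @ c # q} = below 0 (c # pre) \<union> ({rev pre @ [c]} \<inter> ans)"
proof -
  have "(\<exists>q. p = rev pre @ c # q) \<longleftrightarrow> (\<exists>c' q. p = rev pre @ c # c' # q) \<or> p = rev pre @ [c]" for p
    by (metis neq_Nil_conv)
  then show ?thesis by (auto simp: below_def)
qed

lemma below_large: "n \<le> c \<Longrightarrow> below c pre = {}"
  by (auto simp: below_def answers_iff free_path_def)

text \<open>The search follows the lexicographic order, so an answer through child \<open>c\<close>
  lies behind it once \<open>Suc c\<close> is next; the induction climbs to the ancestors. This is
  why no answer is output twice.\<close>

lemma not_remaining: "rev pre @ c # q \<notin> remaining (Suc c) pre"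
proof (induction pre arbitrary: c q)
  case (Cons a pre)
  from Cons[of a "c # q"] show ?case by (auto simp: below_def)
qed (auto simp: below_def)

lemma remaining_step: "remaining c pre = below 0 (c # pre) \<union> ({rev pre @ [c]} \<inter> ans) \<union> remaining (Suc c) pre"
  unfolding remaining_below[of c pre] remaining_below[of "Suc c" pre] below_Suc[of c pre] below_Cons[of pre c]
  by blast

text \<open>A potential for the rounds until the next output. If an answer lies below, the search
  scans siblings and descends at most \<open>n - length pre\<close> levels. Otherwise it first
  climbs up to \<open>length pre\<close> levels and may then have to descend \<open>n\<close>
  levels. Each level is charged \<open>n + 2\<close>, which exceeds the \<open>n\<close> rounds of
  scanning its siblings.\<close>

definition bound :: "nat \<Rightarrow> nat list \<Rightarrow> nat" where
  "bound c pre = (if below c pre \<noteq> {} then (n - length pre) * (n + 2) + (n - c)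
     else n * (n + 2) + length pre * (n + 2) + (n - c) + 1)"

lemma bound_le:
  assumes "stem pre"
  shows "bound c pre \<le> 2 * n * (n + 2) + n + 1"
proof -
  have "length pre * (n + 2) \<le> n * (n + 2)"
    using stem_props(3)[OF assms] by (rule mult_le_mono1)
  moreover have "(n - length pre) * (n + 2) \<le> n * (n + 2)" by (intro mult_le_mono1) simp
  moreover have "2 * n * (n + 2) = n * (n + 2) + n * (n + 2)" by simp
  ultimately show ?thesis unfolding bound_def by (cases "below c pre = {}") (simp_all del: distrib_left_numeral add_mult_distrib2)
qed

lemma push_search:
  assumes "stem pre" "c < n" "extendable D n s t k c pre" "c \<noteq> t"
  shows "stem (c # pre)" "remaining 0 (c # pre) = remaining c pre" "bound 0 (c # pre) < bound c pre"
proof -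
  obtain q where q: "rev pre @ c # q \<in> ans" using extendable_iff assms by blast
  then show st: "stem (c # pre)" by (rule stem_Cons)
  have nt: "rev pre @ [c] \<notin> ans" using assms(4) by (auto simp: answers_iff)
  show "remaining 0 (c # pre) = remaining c pre"
    by (subst (2) remaining_step) (use nt in simp)
  have "rev pre @ c # q \<in> below c pre" using q by (auto simp: below_def)
  \<comment> \<open>The answer through \<open>c\<close> goes on beyond \<open>c\<close>, so the node
    entered has an answer below it and is still in the first case of \<open>bound\<close>.\<close>
  moreover have "q \<noteq> []" using q nt by auto
  then have "rev pre @ c # q \<in> below 0 (c # pre)" using q by (cases q) (auto simp: below_def)
  moreover have "length pre < n" using stem_props(3)[OF st] by simp
  then have "(n - length pre) * (n + 2) = (n - Suc (length pre)) * (n + 2) + (n + 2)"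
    by (simp add: Suc_diff_Suc[symmetric])
  ultimately have "bound 0 (c # pre) = (n - Suc (length pre)) * (n + 2) + n"
    "bound c pre = (n - Suc (length pre)) * (n + 2) + (n + 2) + (n - c)"
    unfolding bound_def by (auto simp del: add_2_eq_Suc')
  then show "bound 0 (c # pre) < bound c pre" by linarith
qed

lemma output_search:
  assumes "stem pre" "c < n" "extendable D n s t k c pre" "c = t"
  shows "stem (c # pre)" "rev (c # pre) \<notin> remaining 0 (c # pre)"
    "remaining c pre = insert (rev (c # pre)) (remaining 0 (c # pre))"
proof -
  obtain q where q: "rev pre @ c # q \<in> ans" using extendable_iff assms by blast
  then show "stem (c # pre)" by (rule stem_Cons)
  \<comment> \<open>An answer ends in \<open>t\<close> and visits it only once, so the answer
    guaranteed by the test is the current path itself; its length needs no separate check.\<close>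
  have "q = []" using q assms(4) by (cases q rule: rev_cases) (auto simp: answers_iff free_path_def)
  with q have a: "rev pre @ [c] \<in> ans" by simp
  then show "remaining c pre = insert (rev (c # pre)) (remaining 0 (c # pre))"
    by (subst remaining_step) auto
  show "rev (c # pre) \<notin> remaining 0 (c # pre)"
    using not_remaining[of pre c "[]"] by (auto simp: below_def)
qed

lemma skip_search:
  assumes "stem pre" "c < n" "\<not> extendable D n s t k c pre"
  shows "remaining (Suc c) pre = remaining c pre" "bound (Suc c) pre < bound c pre"
proof -
  have e: "below c pre = below (Suc c) pre"
    using extendable_iff[OF assms(1,2)] assms(3) below_Suc[of c pre] by auto
  then show "remaining (Suc c) pre = remaining c pre" by (subst (1 2) remaining_below) simp
  show "bound (Suc c) pre < bound c pre" using assms(2) e unfolding bound_def by auto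
qed

lemma pop_search:
  assumes "stem (a # pre)" "n \<le> c"
  shows "stem pre" "a < n" "remaining (Suc a) pre = remaining c (a # pre)" "bound (Suc a) pre < bound c (a # pre)"
proof -
  show "a < n" using stem_props(2)[OF assms(1)] by simp
  show st: "stem pre"
  proof (cases pre)
    case (Cons b pre')
    then show ?thesis using assms(1) free_path_take[of D n "{}" s "rev pre'" b "[a]"]
      by (simp add: stem_def)
  qed (simp add: stem_def)
  show "remaining (Suc a) pre = remaining c (a # pre)" using below_large[OF assms(2)] by simp
  have "(n - length pre) * (n + 2) \<le> n * (n + 2)" by (intro mult_le_mono1) simp
  then show "bound (Suc a) pre < bound c (a # pre)"
    using below_large[OF assms(2), of "a # pre"] unfolding bound_def by auto
qed

lemma remaining_init: "remaining 0 [] = ans"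
proof -
  have "p \<noteq> []" if "p \<in> ans" for p using that by (auto simp: answers_iff free_path_def)
  then show ?thesis by (auto simp: below_def neq_Nil_conv)
qed

text \<open>A left inverse of \<open>nats\<close>, by which the remaining answers and the potential
  become functions of the machine value, as the generator theorem requires.\<close>

fun decode :: "val \<Rightarrow> nat list" where
  "decode (N m) = []"
| "decode (P x y) = num x # decode y"

lemma decode_nats [simp]: "decode (nats xs) = xs"
  by (induction xs) auto

definition live :: "val \<Rightarrow> bool" where
  "live S \<longleftrightarrow> (\<exists>c pre. S = nats (c # pre) \<and> stem pre \<and> c \<le> n)"

definition pending :: "val \<Rightarrow> nat list set" where
  "pending S = remaining (hd (decode S)) (tl (decode S))"

definition rank :: "val \<Rightarrow> nat" where
  "rank S = bound (hd (decode S)) (tl (decode S))"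

lemma pending_nats: "pending (nats (c # pre)) = remaining c pre"
  and rank_nats: "rank (nats (c # pre)) = bound c pre"
  by (simp_all only: pending_def rank_def decode_nats list.sel)

lemma step_search:
  assumes "live S" and M: "inst_size n es s t k * (k + 2) ^ Suc (k + k) = M"
  shows "\<exists>out S' rest. eval step_exp [graph n s t k D, S] = P (nats out) S' \<and>
    tm step_exp [graph n s t k D, S] + 6 * length out + 6 \<le> 1412 * M ^ 7 \<and>
    (S' = N 0 \<and> rest = {} \<or> live S' \<and> rest = pending S') \<and>
    (out = [] \<and> pending S = rest \<and> (S' = N 0 \<or> rank S' < rank S) \<or>
     out \<noteq> [] \<and> out \<notin> rest \<and> pending S = insert out rest)"
proof -
  from assms(1) obtain c pre where S: "S = nats (c # pre)" "stem pre" "c \<le> n" by (auto simp: live_def)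
  have SS: "pending S = remaining c pre" "rank S = bound c pre"
    unfolding S(1) by (rule pending_nats rank_nats)+
  have n: "1 \<le> n" using s by simp
  have nM: "n * (k + 2) ^ Suc (k + k) \<le> M" unfolding M[symmetric] inst_size_def by (intro mult_le_mono1) simp
  have "length (concat (map (\<lambda>(u, v). [u, v]) es)) = 2 * length es" by (induction es) auto
  then have "length D \<le> inst_size n es s t k" by (simp add: inst_size_def encode_def)
  moreover have iM: "inst_size n es s t k \<le> M" using le_of_mult_power[of "inst_size n es s t k" k "Suc (k + k)" M] M by simp
  ultimately have DM: "length D \<le> M" by simp
  have "n \<le> M" using nM by (rule le_of_mult_power)
  then have M1: "1 \<le> M" and pM: "n \<le> M" using n by auto
  have pw: "M \<le> M ^ 7" "1 \<le> M ^ 7" using one_le_power[OF M1, of 7] self_le_power[OF M1, of 7] by simp_all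
  note st = step_exp[OF nM DM stem_props(3)[OF S(2)] n D_bound, of s t c]
  \<comment> \<open>The constant is 1400 + 6 + 6: the step itself, at most 6n for the output, and
    the fixed 6.\<close>
  have time: "tm step_exp [graph n s t k D, S] + 6 * l + 6 \<le> 1412 * M ^ 7" if "l \<le> n" for l
    using st pw pM that S(1) by (simp del: nats_simps)
  \<comment> \<open>The common end of all cases in which the search goes on; the case distinction
    then only supplies the new state.\<close>
  have one: ?thesis if "eval step_exp [graph n s t k D, S] = P (nats out) (nats (c' # pre'))" "length out \<le> n"
    "stem pre'" "c' \<le> n" "out = [] \<longrightarrow> bound c' pre' < bound c pre"
    "out = [] \<and> remaining c pre = remaining c' pre' \<or>
      out \<noteq> [] \<and> out \<notin> remaining c' pre' \<and> remaining c pre = insert out (remaining c' pre')" for out c' pre'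
  proof -
    have "live (nats (c' # pre'))" unfolding live_def using that(3,4) by blast
    with that time[OF that(2)] show ?thesis
      unfolding SS by (intro exI[of _ out] exI[of _ "nats (c' # pre')"] exI[of _ "remaining c' pre'"])
        (auto simp only: pending_nats rank_nats)
  qed
  show ?thesis
  proof (cases "c < n")
    case True
    show ?thesis
    proof (cases "extendable D n s t k c pre")
      case ext: True
      show ?thesis
      proof (cases "c = t")
        case ct: True
        note o = output_search[OF S(2) True ext ct]
        have "length (rev (c # pre)) \<le> n" using stem_props(3)[OF o(1)] by simp
        with one[of "rev (c # pre)" 0 "c # pre"] o st True ext ct S(1) show ?thesis
          by (simp del: nats_simps remaining.simps)
      next
        case False
        with one[of "[]" 0 "c # pre"] push_search[OF S(2) True ext False] st True ext S(1) show ?thesis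
          by (simp del: nats_simps remaining.simps)
      qed
    next
      case ext: False
      with one[of "[]" "Suc c" pre] skip_search[OF S(2) True ext] st True S show ?thesis
        by (simp del: nats_simps remaining.simps)
    qed
  next
    case False
    then have cn: "n \<le> c" by simp
    show ?thesis
    proof (cases pre)
      case Nil
      then have r: "remaining c pre = {}" using below_large[OF cn] by simp
      have "eval step_exp [graph n s t k D, S] = P (nats []) (N 0)" using st False Nil S(1) by simp
      with time[of 0] r SS(1) show ?thesis
        by (intro exI[of _ "[]"] exI[of _ "N 0"] exI[of _ "{}"]) (simp del: nats_simps)
    next
      case (Cons a pre')
      have "stem (a # pre')" using S(2) Cons by simp
      from one[of "[]" "Suc a" pre'] pop_search[OF this cn] st False Cons S(1) show ?thesis
        by (simp del: nats_simps remaining.simps)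
    qed
  qed
qed

lemma enumerates:
  assumes M: "inst_size n es s t k * (k + 2) ^ Suc (k + k) = M"
    and R: "12 + maxreg parse_exp 6 + maxreg init_exp 7 + maxreg step_exp 8 = R"
  shows "enumerates_with_delay (generator parse_exp init_exp step_exp) (encode n es s t k) ans ((4 * R + 20000) * M ^ 9)"
proof -
  let ?x = "encode n es s t k" and ?G = "graph n s t k D"
  have px: "eval parse_exp [nats (rev ?x)] = ?G" "tm parse_exp [nats (rev ?x)] \<le> 40 * length ?x + 40"
    using parse_exp by blast+
  have i: "eval init_exp [?G] = nats [0]" "tm init_exp [?G] = 7" by (simp_all add: init_exp_def)
  \<comment> \<open>This is the value from \<open>bound_le\<close>. Since \<open>?K + 2\<close> is
    at most 10 M^2, the rounds cost at most 14120 M^9; the rest of the 20000 absorbs reading and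
    parsing.\<close>
  let ?K = "2 * n * (n + 2) + n + 1"
  have "enumerates_with_delay (generator parse_exp init_exp step_exp) ?x (pending (eval init_exp [?G]))
    ((4 * R + 20000) * M ^ 9)"
  proof (rule generator_correct[where Inv = live and rest_of = pending and Phi = rank and K = ?K and D = "1412 * M ^ 7",
        OF infer_program _ _ _ step_search[OF _ M]])
    show "?x \<noteq> []" by (simp add: encode_def)
    show "?G = eval parse_exp [nats (rev ?x)]" using px by simp
  next
    fix S assume "live S"
    then obtain c pre where S: "S = nats (c # pre)" "stem pre" by (auto simp: live_def)
    show "S \<noteq> N 0 \<and> finite (pending S) \<and> rank S \<le> ?K \<and> vty S TNs"
      using bound_le[OF S(2), of c] finite_subset[OF remaining_subset finite_answers]
      unfolding S(1) pending_nats rank_nats by (auto simp del: nats_simps)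
  next
    show "live (eval init_exp [?G])" unfolding i(1) live_def
      by (intro exI[of _ 0] exI[of _ "[]"]) (simp add: stem_def)
  next
    have lM: "length ?x + n \<le> M"
      using le_of_mult_power[of "inst_size n es s t k" k "Suc (k + k)" M] M by (simp add: inst_size_def)
    then have M1: "1 \<le> M" and nM: "n \<le> M" using s by auto
    have pw: "M \<le> M ^ 9" "1 \<le> M ^ 9" using one_le_power[OF M1, of 9] self_le_power[OF M1, of 9] by simp_all
    have "n * (n + 2) \<le> M * (M + 2)" using nM by (intro mult_le_mono) auto
    also have "\<dots> = M ^ 2 + 2 * M" by (simp add: power2_eq_square)
    finally have n2: "n * (n + 2) \<le> M ^ 2 + 2 * M" .
    have "2 * a + n + 1 + 2 \<le> 2 * b + M + 3" if "a \<le> b" for a b using that nM by linarith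
    from this[OF n2] have "?K + 2 \<le> 2 * (M ^ 2 + 2 * M) + M + 3" unfolding mult.assoc .
    also have "\<dots> \<le> 10 * M ^ 2" using one_le_power[OF M1, of 2] self_le_power[OF M1, of 2] by simp
    finally have "(?K + 2) * (1412 * M ^ 7) \<le> 10 * M ^ 2 * (1412 * M ^ 7)" by (rule mult_le_mono1)
    also have "\<dots> = 14120 * M ^ 9" by (simp flip: power_add)
    finally have K: "(?K + 2) * (1412 * M ^ 7) \<le> 14120 * M ^ 9" .
    have "4 * R * 1 \<le> 4 * R * M ^ 9" using pw(2) by (rule mult_le_mono2)
    then have "4 * R + 20 + 15 * length ?x + (40 * length ?x + 40) + 7 + 14120 * M ^ 9 \<le> (4 * R + 20000) * M ^ 9"
      using pw lM unfolding add_mult_distrib by linarith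
    then show "4 * (12 + maxreg parse_exp 6 + maxreg init_exp 7 + maxreg step_exp 8) + 20 + 15 * length ?x +
      tm parse_exp [nats (rev ?x)] + tm init_exp [?G] + (?K + 2) * (1412 * M ^ 7) \<le> (4 * R + 20000) * M ^ 9"
      unfolding R i(2) by (rule le_trans[rotated]) (intro add_mono order_refl px(2) K)
  qed
  then show ?thesis unfolding i(1) pending_nats remaining_init .
qed

end

section \<open>Computability and size of the parameter function\<close>

definition power_exp :: "exp \<Rightarrow> exp" where
  "power_exp e = EIter e (ENum 1) (EAdd (EVar 3) (EVar 3))"

lemma viter_double: "viter (\<lambda>c a. N (num a + num a)) m (N x) = N (2 ^ m * x)"
  by (induction m arbitrary: x) (simp_all add: algebra_simps mult_2)

text \<open>The generator construction is reused with a single round: the state \<open>N 1\<close>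
  emits the value and is followed by the null state.\<close>

lemma computable_double_exponential: "computable (\<lambda>k. 2 ^ (2 ^ (2 * k + c)))"
proof -
  \<comment> \<open>The expression runs with two variables in scope, so the accumulator in
    \<open>power_exp\<close> is at level 3. This also holds for the nested use, as the count of an
    iteration is evaluated before anything is pushed.\<close>
  define s where "s = ECons (ECons (power_exp (power_exp (EAdd (EAdd (EHd (EVar 0)) (EHd (EVar 0))) (ENum c))))
    (ENil TNs)) (ENum 0)"
  have ty: "infer s [TNs, TN] = Some (TPair TNs TN)" by (simp add: s_def power_exp_def)
  have "\<exists>T. halted (generator (EVar 0) (ENum 1) s) (conf_at (generator (EVar 0) (ENum 1) s) [k] T) \<and>
    outputs_until (generator (EVar 0) (ENum 1) s) [k] T = [[2 ^ (2 ^ (2 * k + c))]]" for k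
  proof -
    let ?f = "2 ^ (2 ^ (2 * k + c)) :: nat"
    have ev: "eval s [nats [k], N 1] = P (nats [?f]) (N 0)"
      by (simp add: s_def power_exp_def viter_double mult_2)
    define B where "B = 4 * (12 + maxreg (EVar 0) 6 + maxreg (ENum 1) 7 + maxreg s 8) + 20 + 15 * length [k] +
      tm (EVar 0) [nats (rev [k])] + tm (ENum 1) [nats [k]] + (0 + 2) * (tm s [nats [k], N 1] + 12)"
    have "enumerates_with_delay (generator (EVar 0) (ENum 1) s) [k]
      ((\<lambda>_. {[?f]}) (eval (ENum 1) [nats [k]])) B"
      by (rule generator_correct[where Inv = "\<lambda>S. S = N 1" and Phi = "\<lambda>_. 0" and K = 0 and
            D = "tm s [nats [k], N 1] + 12" and tg = TNs and ts = TN and G = "nats [k]"])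
        (use ty ev in \<open>auto simp: B_def\<close>)
    then obtain T where T: "halted (generator (EVar 0) (ENum 1) s) (conf_at (generator (EVar 0) (ENum 1) s) [k] T)"
      "distinct (outputs_until (generator (EVar 0) (ENum 1) s) [k] T)"
      "set (outputs_until (generator (EVar 0) (ENum 1) s) [k] T) = {[?f]}"
      unfolding enumerates_with_delay_def by auto
    then have "length (outputs_until (generator (EVar 0) (ENum 1) s) [k] T) = 1"
      using distinct_card by fastforce
    with T show ?thesis by (auto simp: length_Suc_conv)
  qed
  then show ?thesis unfolding computable_def by blast
qed

text \<open>As k + 2 is at most 2^(k + 1), the power is at most 2 to the 9(k + 1)(2k + 1), and this
  exponent is at most 18(k + 1)^2, hence at most 18 * 4^k. The factor \<open>C\<close> costs another
  \<open>C\<close> in the exponent, and \<open>C + 18\<close> is below 2^(C + 18).\<close>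

lemma double_exponential_bound: "C * ((k + 2) ^ Suc (k + k)) ^ 9 \<le> (2::nat) ^ (2 ^ (2 * k + (C + 18)))"
proof -
  have k: "k + 1 \<le> 2 ^ k" using less_exp[of k] by (simp add: Suc_le_eq)
  then have k2: "k + 2 \<le> 2 ^ (k + 1)" by simp
  have "((k + 2) ^ Suc (k + k)) ^ 9 = (k + 2) ^ (Suc (k + k) * 9)" by (simp only: power_mult)
  also have "\<dots> \<le> (2 ^ (k + 1)) ^ (Suc (k + k) * 9)" using k2 by (rule power_mono) simp
  also have "\<dots> = 2 ^ ((k + 1) * (Suc (k + k) * 9))" by (simp only: power_mult)
  finally have "C * ((k + 2) ^ Suc (k + k)) ^ 9 \<le> 2 ^ C * 2 ^ ((k + 1) * (Suc (k + k) * 9))"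
    using less_exp[of C] by (intro mult_le_mono) auto
  also have "\<dots> = 2 ^ (C + (k + 1) * (Suc (k + k) * 9))" by (simp only: power_add)
  also have "\<dots> \<le> 2 ^ (2 ^ (2 * k + (C + 18)))"
  proof (rule power_increasing)
    have "(k + 1) * (k + 1) \<le> 2 ^ k * 2 ^ k" using k by (intro mult_le_mono)
    then have kk: "(k + 1) * (k + 1) \<le> 2 ^ (2 * k)" by (simp add: mult_2 power_add)
    have "(k + 1) * (Suc (k + k) * 9) \<le> 18 * ((k + 1) * (k + 1))" by (simp add: algebra_simps)
    also have "\<dots> \<le> 18 * 2 ^ (2 * k)" using kk by (rule mult_le_mono2)
    finally have 1: "(k + 1) * (Suc (k + k) * 9) \<le> 18 * 2 ^ (2 * k)" .
    have "C * 1 \<le> C * 2 ^ (2 * k)" by (intro mult_le_mono2) simp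
    then have "C + (k + 1) * (Suc (k + k) * 9) \<le> (C + 18) * 2 ^ (2 * k)" using 1 unfolding add_mult_distrib by linarith
    also have "\<dots> \<le> 2 ^ (C + 18) * 2 ^ (2 * k)" using less_exp[of "C + 18"] by (intro mult_le_mono1) simp
    also have "\<dots> = 2 ^ (2 * k + (C + 18))" by (simp add: power_add)
    finally show "C + (k + 1) * (Suc (k + k) * 9) \<le> 2 ^ (2 * k + (C + 18))" .
  qed simp
  finally show ?thesis .
qed

lemma enumerates_with_delay_mono:
  "enumerates_with_delay Pr x S B \<Longrightarrow> B \<le> B' \<Longrightarrow> enumerates_with_delay Pr x S B'"
  unfolding enumerates_with_delay_def by (elim exE, rule exI) (blast intro: le_trans)

theorem mainTheorem15:
  shows "\<exists>P f c. computable f \<and>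
    (\<forall>n es s t k. wf_graph n es \<and> s < n \<and> t < n \<longrightarrow>
       enumerates_with_delay P (encode n es s t k) (answers n es s t k)
         (f k * inst_size n es s t k ^ c))"
proof -
  define C where "C = 4 * (12 + maxreg parse_exp 6 + maxreg init_exp 7 + maxreg step_exp 8) + 20000"
  define f :: "nat \<Rightarrow> nat" where "f = (\<lambda>k. 2 ^ (2 ^ (2 * k + (C + 18))))"
  have "enumerates_with_delay (generator parse_exp init_exp step_exp) (encode n es s t k) (answers n es s t k)
      (f k * inst_size n es s t k ^ 9)" if "wf_graph n es" "s < n" "t < n" for n es s t k
  proof -
    interpret enumeration n es s t k by unfold_locales (fact that)+
    let ?x = "inst_size n es s t k" and ?w = "(k + 2) ^ Suc (k + k)"
    \<comment> \<open>\<open>M\<close> is a product of the input size and a function of the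
      parameter, so its ninth power separates into the two required factors.\<close>
    have "C * (?x * ?w) ^ 9 = C * ?w ^ 9 * ?x ^ 9" by (simp only: power_mult_distrib mult_ac)
    also have "\<dots> \<le> f k * ?x ^ 9" unfolding f_def by (intro mult_le_mono1 double_exponential_bound)
    finally show ?thesis
      using enumerates[OF refl refl] enumerates_with_delay_mono unfolding C_def by blast
  qed
  moreover have "computable f" unfolding f_def by (rule computable_double_exponential)
  ultimately show ?thesis by blast
qed

end
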